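(* For any integer partitions $\lambda,\mu$ with $|\lambda|+|\mu|\le N$, one has, for $U$ in $U(N)$ under the Haar measure, $$p_{[\lambda,\mu]}(U)=\;:p_\lambda(U)\,p_\mu(U^{-1}):\,.$$
   Context: **Newton polynomials.** $V=\mathbb C^N$; for a partition $\lambda$, $p_\lambda(U)=\prod_{i}p_{\lambda_i}(U)$ where $p_k(U)=\mathrm{Tr}(U^k)$, and $p_\emptyset=1$. Let $T_{n,m}=V^{\otimes n}\otimes(V^* )^{\otimes m}$ with the diagonal action $\rho_{n,m}$ of $U(N)$ and the action $\rho_N$ of $S_n\times S_m$ permuting factors, and let $\overset{\circ}{T}_{n,m}$ be the subspace of traceless tensors (killed by all contractions of a $V$ factor with a $V^*$ factor). For $n,m\ge1$, $\alpha\in S_n$, $\beta\in S_m$ set $p_{[\alpha,\beta]}(U)=\mathrm{Tr}_{\overset{\circ}{T}_{n,m}}(\rho_N(\alpha\times\beta)\rho_{n,m}(U))$; it only depends on the cycle types $\lambda\vdash n$ of $\alpha$ and $\mu\vdash m$ of $\beta$, and is also denoted $p_{[\lambda,\mu]}$. By convention $p_{[\emptyset,\emptyset]}=1$, $p_{[\lambda,\emptyset]}=p_\lambda$, $p_{[\emptyset,\mu]}=\overline{p_\mu}$. **Wick product.** For random variables $X_1,\dots,X_k$ on the same probability space such that all $\mathbb E[\prod_{i\in S}|X_i|]$, $S\subset\{1,\dots,k\}$, are finite, $:X_1\cdots X_k:\,=P(X_1,\dots,X_k)$ where the polynomial $P=P_{X_1,\dots,X_k}\in\mathbb C[Y_1,\dots,Y_k]$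 is defined recursively by $\partial_{Y_i}P_{X_1,\dots,X_k}=P_{X_1,\dots,\hat X_i,\dots,X_k}$ for all $i$ (the $i$-th variable being omitted; the empty Wick product is $1$) and $\mathbb E[P(X_1,\dots,X_k)]=0$. Here $:p_\lambda(U)p_\mu(U^{-1}):$ is the Wick product, for $U$ Haar distributed on $U(N)$, of the family of random variables $p_{\lambda_1}(U),p_{\lambda_2}(U),\dots,p_{\lambda_{\ell(\lambda)}}(U),p_{\mu_1}(U^{-1}),\dots,p_{\mu_{\ell(\mu)}}(U^{-1})$. *)

theory Defs
  imports
    "HOL-Probability.Probability"
    "HOL-Combinatorics.Orbits"
    "HOL-Library.Function_Algebras"
    "HOL-Library.Poly_Mapping"
begin

section \<open>The unitary group and its Haar measure\<close>

definition conj_transpose :: "complex^'n^'m \<Rightarrow> complex^'m^'n" where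
  "conj_transpose A = (\<chi> i j. cnj (A $ j $ i))"

definition unitary_group :: "(complex^'n^'n) set" where
  "unitary_group = {U. conj_transpose U ** U = mat 1 \<and> U ** conj_transpose U = mat 1}"

text \<open>
  The condition on the \<open>\<sigma>\<close>-algebra also determines \<^term>\<open>space M\<close>, which is the unitary group.
  By existence and uniqueness of the normalised Haar measure of a compact group, exactly one
  \<open>M\<close> satisfies this predicate.
\<close>

definition haar_measure_unitary :: "(complex^'n^'n) measure \<Rightarrow> bool" where
  "haar_measure_unitary M \<longleftrightarrow>
     prob_space M \<and>
     sets M = sets (restrict_space borel unitary_group) \<and>
     (\<forall>V\<in>unitary_group. distr M M (\<lambda>U. V ** U) = M)"


section \<open>Partitions and power sums\<close>

definition int_partition :: "nat list \<Rightarrow> bool" where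
  "int_partition l \<longleftrightarrow> sorted_wrt (\<ge>) l \<and> (\<forall>k\<in>set l. 0 < k)"

text \<open>
  The type class operation \<open>^\<close> on \<open>complex^'n^'n\<close> is the entrywise power, so the matrix
  power is written as an iterated matrix product.
\<close>

definition power_sum :: "nat \<Rightarrow> complex^'n^'n \<Rightarrow> complex" where
  "power_sum k U = trace ((((**) U) ^^ k) (mat 1))"

definition power_sums :: "nat list \<Rightarrow> complex^'n^'n \<Rightarrow> complex" where
  "power_sums l U = (\<Prod>k\<leftarrow>l. power_sum k U)"


section \<open>Trace of an endomorphism of a finite-dimensional subspace\<close>

text \<open>
  Meaningful for a finite-dimensional subspace \<open>W\<close> and an \<open>f\<close> that is linear on \<open>W\<close> and maps
  \<open>W\<close> to itself; the value then does not depend on the chosen basis.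
\<close>

definition (in vector_space) trace_on :: "'b set \<Rightarrow> ('b \<Rightarrow> 'b) \<Rightarrow> 'a" where
  "trace_on W f = (let B = (SOME B. independent B \<and> span B = W)
                   in \<Sum>b\<in>B. representation B (f b) b)"

global_interpretation cfun: vector_space "\<lambda>(c::complex) (f :: 'a \<Rightarrow> complex) x. c * f x"
  by unfold_locales (auto simp: fun_eq_iff algebra_simps)


section \<open>Mixed tensors\<close>

text \<open>
  With \<open>V = complex^'n\<close>, an element of \<open>T\<^bsub>n,m\<^esub> = V\<^sup>\<otimes>\<^sup>n \<otimes> (V\<^sup>*)\<^sup>\<otimes>\<^sup>m\<close> is given by its coordinates: the value of \<open>t\<close>
  at \<open>([i\<^sub>1, \<dots>, i\<^sub>n], [j\<^sub>1, \<dots>, j\<^sub>m])\<close> is the coefficient of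
  \<open>e\<^bsub>i\<^sub>1\<^esub> \<otimes> \<dots> \<otimes> e\<^bsub>i\<^sub>n\<^esub> \<otimes> e\<^sup>*\<^bsub>j\<^sub>1\<^esub> \<otimes> \<dots> \<otimes> e\<^sup>*\<^bsub>j\<^sub>m\<^esub>\<close>, and \<open>t\<close> vanishes at all other pairs of lists.
\<close>

type_synonym 'n tensor = "'n list \<times> 'n list \<Rightarrow> complex"

definition tensors :: "nat \<Rightarrow> nat \<Rightarrow> 'n tensor set" where
  "tensors n m = {t. \<forall>is js. t (is, js) \<noteq> 0 \<longrightarrow> length is = n \<and> length js = m}"

text \<open>
  The diagonal action: \<open>U\<close> sends \<open>e\<^sub>k\<close> to \<open>\<Sum>\<^sub>i U\<^bsub>ik\<^esub> e\<^sub>i\<close> and acts on \<open>V\<^sup>*\<close> by the dual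
  representation, which sends \<open>e\<^sup>*\<^sub>l\<close> to \<open>e\<^sup>*\<^sub>l \<circ> U\<^sup>-\<^sup>1 = \<Sum>\<^sub>j (U\<^sup>-\<^sup>1)\<^bsub>lj\<^esub> e\<^sup>*\<^sub>j\<close>.
\<close>

definition unitary_action :: "complex^'n^'n \<Rightarrow> 'n tensor \<Rightarrow> 'n tensor" where
  "unitary_action U t = (\<lambda>(is, js).
     \<Sum>ks | length ks = length is. \<Sum>ls | length ls = length js.
       (\<Prod>a<length is. U $ (is ! a) $ (ks ! a)) *
       (\<Prod>b<length js. matrix_inv U $ (ls ! b) $ (js ! b)) * t (ks, ls))"

text \<open>
  \<open>\<alpha>\<close> sends \<open>v\<^sub>1 \<otimes> \<dots> \<otimes> v\<^sub>n\<close> to the tensor with \<open>v\<^sub>a\<close> in position \<open>\<alpha> a\<close>, whose coordinate at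
  \<open>(i\<^sub>1, \<dots>, i\<^sub>n)\<close> is that of \<open>v\<^sub>1 \<otimes> \<dots> \<otimes> v\<^sub>n\<close> at \<open>(i\<^bsub>\<alpha> 1\<^esub>, \<dots>, i\<^bsub>\<alpha> n\<^esub>)\<close>. Positions are numbered from 0.
\<close>

definition perm_action :: "(nat \<Rightarrow> nat) \<Rightarrow> (nat \<Rightarrow> nat) \<Rightarrow> 'n tensor \<Rightarrow> 'n tensor" where
  "perm_action \<alpha> \<beta> t = (\<lambda>(is, js). t (permute_list \<alpha> is, permute_list \<beta> js))"

definition contraction :: "nat \<Rightarrow> nat \<Rightarrow> ('n::finite) tensor \<Rightarrow> 'n tensor" where
  "contraction a b t = (\<lambda>(is, js).
     \<Sum>k\<in>UNIV. t (take a is @ k # drop a is, take b js @ k # drop b js))"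

definition traceless_tensors :: "nat \<Rightarrow> nat \<Rightarrow> ('n::finite) tensor set" where
  "traceless_tensors n m = {t \<in> tensors n m. \<forall>a<n. \<forall>b<m. contraction a b t = 0}"


section \<open>Newton polynomials\<close>

definition newton_perm ::
  "nat \<Rightarrow> nat \<Rightarrow> (nat \<Rightarrow> nat) \<Rightarrow> (nat \<Rightarrow> nat) \<Rightarrow> complex^'n^'n \<Rightarrow> complex" where
  "newton_perm n m \<alpha> \<beta> U =
     cfun.trace_on (traceless_tensors n m) (perm_action \<alpha> \<beta> \<circ> unitary_action U)"

text \<open>Orbits, unlike nontrivial cycles, also account for the fixed points.\<close>

definition has_cycle_type :: "nat \<Rightarrow> (nat \<Rightarrow> nat) \<Rightarrow> nat list \<Rightarrow> bool" where
  "has_cycle_type n \<alpha> l \<longleftrightarrow>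
     \<alpha> permutes {..<n} \<and> image_mset card (mset_set (orbit \<alpha> ` {..<n})) = mset l"

text \<open>
  The trace depends on the permutations only through their cycle types, so any choice of
  permutations with the given cycle types yields the same value.
\<close>

definition newton_poly :: "nat list \<Rightarrow> nat list \<Rightarrow> complex^'n^'n \<Rightarrow> complex" where
  "newton_poly l m U =
     (if l = [] \<and> m = [] then 1
      else if m = [] then power_sums l U
      else if l = [] then cnj (power_sums m U)
      else newton_perm (sum_list l) (sum_list m)
             (SOME \<alpha>. has_cycle_type (sum_list l) \<alpha> l)
             (SOME \<beta>. has_cycle_type (sum_list m) \<beta> m) U)"


section \<open>Wick products\<close>

text \<open>Polynomials in variables indexed by \<^typ>\<open>nat\<close>: finitely supported maps from monomials to coefficients.\<close>

type_synonym mpolynomial = "(nat \<Rightarrow>\<^sub>0 nat) \<Rightarrow>\<^sub>0 complex"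

definition mpoly_vars :: "mpolynomial \<Rightarrow> nat set" where
  "mpoly_vars P = (\<Union>m\<in>Poly_Mapping.keys P. Poly_Mapping.keys m)"

definition mpoly_eval :: "mpolynomial \<Rightarrow> (nat \<Rightarrow> complex) \<Rightarrow> complex" where
  "mpoly_eval P y = (\<Sum>m\<in>Poly_Mapping.keys P.
     Poly_Mapping.lookup P m * (\<Prod>i\<in>Poly_Mapping.keys m. y i ^ Poly_Mapping.lookup m i))"

definition mpoly_deriv :: "nat \<Rightarrow> mpolynomial \<Rightarrow> mpolynomial" where
  "mpoly_deriv i P = (\<Sum>m\<in>Poly_Mapping.keys P.
     Poly_Mapping.single (m - Poly_Mapping.single i 1)
       (of_nat (Poly_Mapping.lookup m i) * Poly_Mapping.lookup P m))"

text \<open>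
  \<open>wick_poly M X S\<close> is the polynomial attached to the family \<open>(X\<^sub>i)\<^bsub>i \<in> S\<^esub>\<close>. Families are indexed
  by finite sets rather than by initial segments so that omitting the variable \<open>i\<close> needs no
  renumbering. The description has a unique solution when \<open>M\<close> is a probability space
  and all products of distinct members of the family are integrable.
\<close>

function wick_poly :: "'a measure \<Rightarrow> (nat \<Rightarrow> 'a \<Rightarrow> complex) \<Rightarrow> nat set \<Rightarrow> mpolynomial" where
  "wick_poly M X S =
     (if finite S \<and> S \<noteq> {} then
        (THE P. mpoly_vars P \<subseteq> S \<and>
                (\<forall>i\<in>S. mpoly_deriv i P = wick_poly M X (S - {i})) \<and>
                (LINT \<omega>|M. mpoly_eval P (\<lambda>i. X i \<omega>)) = 0)
      else 1)"
  by pat_completeness auto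
termination
  by (relation "Wellfounded.measure (\<lambda>(M, X, S). card S)") (auto simp: card_gt_0_iff)

declare wick_poly.simps [simp del]

definition wick_product :: "'a measure \<Rightarrow> ('a \<Rightarrow> complex) list \<Rightarrow> 'a \<Rightarrow> complex" where
  "wick_product M Xs \<omega> =
     mpoly_eval (wick_poly M (\<lambda>i. Xs ! i) {..<length Xs}) (\<lambda>i. (Xs ! i) \<omega>)"

definition power_sum_family :: "nat list \<Rightarrow> nat list \<Rightarrow> (complex^'n^'n \<Rightarrow> complex) list" where
  "power_sum_family l m =
     map (\<lambda>k U. power_sum k U) l @ map (\<lambda>k U. power_sum k (matrix_inv U)) m"

end

theory Submission
  imports Defs
begin

text \<open>
  For \<open>n + m \<le> N\<close> the space \<open>T\<^bsub>n,m\<^esub>\<close> is the direct sum, over all partial matchings \<open>\<pi>\<close> of the \<open>V\<close> slots with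
  the \<open>V\<^sup>*\<close> slots, of copies of the traceless tensors in the unmatched slots, the matched pairs being
  filled with the invariant \<open>\<Sum>\<^sub>k e\<^sub>k \<otimes> e\<^sup>*\<^sub>k\<close>. These copies span because traceless tensors are the orthogonal
  complement of the images of the insertions of an invariant; they are independent by a dimension
  count, a traceless tensor being determined by its coordinates at the assignments without leading
  pairs.

  The operator \<open>\<alpha> \<times> \<beta>\<close> permutes the summands, so only the matchings fixed by \<open>\<alpha> \<times> \<beta>\<close> contribute to the
  trace on \<open>T\<^bsub>n,m\<^esub>\<close>, and a fixed matching covers a union of cycles. Writing \<open>X\<^sub>i\<close> for the power sum of the
  \<open>i\<close>-th cycle and \<open>F\<^sub>A\<close> for the Newton polynomial of the cycles in \<open>A\<close>, this gives
  \<open>\<Prod>\<^bsub>i\<in>A\<^esub> X\<^sub>i = \<Sum>\<^bsub>T\<subseteq>A\<^esub> m\<^sub>T F\<^bsub>A - T\<^esub>\<close>, where \<open>m\<^sub>T\<close> counts the fixed matchings covering exactly the cycles in \<open>T\<close>. No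
  nonzero traceless tensor is invariant under the unitary group, so \<open>F\<^sub>A\<close> has mean zero for \<open>A \<noteq> {}\<close>
  and \<open>m\<^sub>A\<close> is the mean of \<open>\<Prod>\<^bsub>i\<in>A\<^esub> X\<^sub>i\<close>. This is the relation that defines Wick products.
\<close>


section \<open>Linear algebra\<close>

text \<open>The bound on N enters twice. The numbering of the indices must supply a value
  \<open>a + b\<close> for every pair of slots, so that the leading terms of the invariants can be
  told apart; and invariant traceless forms are killed by a maximum principle in which fewer than N
  further slots of one kind may occur. The obstacle in the decomposition is that the summands of
  different matchings are not orthogonal to each other, so orthogonality gives spanning only.
  Independence is squeezed out of a count: the numbering bounds the sum of the dimensions by the
  number of assignments, and a spanning family that is no larger than the dimension is a basis. The
  moments are never evaluated. The decomposition that yields the expansion of the products also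
  yields their means, as numbers of matchings. The expansion is then a convolution over subsets with
  the moments, and the coefficients of a Wick polynomial form the inverse of the moments under this
  convolution.\<close>

lemma (in vector_space) trace_on_eq_sum:
  assumes B: "independent B" "finite B" and f: "Vector_Spaces.linear scale scale f"
    and fB: "\<And>b. b \<in> B \<Longrightarrow> f b \<in> span B"
  shows "trace_on (span B) f = (\<Sum>b\<in>B. representation B (f b) b)"
proof -
  interpret f: Vector_Spaces.linear scale scale f by (rule f)
  define C where "C = (SOME C. independent C \<and> span C = span B)"
  have C: "independent C" "span C = span B"
    using someI[of "\<lambda>C. independent C \<and> span C = span B" B] B by (auto simp: C_def)
  have CB: "C \<subseteq> span B" using C(2) span_superset by metis
  have finC: "finite C"
    using independent_span_bound[OF B(2) C(1) CB] by simp
  have f_span: "f v \<in> span B" if "v \<in> span B" for v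
  proof -
    have "f v \<in> span (f ` B)" using that f.span_image[of B] by blast
    also have "span (f ` B) \<subseteq> span B" using fB by (intro span_minimal) auto
    finally show ?thesis .
  qed
  let ?RB = "representation B" and ?RC = "representation C"
  \<comment> \<open>This is tr(PQ) = tr(QP) for the two base changes: expanding \<open>f b\<close>
    in \<open>C\<close> here and \<open>c\<close> in \<open>B\<close> below turns both traces into
    the same double sum.\<close>
  have "(\<Sum>b\<in>B. ?RB (f b) b) = (\<Sum>b\<in>B. \<Sum>c\<in>C. ?RC (f b) c * ?RB c b)"
  proof (rule sum.cong[OF refl])
    fix b assume b: "b \<in> B"
    have fb: "f b \<in> span C" using fB[OF b] C(2) by simp
    have "?RB (f b) = ?RB (\<Sum>c\<in>C. scale (?RC (f b) c) c)"
      by (subst sum_representation_eq[OF C(1) fb finC order.refl]) simp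
    also have "\<dots> = (\<lambda>b'. \<Sum>c\<in>C. ?RB (scale (?RC (f b) c) c) b')"
      by (rule representation_sum[OF B(1)]) (use CB in \<open>auto intro: span_scale\<close>)
    also have "\<dots> = (\<lambda>b'. \<Sum>c\<in>C. ?RC (f b) c * ?RB c b')"
      using CB by (intro ext sum.cong refl) (simp add: representation_scale[OF B(1)] subset_iff)
    finally show "?RB (f b) b = (\<Sum>c\<in>C. ?RC (f b) c * ?RB c b)" by simp
  qed
  also have "\<dots> = (\<Sum>c\<in>C. \<Sum>b\<in>B. ?RB c b * ?RC (f b) c)"
    by (subst sum.swap) (simp add: mult.commute)
  also have "\<dots> = (\<Sum>c\<in>C. ?RC (f c) c)"
  proof (rule sum.cong[OF refl])
    fix c assume c: "c \<in> C"
    have cB: "c \<in> span B" using c CB by auto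
    have "?RC (f c) = ?RC (f (\<Sum>b\<in>B. scale (?RB c b) b))"
      by (subst sum_representation_eq[OF B(1) cB B(2) order.refl]) simp
    also have "\<dots> = ?RC (\<Sum>b\<in>B. scale (?RB c b) (f b))"
      by (simp add: f.sum f.scale)
    also have "\<dots> = (\<lambda>c'. \<Sum>b\<in>B. ?RC (scale (?RB c b) (f b)) c')"
      by (rule representation_sum[OF C(1)]) (use fB C(2) in \<open>auto intro: span_scale\<close>)
    also have "\<dots> = (\<lambda>c'. \<Sum>b\<in>B. ?RB c b * ?RC (f b) c')"
      using fB C(2) by (intro ext sum.cong refl) (simp add: representation_scale[OF C(1)])
    finally show "(\<Sum>b\<in>B. ?RB c b * ?RC (f b) c) = ?RC (f c) c" by simp
  qed
  finally show ?thesis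
    by (simp add: trace_on_def C_def Let_def)
qed

text \<open>Traces move along injective intertwining maps. The maps in view are gluing, from
  harmonic forms in the unmatched slots onto a summand, and the passage from forms to list
  tensors.\<close>

lemma (in vector_space_pair) trace_on_image:
  assumes B: "vs1.independent B" "finite B"
    and \<phi>: "Vector_Spaces.linear s1 s2 \<phi>" "inj_on \<phi> (vs1.span B)"
    and f: "Vector_Spaces.linear s1 s1 f" "\<And>b. b \<in> B \<Longrightarrow> f b \<in> vs1.span B"
    and g: "Vector_Spaces.linear s2 s2 g" "\<And>b. b \<in> B \<Longrightarrow> g (\<phi> b) = \<phi> (f b)"
  shows "vs2.trace_on (\<phi> ` vs1.span B) g = vs1.trace_on (vs1.span B) f"
proof -
  interpret \<phi>: Vector_Spaces.linear s1 s2 \<phi> by (rule \<phi>)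
  have ind: "vs2.independent (\<phi> ` B)"
    by (rule \<phi>.independent_injective_image[OF B(1) \<phi>(2)])
  have span: "vs2.span (\<phi> ` B) = \<phi> ` vs1.span B" by (rule \<phi>.span_image)
  have inj: "inj_on \<phi> B" using \<phi>(2) vs1.span_superset by (rule inj_on_subset)
  have rep: "vs2.representation (\<phi> ` B) (\<phi> v) (\<phi> b) = vs1.representation B v b"
    if v: "v \<in> vs1.span B" and b: "b \<in> B" for v b
  proof -
    have "\<phi> v = (\<Sum>b\<in>B. s2 (vs1.representation B v b) (\<phi> b))"
    proof -
      have "\<phi> v = \<phi> (\<Sum>b\<in>B. s1 (vs1.representation B v b) b)"
        by (subst vs1.sum_representation_eq[OF B(1) v B(2) order.refl]) simp
      then show ?thesis by (simp add: \<phi>.sum \<phi>.scale)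
    qed
    then have "vs2.representation (\<phi> ` B) (\<phi> v)
      = vs2.representation (\<phi> ` B) (\<Sum>b\<in>B. s2 (vs1.representation B v b) (\<phi> b))" by simp
    also have "\<dots> = (\<lambda>c. \<Sum>b\<in>B. vs2.representation (\<phi> ` B) (s2 (vs1.representation B v b) (\<phi> b)) c)"
      by (rule vs2.representation_sum[OF ind]) (auto intro: vs2.span_scale vs2.span_base)
    also have "\<dots> = (\<lambda>c. \<Sum>b\<in>B. vs1.representation B v b * (if c = \<phi> b then 1 else 0))"
      by (intro ext sum.cong refl)
         (simp add: vs2.representation_scale[OF ind] vs2.span_base vs2.representation_basis[OF ind])
    finally have "vs2.representation (\<phi> ` B) (\<phi> v) (\<phi> b)
      = (\<Sum>b'\<in>B. vs1.representation B v b' * (if \<phi> b = \<phi> b' then 1 else 0))" by simp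
    also have "\<dots> = (\<Sum>b'\<in>B. if b' = b then vs1.representation B v b' else 0)"
      using inj b by (intro sum.cong refl) (auto simp: inj_on_eq_iff)
    also have "\<dots> = vs1.representation B v b" using b B(2) by simp
    finally show ?thesis .
  qed
  have "vs2.trace_on (vs2.span (\<phi> ` B)) g = (\<Sum>c\<in>\<phi> ` B. vs2.representation (\<phi> ` B) (g c) c)"
    by (rule vs2.trace_on_eq_sum[OF ind _ g(1)]) (use B(2) g(2) f(2) span in auto)
  also have "\<dots> = (\<Sum>b\<in>B. vs2.representation (\<phi> ` B) (\<phi> (f b)) (\<phi> b))"
    by (subst sum.reindex[OF inj]) (simp add: g(2))
  also have "\<dots> = (\<Sum>b\<in>B. vs1.representation B (f b) b)"
    using rep f(2) by (intro sum.cong refl) simp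
  also have "\<dots> = vs1.trace_on (vs1.span B) f"
    by (rule vs1.trace_on_eq_sum[symmetric, OF B f])
  finally show ?thesis by (simp add: span)
qed

section \<open>Spaces of complex-valued functions\<close>

abbreviation (input) cscale :: "complex \<Rightarrow> ('a \<Rightarrow> complex) \<Rightarrow> 'a \<Rightarrow> complex" where
  "cscale c f \<equiv> (\<lambda>x. c * f x)"

global_interpretation cfun_pair: vector_space_pair
  "cscale :: complex \<Rightarrow> ('a \<Rightarrow> complex) \<Rightarrow> _" "cscale :: complex \<Rightarrow> ('b \<Rightarrow> complex) \<Rightarrow> _"
  by unfold_locales

abbreviation clinear :: "(('a \<Rightarrow> complex) \<Rightarrow> ('b \<Rightarrow> complex)) \<Rightarrow> bool" where
  "clinear \<equiv> Vector_Spaces.linear cscale cscale"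

lemma clinearI:
  assumes "\<And>s t. F (s + t) = F s + F t" "\<And>c t. F (cscale c t) = cscale c (F t)"
  shows "clinear F"
  using assms by unfold_locales auto

lemma sum_fun_apply: "(\<Sum>i\<in>I. f i) x = (\<Sum>i\<in>I. f i (x::'a) :: complex)"
  by (induction I rule: infinite_finite_induct) auto

lemma csubspaceI:
  assumes "0 \<in> W" "\<And>s t. s \<in> W \<Longrightarrow> t \<in> W \<Longrightarrow> s + t \<in> W" "\<And>c t. t \<in> W \<Longrightarrow> cscale c t \<in> W"
  shows "cfun.subspace W"
  using assms by (auto simp: cfun.subspace_def)

text \<open>The inner product is taken over a finite set \<open>X\<close> of points that need not separate all functions.\<close>

definition cinner_on :: "'a set \<Rightarrow> ('a \<Rightarrow> complex) \<Rightarrow> ('a \<Rightarrow> complex) \<Rightarrow> complex" where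
  "cinner_on X f g = (\<Sum>x\<in>X. f x * cnj (g x))"

lemma cinner_on_diff_left: "cinner_on X (f - g) h = cinner_on X f h - cinner_on X g h"
  and cinner_on_scale_left: "cinner_on X (cscale c f) h = c * cinner_on X f h"
  and cinner_on_add_right: "cinner_on X f (g + h) = cinner_on X f g + cinner_on X f h"
  and cinner_on_scale_right: "cinner_on X f (cscale c h) = cnj c * cinner_on X f h"
  and cinner_on_zero_right: "cinner_on X f 0 = 0"
  by (simp_all add: cinner_on_def sum.distrib sum_subtractf sum_distrib_left algebra_simps)

lemma cinner_on_self_eq_0:
  assumes "finite X" "cinner_on X f f = 0" "x \<in> X"
  shows "f x = 0"
proof -
  have "cinner_on X f f = of_real (\<Sum>x\<in>X. (cmod (f x))\<^sup>2)"
    by (simp add: cinner_on_def flip: complex_norm_square)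
  then have "(\<Sum>x\<in>X. (cmod (f x))\<^sup>2) = 0" using assms(2) of_real_eq_0_iff by metis
  then show ?thesis using assms(1,3) by (simp add: sum_nonneg_eq_0_iff)
qed

lemma cinner_on_span_eq_0:
  assumes "\<And>s. s \<in> S \<Longrightarrow> cinner_on X f s = 0" "u \<in> cfun.span S"
  shows "cinner_on X f u = 0"
  using assms(2)
proof (induction rule: cfun.span_induct_alt)
  case base
  show ?case by (rule cinner_on_zero_right)
next
  case (step c s t)
  then show ?case unfolding cinner_on_add_right cinner_on_scale_right by (simp add: assms(1))
qed

text \<open>Gram-Schmidt, adding one generator at a time. \<open>S\<close> may be dependent and the
  pairing may be degenerate, so a residual of norm zero has to be allowed for.\<close>

lemma orthogonal_decomposition:
  assumes "finite X" "finite S"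
  shows "\<exists>u\<in>cfun.span S. \<forall>s\<in>S. cinner_on X (v - u) s = 0"
  using assms(2)
proof (induction S arbitrary: v rule: finite_induct)
  case empty
  then show ?case by auto
next
  case (insert s S)
  obtain u0 where u0: "u0 \<in> cfun.span S" "\<And>r. r \<in> S \<Longrightarrow> cinner_on X (s - u0) r = 0"
    using insert.IH[of s] by blast
  obtain u where u: "u \<in> cfun.span S" "\<And>r. r \<in> S \<Longrightarrow> cinner_on X (v - u) r = 0"
    using insert.IH[of v] by blast
  define w0 where "w0 = s - u0"
  \<comment> \<open>If \<open>w0\<close> has norm zero it vanishes on \<open>X\<close> and any
    scalar serves, so the value of a division by zero is harmless.\<close>
  define c where "c = cinner_on X (v - u) w0 / cinner_on X w0 w0"
  define u' where "u' = u + cscale c w0"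
  have mono: "cfun.span S \<subseteq> cfun.span (insert s S)"
    by (rule cfun.span_mono) auto
  have w0_span: "w0 \<in> cfun.span (insert s S)"
    unfolding w0_def by (rule cfun.span_diff) (use u0(1) mono in \<open>auto intro: cfun.span_base\<close>)
  have u'_span: "u' \<in> cfun.span (insert s S)"
    unfolding u'_def using u(1) w0_span mono by (blast intro: cfun.span_add cfun.span_scale)
  have eq: "v - u' = (v - u) - cscale c w0"
    by (simp add: u'_def fun_eq_iff)
  have orth: "cinner_on X (v - u') r = 0" if "r \<in> S" for r
    unfolding eq cinner_on_diff_left[of X "v - u"] cinner_on_scale_left
    using u(2)[OF that] u0(2)[OF that, folded w0_def] by simp
  have "cinner_on X (v - u') w0 = 0"
  proof (cases "cinner_on X w0 w0 = 0")
    case True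
    then have "w0 x = 0" if "x \<in> X" for x
      using cinner_on_self_eq_0[OF assms(1) _ that] by blast
    then show ?thesis by (simp add: cinner_on_def)
  next
    case False
    then show ?thesis
      unfolding eq cinner_on_diff_left[of X "v - u"] cinner_on_scale_left by (simp add: c_def)
  qed
  moreover have "cinner_on X (v - u') u0 = 0"
    by (rule cinner_on_span_eq_0[OF _ u0(1)]) (rule orth)
  ultimately have "cinner_on X (v - u') (w0 + u0) = 0"
    by (simp only: cinner_on_add_right) simp
  then have "cinner_on X (v - u') s = 0" by (simp add: w0_def)
  with orth u'_span show ?case by blast
qed

section \<open>Forms\<close>

text \<open>
  Tensors are represented as functions of an assignment of indices to all slots, \<open>Inl a\<close> for the \<open>a\<close>-th
  copy of \<open>V\<close> and \<open>Inr b\<close> for the \<open>b\<close>-th copy of \<open>V\<^sup>*\<close>. A tensor in the slots of \<open>S\<close> is one that depends only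
  on the values at \<open>S\<close>, so restricting to fewer slots needs no renumbering.
\<close>

type_synonym slot = "nat + nat"
type_synonym 'n form = "(slot \<Rightarrow> 'n) \<Rightarrow> complex"

abbreviation assign :: "slot set \<Rightarrow> (slot \<Rightarrow> 'n) set" where
  "assign S \<equiv> PiE S (\<lambda>_. UNIV)"

definition forms :: "slot set \<Rightarrow> 'n form set" where
  "forms S = {t. \<forall>f g. (\<forall>s\<in>S. f s = g s) \<longrightarrow> t f = t g}"

lemma formsD: "t \<in> forms S \<Longrightarrow> (\<And>s. s \<in> S \<Longrightarrow> f s = g s) \<Longrightarrow> t f = t g"
  unfolding forms_def by blast

lemma formsI: "(\<And>f g. (\<And>s. s \<in> S \<Longrightarrow> f s = g s) \<Longrightarrow> t f = t g) \<Longrightarrow> t \<in> forms S"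
  unfolding forms_def by blast

lemma forms_restrict: "t \<in> forms S \<Longrightarrow> t (restrict f S) = t f"
  by (rule formsD) auto

lemma subspace_forms: "cfun.subspace (forms S)"
proof (rule csubspaceI)
  fix s t :: "'a form" and c
  assume "s \<in> forms S" "t \<in> forms S"
  then show "s + t \<in> forms S" "cscale c t \<in> forms S"
    unfolding forms_def by (simp_all, metis+)
qed (simp add: forms_def)

definition point :: "slot set \<Rightarrow> (slot \<Rightarrow> 'n) \<Rightarrow> 'n form" where
  "point S x = (\<lambda>f. if \<forall>s\<in>S. f s = x s then 1 else 0)"

lemma point_in_forms: "point S x \<in> forms S"
  by (auto simp: forms_def point_def)

lemma assign_eqI: "x \<in> assign S \<Longrightarrow> y \<in> assign S \<Longrightarrow> (\<And>s. s \<in> S \<Longrightarrow> x s = y s) \<Longrightarrow> x = y"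
  by (rule PiE_ext)

lemma point_apply_assign:
  "x \<in> assign S \<Longrightarrow> y \<in> assign S \<Longrightarrow> point S x y = (if x = y then 1 else 0)"
  using assign_eqI[of x S y] by (auto simp: point_def)

lemma finite_assign: "finite S \<Longrightarrow> finite (assign S :: (slot \<Rightarrow> 'n::finite) set)"
  by (rule finite_PiE) auto

lemma inj_on_point: "inj_on (point S) (assign S)"
proof (rule inj_onI)
  fix x y :: "slot \<Rightarrow> 'n" assume xy: "x \<in> assign S" "y \<in> assign S" and eq: "point S x = point S y"
  have "point S x x = 1" by (simp add: point_def)
  then have "point S y x = 1" by (simp add: eq)
  then show "x = y" using point_apply_assign[OF xy(2,1)] by (auto split: if_splits)
qed

lemma forms_expand:
  fixes t :: "'n::finite form"
  assumes "finite S" "t \<in> forms S"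
  shows "t = (\<Sum>x\<in>assign S. cscale (t x) (point S x))"
proof (rule ext)
  fix f
  have "(\<Sum>x\<in>assign S. t x * point S x f) = (\<Sum>x\<in>assign S. if x = restrict f S then t x else 0)"
  proof (rule sum.cong[OF refl])
    fix x assume x: "x \<in> (assign S :: (slot \<Rightarrow> 'n) set)"
    have "(\<forall>s\<in>S. f s = x s) \<longleftrightarrow> x = restrict f S"
      using x by (auto intro!: assign_eqI[OF x])
    then show "t x * point S x f = (if x = restrict f S then t x else 0)" by (simp add: point_def)
  qed
  also have "\<dots> = t (restrict f S)"
  proof -
    have "restrict f S \<in> (assign S :: (slot \<Rightarrow> 'n) set)" by auto
    then show ?thesis using finite_assign[OF assms(1), where 'n='n] by simp
  qed
  also have "\<dots> = t f" by (rule forms_restrict[OF assms(2)])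
  finally show "t f = (\<Sum>x\<in>assign S. cscale (t x) (point S x)) f" by (simp add: sum_fun_apply)
qed

lemma span_point:
  assumes "finite S"
  shows "cfun.span (point S ` assign S) = (forms S :: 'n::finite form set)"
proof
  show "cfun.span (point S ` assign S) \<subseteq> (forms S :: 'n form set)"
    by (intro cfun.span_minimal subspace_forms) (auto intro: point_in_forms)
  show "(forms S :: 'n form set) \<subseteq> cfun.span (point S ` assign S)"
  proof
    fix t :: "'n form" assume "t \<in> forms S"
    have "(\<Sum>x\<in>assign S. cscale (t x) (point S x)) \<in> cfun.span (point S ` assign S)"
      by (intro cfun.span_sum cfun.span_scale cfun.span_base imageI)
    then show "t \<in> cfun.span (point S ` assign S)"
      using forms_expand[OF assms \<open>t \<in> forms S\<close>] by simp
  qed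
qed

lemma independent_point:
  assumes "finite S"
  shows "cfun.independent (point S ` assign S :: 'n::finite form set)"
proof (rule cfun.independent_if_scalars_zero)
  show "finite (point S ` assign S :: 'n form set)" using finite_assign[OF assms] by blast
  fix c :: "'n form \<Rightarrow> complex" and e :: "'n form"
  assume 0: "(\<Sum>e\<in>point S ` assign S. cscale (c e) e) = 0" and "e \<in> point S ` assign S"
  then obtain x :: "slot \<Rightarrow> 'n" where x: "x \<in> assign S" "e = point S x" by blast
  have "(\<Sum>e\<in>point S ` assign S. cscale (c e) e) x = (\<Sum>y\<in>assign S. c (point S y) * point S y x)"
    unfolding sum_fun_apply by (subst sum.reindex[OF inj_on_point]) simp
  also have "\<dots> = (\<Sum>y\<in>assign S. if y = x then c (point S y) else 0)"
    using x by (intro sum.cong refl) (auto simp: point_apply_assign)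
  also have "\<dots> = c e" using x finite_assign[OF assms, where 'n='n] by simp
  finally show "c e = 0" using 0 by simp
qed

lemma representation_point:
  fixes t :: "'n::finite form"
  assumes "finite S" "t \<in> forms S" "x \<in> assign S"
  shows "cfun.representation (point S ` assign S) t (point S x) = t x"
proof -
  let ?B = "point S ` assign S :: 'n form set"
  have "t = (\<Sum>e\<in>?B. cscale (cfun.representation ?B t e) e)"
    using cfun.sum_representation_eq[OF independent_point[OF assms(1)], of t ?B] assms
      finite_assign[OF assms(1), where 'n='n] by (simp add: span_point)
  then have "t x = (\<Sum>e\<in>?B. cscale (cfun.representation ?B t e) e) x" by simp
  also have "\<dots> = (\<Sum>y\<in>assign S. cfun.representation ?B t (point S y) * point S y x)"
    unfolding sum_fun_apply by (subst sum.reindex[OF inj_on_point]) simp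
  also have "\<dots> = (\<Sum>y\<in>assign S. if y = x then cfun.representation ?B t (point S y) else 0)"
    using assms(3) by (intro sum.cong refl) (auto simp: point_apply_assign)
  also have "\<dots> = cfun.representation ?B t (point S x)"
    using assms(3) finite_assign[OF assms(1), where 'n='n] by simp
  finally show ?thesis by simp
qed

section \<open>Contractions and their adjoints\<close>

text \<open>Both slots stay in the argument and the result merely no longer depends on them.
  Contracting thus shifts no positions, in contrast to \<open>contraction\<close> on lists.\<close>

definition pair_trace :: "nat \<Rightarrow> nat \<Rightarrow> 'n::finite form \<Rightarrow> 'n form" where
  "pair_trace a b t = (\<lambda>f. \<Sum>k\<in>UNIV. t (f(Inl a := k, Inr b := k)))"

definition harmonic :: "slot set \<Rightarrow> 'n::finite form set" where
  "harmonic S = {t \<in> forms S. \<forall>a b. Inl a \<in> S \<longrightarrow> Inr b \<in> S \<longrightarrow> pair_trace a b t = 0}"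

lemma harmonic_in_forms: "t \<in> harmonic S \<Longrightarrow> t \<in> forms S"
  by (simp add: harmonic_def)

lemma subspace_harmonic: "cfun.subspace (harmonic S :: 'n::finite form set)"
proof -
  have "pair_trace a b (s + t) = pair_trace a b s + pair_trace a b t" for a b and s t :: "'n form"
    by (simp add: pair_trace_def fun_eq_iff sum.distrib)
  moreover have "pair_trace a b (cscale c t) = cscale c (pair_trace a b t)" for a b c and t :: "'n form"
    by (simp add: pair_trace_def fun_eq_iff sum_distrib_left)
  moreover have "pair_trace a b 0 = (0 :: 'n form)" for a b
    by (simp add: pair_trace_def fun_eq_iff)
  ultimately show ?thesis
    using subspace_forms[of S] by (intro csubspaceI) (auto simp: harmonic_def cfun.subspace_def fun_eq_iff)
qed

section \<open>Partial matchings and the insertion of invariants\<close>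

definition matching :: "(nat \<times> nat) set \<Rightarrow> bool" where
  "matching \<pi> \<longleftrightarrow> inj_on fst \<pi> \<and> inj_on snd \<pi>"

definition cov :: "(nat \<times> nat) set \<Rightarrow> slot set" where
  "cov \<pi> = Inl ` fst ` \<pi> \<union> Inr ` snd ` \<pi>"

definition matchings :: "slot set \<Rightarrow> (nat \<times> nat) set set" where
  "matchings S = {\<pi>. matching \<pi> \<and> cov \<pi> \<subseteq> S}"

text \<open>If \<open>t\<close> does not depend on \<open>cov \<pi>\<close>, this is the tensor
  product of \<open>t\<close> with one invariant per pair of \<open>\<pi>\<close>; the coordinates
  of an invariant are a Kronecker delta, whence the test for equality.\<close>

definition glue :: "(nat \<times> nat) set \<Rightarrow> 'n form \<Rightarrow> 'n form" where
  "glue \<pi> t = (\<lambda>f. if \<forall>(a, b)\<in>\<pi>. f (Inl a) = f (Inr b) then t f else 0)"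

lemma cov_empty [simp]: "cov {} = {}"
  and cov_insert: "cov (insert (a, b) \<pi>) = {Inl a, Inr b} \<union> cov \<pi>"
  by (auto simp: cov_def)

lemma matching_insert:
  "matching (insert (a, b) \<pi>) \<Longrightarrow> (a, b) \<notin> \<pi> \<Longrightarrow> matching \<pi> \<and> Inl a \<notin> cov \<pi> \<and> Inr b \<notin> cov \<pi>"
  by (force simp: matching_def cov_def inj_on_def)

lemma matching_insertI:
  "matching \<pi> \<Longrightarrow> Inl a \<notin> cov \<pi> \<Longrightarrow> Inr b \<notin> cov \<pi> \<Longrightarrow> matching (insert (a, b) \<pi>)"
  unfolding matching_def cov_def inj_on_def by auto

lemma glue_empty [simp]: "glue {} t = t"
  by (simp add: glue_def)

lemma glue_insert: "glue (insert (a, b) \<pi>) t = glue {(a, b)} (glue \<pi> t)"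
  by (auto simp: glue_def fun_eq_iff)

lemma clinear_glue: "clinear (glue \<pi>)"
  by (rule clinearI) (auto simp: glue_def fun_eq_iff)

lemma glue_in_forms:
  assumes "t \<in> forms S'" "S' \<union> cov \<pi> \<subseteq> S"
  shows "glue \<pi> t \<in> forms S"
proof (rule formsI)
  fix f g :: "slot \<Rightarrow> 'a" assume fg: "\<And>s. s \<in> S \<Longrightarrow> f s = g s"
  have "t f = t g" using assms by (intro formsD[OF assms(1)] fg) auto
  moreover have "f (Inl a) = g (Inl a) \<and> f (Inr b) = g (Inr b)" if "(a, b) \<in> \<pi>" for a b
    using that assms(2) by (intro conjI fg) (force simp: cov_def)+
  ultimately show "glue \<pi> t f = glue \<pi> t g" by (auto simp: glue_def)
qed

lemma finite_matching: "finite S \<Longrightarrow> \<pi> \<in> matchings S \<Longrightarrow> finite \<pi>"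
proof -
  assume S: "finite S" "\<pi> \<in> matchings S"
  have "finite (Inl ` fst ` \<pi> :: slot set)"
    using S by (auto simp: matchings_def cov_def intro: finite_subset)
  then show "finite \<pi>"
    using S by (auto simp: matchings_def matching_def finite_image_iff)
qed

lemma finite_matchings: "finite S \<Longrightarrow> finite (matchings S)"
proof -
  assume S: "finite S"
  have "finite (Inl -` S)" "finite (Inr -` S)"
    using S by (auto intro!: finite_vimageI)
  moreover have "matchings S \<subseteq> Pow ((Inl -` S) \<times> (Inr -` S))"
    by (force simp: matchings_def cov_def)
  ultimately show ?thesis by (meson finite_Pow_iff finite_SigmaI finite_subset)
qed

lemma inj_on_glue:
  assumes "matching \<pi>"
  shows "inj_on (glue \<pi>) (forms (S - cov \<pi>))"
proof (rule inj_onI)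
  fix s t :: "'a form"
  assume st: "s \<in> forms (S - cov \<pi>)" "t \<in> forms (S - cov \<pi>)" and eq: "glue \<pi> s = glue \<pi> t"
  show "s = t"
  proof
    fix f :: "slot \<Rightarrow> 'a"
    \<comment> \<open>\<open>g\<close> copies the value at each matched \<open>Inl a\<close> to its
      partner \<open>Inr b\<close>, so it passes the test in \<open>glue\<close>. It differs from
      \<open>f\<close> only at covered slots, which \<open>s\<close> and \<open>t\<close> do not
      read.\<close>
    define g where "g x = (case x of Inl a \<Rightarrow> f x
      | Inr b \<Rightarrow> if b \<in> snd ` \<pi> then f (Inl (THE a. (a, b) \<in> \<pi>)) else f x)" for x
    have "g (Inl a) = g (Inr b)" if "(a, b) \<in> \<pi>" for a b
    proof -
      have "(THE a. (a, b) \<in> \<pi>) = a"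
        using that assms by (intro the_equality) (force simp: matching_def inj_on_def)+
      then show ?thesis using that by (force simp: g_def)
    qed
    then have "glue \<pi> s g = s g" "glue \<pi> t g = t g" by (auto simp: glue_def)
    moreover have "s g = s f" "t g = t f"
      by (rule formsD[OF st(1)] formsD[OF st(2)], auto simp: g_def cov_def split: sum.splits)+
    ultimately show "s f = t f" using eq by simp
  qed
qed

section \<open>Gluing harmonic forms spans all forms\<close>

definition glued_harmonics :: "slot set \<Rightarrow> 'n::finite form set" where
  "glued_harmonics S = (\<Union>\<pi>\<in>matchings S. glue \<pi> ` harmonic (S - cov \<pi>))"

text \<open>Inserting an invariant is adjoint to contracting; pairing with a glued coordinate form
  therefore reads off one coordinate of the contraction.\<close>

lemma cinner_glue_point:
  fixes w :: "'n::finite form"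
  assumes S: "finite S" "Inl a \<in> S" "Inr b \<in> S" and w: "w \<in> forms S"
  shows "cinner_on (assign S) w (glue {(a, b)} (point (S - {Inl a, Inr b}) (restrict f (S - {Inl a, Inr b}))))
    = pair_trace a b w f"
proof -
  let ?R = "S - {Inl a, Inr b}"
  let ?P = "\<lambda>y. y (Inl a) = y (Inr b) \<and> (\<forall>s\<in>?R. y s = f s)"
  have "cinner_on (assign S) w (glue {(a, b)} (point ?R (restrict f ?R)))
    = (\<Sum>y\<in>assign S. if ?P y then w y else 0)"
    unfolding cinner_on_def glue_def point_def by (intro sum.cong refl) auto
  also have "\<dots> = (\<Sum>y\<in>{y \<in> assign S. ?P y}. w y)"
    by (rule sum.inter_filter[symmetric]) (rule finite_assign[OF S(1)])
  also have "\<dots> = (\<Sum>k\<in>UNIV. w (f(Inl a := k, Inr b := k)))"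
  proof (rule sum.reindex_bij_witness[where i = "\<lambda>k. restrict (f(Inl a := k, Inr b := k)) S"
        and j = "\<lambda>y. y (Inl a)"])
    fix y assume y: "y \<in> {y \<in> assign S. ?P y}"
    show "restrict (f(Inl a := y (Inl a), Inr b := y (Inl a))) S = y"
      using y by (intro assign_eqI[of _ S]) auto
    show "w (f(Inl a := y (Inl a), Inr b := y (Inl a))) = w y"
      using y by (intro formsD[OF w]) auto
  qed (use S in auto)
  finally show ?thesis by (simp add: pair_trace_def)
qed

text \<open>Induction on the number of slots. Whatever is orthogonal to all single insertions is
  harmonic, and each insertion starts from a form in two slots fewer; adding its pair to a glued
  harmonic form enlarges the matching by that pair.\<close>

lemma forms_subset_span_glued_harmonics:
  fixes S :: "slot set"
  assumes "finite S"
  shows "(forms S :: 'n::finite form set) \<subseteq> cfun.span (glued_harmonics S)"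
  using assms
proof (induction "card S" arbitrary: S rule: less_induct)
  case (less S)
  note S = \<open>finite S\<close>
  let ?R = "\<lambda>a b. S - {Inl a, Inr b}"
  \<comment> \<open>Inserting into coordinate forms only keeps \<open>E\<close> finite, as
    \<open>orthogonal_decomposition\<close> demands.\<close>
  define E :: "'n form set" where
    "E = (\<Union>a\<in>Inl -` S. \<Union>b\<in>Inr -` S. \<Union>x\<in>assign (?R a b). {glue {(a, b)} (point (?R a b) x)})"
  have finE: "finite E"
    unfolding E_def using S by (intro finite_UN_I finite_vimageI finite_assign) auto
  have E_forms: "E \<subseteq> forms S"
  proof
    fix e assume "e \<in> E"
    then obtain a b x where ab: "Inl a \<in> S" "Inr b \<in> S" and e: "e = glue {(a, b)} (point (?R a b) x)"
      by (auto simp: E_def)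
    show "e \<in> forms S"
      unfolding e by (rule glue_in_forms[OF point_in_forms]) (use ab in \<open>auto simp: cov_def\<close>)
  qed
  have E_span: "E \<subseteq> cfun.span (glued_harmonics S)"
  proof
    fix e assume "e \<in> E"
    then obtain a b x where ab: "Inl a \<in> S" "Inr b \<in> S" and e: "e = glue {(a, b)} (point (?R a b) x)"
      by (auto simp: E_def)
    have "card (?R a b) < card S" using ab S by (intro psubset_card_mono) auto
    then have "point (?R a b) x \<in> cfun.span (glued_harmonics (?R a b))"
      using less.hyps[of "?R a b"] S point_in_forms by blast
    then have "e \<in> cfun.span (glue {(a, b)} ` glued_harmonics (?R a b))"
      unfolding e cfun_pair.linear_span_image[OF clinear_glue] by blast
    moreover have "glue {(a, b)} ` glued_harmonics (?R a b) \<subseteq> (glued_harmonics S :: 'n form set)"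
    proof safe
      fix t :: "'n form" assume "t \<in> glued_harmonics (?R a b)"
      then obtain \<pi> h where \<pi>: "matching \<pi>" "cov \<pi> \<subseteq> ?R a b" and h: "h \<in> harmonic (?R a b - cov \<pi>)"
        and t: "t = glue \<pi> h"
        by (auto simp: glued_harmonics_def matchings_def)
      have "insert (a, b) \<pi> \<in> matchings S"
        using \<pi> ab by (auto simp: matchings_def cov_insert intro!: matching_insertI)
      moreover have "?R a b - cov \<pi> = S - cov (insert (a, b) \<pi>)"
        by (auto simp: cov_insert)
      moreover have "glue {(a, b)} t = glue (insert (a, b) \<pi>) h"
        by (simp add: t glue_insert[of a b \<pi>])
      ultimately show "glue {(a, b)} t \<in> glued_harmonics S"
        using h unfolding glued_harmonics_def by auto
    qed
    ultimately show "e \<in> cfun.span (glued_harmonics S)"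
      using cfun.span_mono by blast
  qed
  show ?case
  proof
    fix v :: "'n form" assume v: "v \<in> forms S"
    obtain u where u: "u \<in> cfun.span E" and orth: "\<And>e. e \<in> E \<Longrightarrow> cinner_on (assign S) (v - u) e = 0"
      using orthogonal_decomposition[OF finite_assign[OF S] finE, of v] by blast
    have uf: "u \<in> forms S"
      using u E_forms cfun.span_minimal[OF _ subspace_forms] by blast
    define w where "w = v - u"
    have w: "w \<in> forms S"
      unfolding w_def using v uf by (intro cfun.subspace_diff[OF subspace_forms])
    have "pair_trace a b w = 0" if ab: "Inl a \<in> S" "Inr b \<in> S" for a b
    proof
      fix f
      have "glue {(a, b)} (point (?R a b) (restrict f (?R a b))) \<in> E"
      proof -
        have "restrict f (?R a b) \<in> assign (?R a b)" by auto
        then show ?thesis unfolding E_def using ab by blast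
      qed
      then have "cinner_on (assign S) w (glue {(a, b)} (point (?R a b) (restrict f (?R a b)))) = 0"
        unfolding w_def by (rule orth)
      then show "pair_trace a b w f = 0 f" using cinner_glue_point[OF S ab w] by simp
    qed
    then have "w \<in> harmonic S" using w by (simp add: harmonic_def)
    then have "glue {} w \<in> glue {} ` harmonic (S - cov {})"
      unfolding cov_empty Diff_empty by (rule imageI)
    moreover have "{} \<in> matchings S" by (simp add: matchings_def matching_def)
    ultimately have "w \<in> glued_harmonics S"
      unfolding glued_harmonics_def glue_empty[of w] by blast
    moreover have "u \<in> cfun.span (glued_harmonics S)"
      using u E_span cfun.span_mono[of E] by (metis (no_types) cfun.span_span subsetD cfun.span_mono)
    ultimately have "w + u \<in> cfun.span (glued_harmonics S)"
      by (intro cfun.span_add) (auto intro: cfun.span_base)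
    then show "v \<in> cfun.span (glued_harmonics S)" by (simp add: w_def)
  qed
qed

section \<open>Standard assignments\<close>

definition list_slots :: "nat \<Rightarrow> nat \<Rightarrow> slot set" where
  "list_slots n m = Inl ` {..<n} \<union> Inr ` {..<m}"

text \<open>
  A numbering of the indices as in the locale makes \<open>e\<^sub>k \<otimes> e\<^sup>*\<^sub>k\<close> with \<open>num k = a + b\<close> the leading term of
  the invariant pairing the slots \<open>Inl a\<close> and \<open>Inr b\<close>: it is the unique maximum of the weight
  \<open>2 a k - k\<^sup>2 + 2 b k\<close>. Leading terms of pairings of different pairs of slots have no factor in common,
  which makes these pairings behave like independent variables.
\<close>

locale index_numbering =
  fixes num :: "'n::finite \<Rightarrow> nat" and n m :: nat
  assumes inj_num: "inj num"
    and num_onto: "j < n + m \<Longrightarrow> \<exists>k. num k = j"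
begin

abbreviation slots :: "slot set" where
  "slots \<equiv> list_slots n m"

definition leading_pairs :: "slot set \<Rightarrow> (slot \<Rightarrow> 'n) \<Rightarrow> (nat \<times> nat) set" where
  "leading_pairs S x = {(a, b). Inl a \<in> S \<and> Inr b \<in> S \<and> num (x (Inl a)) = a + b \<and> num (x (Inr b)) = a + b}"

definition standard :: "slot set \<Rightarrow> (slot \<Rightarrow> 'n) set" where
  "standard S = {x \<in> assign S. leading_pairs S x = {}}"

definition weight :: "slot set \<Rightarrow> (slot \<Rightarrow> 'n) \<Rightarrow> int" where
  "weight S x = (\<Sum>s\<in>S. case s of Inl a \<Rightarrow> 2 * int a * int (num (x s)) - (int (num (x s)))\<^sup>2
     | Inr b \<Rightarrow> 2 * int b * int (num (x s)))"

lemma finite_slots: "finite slots"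
  by (simp add: list_slots_def)

text \<open>Completing the square: a common value \<open>j\<close> at the two slots contributes
  \<open>(a + b)^2 - (j - a - b)^2\<close>, because the quadratic term is charged to the
  \<open>V\<close> slot alone. All other slots contribute the same on both sides.\<close>

lemma weight_less:
  assumes S: "finite S" "Inl a \<in> S" "Inr b \<in> S"
    and x: "num (x (Inl a)) = a + b" "num (x (Inr b)) = a + b" and k: "k \<noteq> x (Inl a)"
  shows "weight S (x(Inl a := k, Inr b := k)) < weight S x"
proof -
  let ?w = "\<lambda>x s. case s of Inl a \<Rightarrow> 2 * int a * int (num (x s)) - (int (num (x s)))\<^sup>2
     | Inr b \<Rightarrow> 2 * int b * int (num (x s))"
  let ?R = "S - {Inl a, Inr b}"
  have split: "weight S y = ?w y (Inl a) + ?w y (Inr b) + (\<Sum>s\<in>?R. ?w y s)" for y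
  proof -
    have "weight S y = (\<Sum>s\<in>insert (Inl a) (insert (Inr b) ?R). ?w y s)"
      unfolding weight_def using S by (intro sum.cong) auto
    then show ?thesis using S by simp
  qed
  define j where "j = int (num k)"
  have "num k \<noteq> a + b" using k x(1) inj_num by (metis injD)
  then have "j \<noteq> int a + int b" by (simp add: j_def)
  then have "(j - (int a + int b))\<^sup>2 > 0" by simp
  then have *: "2 * int a * j - j\<^sup>2 + 2 * int b * j < (int a + int b)\<^sup>2"
    by (simp add: power2_eq_square algebra_simps)
  have "(\<Sum>s\<in>?R. ?w (x(Inl a := k, Inr b := k)) s) = (\<Sum>s\<in>?R. ?w x s)"
    by (intro sum.cong refl) (auto split: sum.splits)
  then show ?thesis
    unfolding split[of "x(Inl a := k, Inr b := k)"] split[of x]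
    using * x by (simp add: j_def power2_eq_square algebra_simps)
qed

text \<open>Take a nonzero coordinate of least weight. If it had a leading pair, the vanishing
  contraction of that pair would express it through coordinates of strictly smaller weight, all of
  which are zero.\<close>

lemma harmonic_eq_0_if_standard:
  assumes S: "finite S" and t: "t \<in> harmonic S" and 0: "\<And>x. x \<in> standard S \<Longrightarrow> t x = 0"
  shows "t = 0"
proof (rule ccontr)
  assume "t \<noteq> 0"
  then obtain f where f: "t f \<noteq> 0" by (auto simp: fun_eq_iff)
  define A where "A = {x \<in> assign S. t x \<noteq> 0}"
  have finA: "finite A" using finite_assign[OF S, where 'n='n] by (simp add: A_def)
  have tf: "t \<in> forms S" using t by (rule harmonic_in_forms)
  have "restrict f S \<in> A" using f forms_restrict[OF tf] by (auto simp: A_def)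
  then obtain x where x: "x \<in> A" and min: "\<And>y. y \<in> A \<Longrightarrow> weight S x \<le> weight S y"
    using finA ex_is_arg_min_if_finite[of A "weight S"] by (auto simp: is_arg_min_linorder)
  then have "x \<notin> standard S" "x \<in> assign S" using 0 by (auto simp: A_def)
  then obtain a b where ab: "Inl a \<in> S" "Inr b \<in> S" "num (x (Inl a)) = a + b" "num (x (Inr b)) = a + b"
    by (auto simp: standard_def leading_pairs_def)
  let ?y = "\<lambda>k. x(Inl a := k, Inr b := k)"
  have others: "t (?y k) = 0" if "k \<noteq> x (Inl a)" for k
  proof (rule ccontr)
    assume "t (?y k) \<noteq> 0"
    moreover have "?y k \<in> assign S" using \<open>x \<in> assign S\<close> ab by (auto simp: PiE_def extensional_def)
    ultimately have "?y k \<in> A" by (simp add: A_def)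
    then show False using min weight_less[OF S ab that] by force
  qed
  have "x (Inr b) = x (Inl a)" using ab inj_num by (metis injD)
  then have self: "?y (x (Inl a)) = x" by (simp add: fun_eq_iff)
  have "pair_trace a b t = 0" using t ab by (simp add: harmonic_def)
  then have "0 = (\<Sum>k\<in>UNIV. t (?y k))" by (simp add: pair_trace_def fun_eq_iff)
  also have "\<dots> = (\<Sum>k\<in>{x (Inl a)}. t (?y k))"
    by (rule sum.mono_neutral_right) (use others in auto)
  also have "\<dots> = t x" using self by simp
  finally show False using x by (simp add: A_def)
qed

text \<open>Cutting off all nonstandard coordinates is injective on harmonic forms, so their
  dimension is at most the number of standard assignments.\<close>

lemma card_independent_harmonic:
  fixes B :: "'n form set"
  assumes S: "finite S" and B: "cfun.independent B" "B \<subseteq> harmonic S"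
  shows "finite B \<and> card B \<le> card (standard S)"
proof -
  \<comment> \<open>Forms take arbitrary functions as arguments, standard assignments are
    extensional; hence the restriction in the test.\<close>
  define r :: "'n form \<Rightarrow> 'n form" where
    "r t = (\<lambda>f. if restrict f S \<in> standard S then t f else 0)" for t
  have lin: "clinear r"
    by (rule clinearI) (auto simp: r_def fun_eq_iff)
  have span_B: "cfun.span B \<subseteq> harmonic S"
    by (rule cfun.span_minimal[OF B(2) subspace_harmonic])
  have inj: "inj_on r (cfun.span B)"
  proof (rule inj_onI)
    fix s t assume st: "s \<in> cfun.span B" "t \<in> cfun.span B" and eq: "r s = r t"
    have "s - t \<in> harmonic S" using cfun.span_diff[OF st] span_B by blast
    moreover have "(s - t) x = 0" if "x \<in> standard S" for x
    proof -
      have "restrict x S = x" using that by (auto simp: standard_def)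
      then have "r s x = s x" "r t x = t x" using that by (simp_all add: r_def)
      then show ?thesis using eq by simp
    qed
    ultimately have "s - t = 0" by (intro harmonic_eq_0_if_standard[OF S])
    then show "s = t" by simp
  qed
  have ind: "cfun.independent (r ` B)"
    by (rule cfun_pair.linear_independent_injective_image[OF lin B(1) inj])
  have fin: "finite (standard S)" using finite_assign[OF S, where 'n='n] by (simp add: standard_def)
  have "r t \<in> cfun.span (point S ` standard S)" if "t \<in> forms S" for t
  proof -
    have rt: "r t f = r t g" if "\<And>s. s \<in> S \<Longrightarrow> f s = g s" for f g
    proof -
      have "restrict f S = restrict g S" using that by auto
      moreover have "t f = t g" using \<open>t \<in> forms S\<close> that by (rule formsD)
      ultimately show ?thesis by (simp add: r_def)
    qed
    have "r t = (\<Sum>x\<in>assign S. cscale (r t x) (point S x))"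
      by (rule forms_expand[OF S formsI]) (rule rt)
    also have "\<dots> = (\<Sum>x\<in>standard S. cscale (r t x) (point S x))"
    proof (rule sum.mono_neutral_right[OF finite_assign[OF S]])
      show "\<forall>i\<in>assign S - standard S. cscale (r t i) (point S i) = 0"
      proof
        fix i assume "i \<in> assign S - standard S"
        then have "restrict i S \<notin> standard S" by auto
        then have "r t i = 0" by (simp add: r_def)
        then show "cscale (r t i) (point S i) = 0" by (simp add: fun_eq_iff)
      qed
    qed (auto simp: standard_def)
    also have "\<dots> \<in> cfun.span (point S ` standard S)"
      by (intro cfun.span_sum cfun.span_scale cfun.span_base imageI)
    finally show ?thesis .
  qed
  then have "r ` B \<subseteq> cfun.span (point S ` standard S)"
    using B(2) harmonic_in_forms by auto
  from cfun.independent_span_bound[OF finite_imageI[OF fin] ind this]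
  have "finite (r ` B)" "card (r ` B) \<le> card (standard S)"
    using card_image_le[OF fin, of "point S"] by auto
  moreover have "inj_on r B" using inj cfun.span_superset by (rule inj_on_subset)
  ultimately show ?thesis by (simp add: finite_image_iff card_image)
qed

text \<open>Put the value numbered \<open>a + b\<close> on both slots of each pair of
  \<open>\<pi>\<close>. A covered slot then determines its partner from its value, so it leads in no
  other pair, and a leading pair of two uncovered slots would already be one of
  \<open>y\<close>.\<close>

lemma standard_extend:
  assumes S: "S \<subseteq> slots" and \<pi>: "\<pi> \<in> matchings S" and y: "y \<in> standard (S - cov \<pi>)"
  shows "\<exists>x\<in>assign S. leading_pairs S x = \<pi> \<and> restrict x (S - cov \<pi>) = y"
proof -
  have m: "matching \<pi>" "cov \<pi> \<subseteq> S" using \<pi> by (auto simp: matchings_def)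
  define x where "x s = (if s \<in> cov \<pi> then (SOME k. \<exists>(a, b)\<in>\<pi>. (s = Inl a \<or> s = Inr b) \<and> num k = a + b)
    else y s)" for s
  have x_val: "num (x (Inl a)) = a + b" "num (x (Inr b)) = a + b" if "(a, b) \<in> \<pi>" for a b
  proof -
    have "Inl a \<in> S" "Inr b \<in> S" using that m(2) by (force simp: cov_def)+
    then have "a < n" "b < m" using S by (auto simp: list_slots_def)
    then obtain k where k: "num k = a + b" using num_onto[of "a + b"] by auto
    have u1: "b' = b" if "(a, b') \<in> \<pi>" for b' using that \<open>(a, b) \<in> \<pi>\<close> m(1)
      by (force simp: matching_def inj_on_def)
    have u2: "a' = a" if "(a', b) \<in> \<pi>" for a' using that \<open>(a, b) \<in> \<pi>\<close> m(1)
      by (force simp: matching_def inj_on_def)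
    have cov: "Inl a \<in> cov \<pi>" "Inr b \<in> cov \<pi>" using that by (force simp: cov_def)+
    have "\<exists>(a', b')\<in>\<pi>. (Inl a = (Inl a' :: slot) \<or> Inl a = (Inr b' :: slot)) \<and> num k = a' + b'"
      using that k by auto
    from someI[where P = "\<lambda>k. \<exists>(a', b')\<in>\<pi>. (Inl a = (Inl a' :: slot) \<or> Inl a = (Inr b' :: slot)) \<and> num k = a' + b'", OF this]
    show "num (x (Inl a)) = a + b" using cov u1 by (auto simp: x_def)
    have "\<exists>(a', b')\<in>\<pi>. (Inr b = (Inl a' :: slot) \<or> Inr b = (Inr b' :: slot)) \<and> num k = a' + b'"
      using that k by auto
    from someI[where P = "\<lambda>k. \<exists>(a', b')\<in>\<pi>. (Inr b = (Inl a' :: slot) \<or> Inr b = (Inr b' :: slot)) \<and> num k = a' + b'", OF this]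
    show "num (x (Inr b)) = a + b" using cov u2 by (auto simp: x_def)
  qed
  have y_ext: "y s = undefined" if "s \<notin> S - cov \<pi>" for s
    using y that by (auto simp: standard_def)
  have "x \<in> assign S"
    using m(2) y_ext by (auto simp: x_def)
  moreover have "restrict x (S - cov \<pi>) = y"
    using y_ext by (auto simp: x_def fun_eq_iff)
  moreover have "leading_pairs S x = \<pi>"
  proof (intro set_eqI iffI; clarify)
    fix a b assume "(a, b) \<in> \<pi>"
    moreover from this have "Inl a \<in> S" "Inr b \<in> S" using m(2) by (force simp: cov_def)+
    ultimately show "(a, b) \<in> leading_pairs S x" by (simp add: leading_pairs_def x_val)
  next
    fix a b assume "(a, b) \<in> leading_pairs S x"
    then have ab: "Inl a \<in> S" "Inr b \<in> S" "num (x (Inl a)) = a + b" "num (x (Inr b)) = a + b"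
      by (auto simp: leading_pairs_def)
    consider b' where "(a, b') \<in> \<pi>" | a' where "(a', b) \<in> \<pi>" | "Inl a \<notin> cov \<pi>" "Inr b \<notin> cov \<pi>"
      by (force simp: cov_def)
    then show "(a, b) \<in> \<pi>"
    proof cases
      case 1
      then show ?thesis using x_val(1)[OF 1] ab by simp
    next
      case 2
      then show ?thesis using x_val(2)[OF 2] ab by simp
    next
      case 3
      then have "(a, b) \<in> leading_pairs (S - cov \<pi>) y"
        using ab by (simp add: leading_pairs_def x_def)
      then show ?thesis using y by (simp add: standard_def)
    qed
  qed
  ultimately show ?thesis by blast
qed

text \<open>The assignments with \<open>\<pi>\<close> as their set of leading pairs form disjoint
  classes, and by \<open>standard_extend\<close> the class of \<open>\<pi>\<close> restricts onto at
  least the standard assignments off \<open>\<pi>\<close>.\<close>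

lemma sum_card_standard:
  assumes S: "S \<subseteq> slots"
  shows "(\<Sum>\<pi>\<in>matchings S. card (standard (S - cov \<pi>))) \<le> card (assign S :: (slot \<Rightarrow> 'n) set)"
proof -
  have finS: "finite S" using S finite_slots by (rule finite_subset)
  note fin = finite_assign[OF finS, where 'n='n]
  let ?F = "\<lambda>\<pi>. {x \<in> assign S. leading_pairs S x = \<pi>}"
  have "(\<Sum>\<pi>\<in>matchings S. card (standard (S - cov \<pi>))) \<le> (\<Sum>\<pi>\<in>matchings S. card (?F \<pi>))"
  proof (rule sum_mono)
    fix \<pi> assume \<pi>: "\<pi> \<in> matchings S"
    have "standard (S - cov \<pi>) \<subseteq> (\<lambda>x. restrict x (S - cov \<pi>)) ` ?F \<pi>"
    proof
      fix y assume "y \<in> standard (S - cov \<pi>)"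
      from standard_extend[OF S \<pi> this]
      show "y \<in> (\<lambda>x. restrict x (S - cov \<pi>)) ` ?F \<pi>" by blast
    qed
    moreover have "finite (?F \<pi>)" using fin by simp
    ultimately show "card (standard (S - cov \<pi>)) \<le> card (?F \<pi>)"
      by (rule surj_card_le[rotated])
  qed
  also have "\<dots> = card (\<Union>\<pi>\<in>matchings S. ?F \<pi>)"
    using fin by (intro card_UN_disjoint[symmetric] finite_matchings finS) auto
  also have "\<dots> \<le> card (assign S :: (slot \<Rightarrow> 'n) set)"
    by (rule card_mono[OF fin]) auto
  finally show ?thesis .
qed

text \<open>The glued bases span all forms, while their total size is at most the dimension; hence
  together they form a basis.\<close>

lemma glued_basis:
  assumes S: "S \<subseteq> slots"
  obtains B :: "(nat \<times> nat) set \<Rightarrow> 'n form set" where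
    "\<And>\<pi>. finite (B \<pi>)" "\<And>\<pi>. cfun.independent (B \<pi>)" "\<And>\<pi>. cfun.span (B \<pi>) = harmonic (S - cov \<pi>)"
    "inj_on (\<lambda>(\<pi>, b). glue \<pi> b) (Sigma (matchings S) B)"
    "cfun.independent ((\<lambda>(\<pi>, b). glue \<pi> b) ` Sigma (matchings S) B)"
    "cfun.span ((\<lambda>(\<pi>, b). glue \<pi> b) ` Sigma (matchings S) B) = forms S"
proof -
  have finS: "finite S" using S finite_slots by (rule finite_subset)
  have "\<exists>B. B \<subseteq> harmonic (S - cov \<pi>) \<and> cfun.independent B \<and> (harmonic (S - cov \<pi>) :: 'n form set) \<subseteq> cfun.span B" for \<pi>
    by (metis cfun.maximal_independent_subset)
  then obtain B :: "(nat \<times> nat) set \<Rightarrow> 'n form set" where B: "\<And>\<pi>. B \<pi> \<subseteq> harmonic (S - cov \<pi>)"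
    "\<And>\<pi>. cfun.independent (B \<pi>)" "\<And>\<pi>. harmonic (S - cov \<pi>) \<subseteq> cfun.span (B \<pi>)" by metis
  have span: "cfun.span (B \<pi>) = harmonic (S - cov \<pi>)" for \<pi>
    using B(3)[of \<pi>] cfun.span_minimal[OF B(1) subspace_harmonic] by blast
  have fin: "finite (B \<pi>)" "card (B \<pi>) \<le> card (standard (S - cov \<pi>))" for \<pi>
    using card_independent_harmonic[OF _ B(2) B(1)] finS by auto
  let ?I = "Sigma (matchings S) B" and ?g = "\<lambda>(\<pi>, b). glue \<pi> b :: 'n form"
  let ?P = "point S ` assign S :: 'n form set"
  have fin_I: "finite ?I" using fin finite_matchings[OF finS] by blast
  have card_P: "card ?P = card (assign S :: (slot \<Rightarrow> 'n) set)"
    by (rule card_image[OF inj_on_point])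
  have card_I: "card ?I \<le> card ?P"
  proof -
    have "card ?I = (\<Sum>\<pi>\<in>matchings S. card (B \<pi>))"
      using fin finite_matchings[OF finS] by (simp add: card_SigmaI)
    also have "\<dots> \<le> (\<Sum>\<pi>\<in>matchings S. card (standard (S - cov \<pi>)))"
      by (rule sum_mono) (rule fin)
    also have "\<dots> \<le> card ?P" unfolding card_P by (rule sum_card_standard[OF S])
    finally show ?thesis .
  qed
  have gI_forms: "?g ` ?I \<subseteq> forms S"
  proof clarify
    fix \<pi> b assume "\<pi> \<in> matchings S" "b \<in> B \<pi>"
    then show "glue \<pi> b \<in> forms S"
      using B(1) harmonic_in_forms by (intro glue_in_forms[of _ "S - cov \<pi>"]) (auto simp: matchings_def)
  qed
  have "glued_harmonics S \<subseteq> cfun.span (?g ` ?I)"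
  proof
    fix t :: "'n form" assume "t \<in> glued_harmonics S"
    then obtain \<pi> h where \<pi>: "\<pi> \<in> matchings S" and h: "h \<in> cfun.span (B \<pi>)" and t: "t = glue \<pi> h"
      unfolding glued_harmonics_def span by blast
    have "t \<in> cfun.span (glue \<pi> ` B \<pi>)"
      unfolding t cfun_pair.linear_span_image[OF clinear_glue] using h by blast
    moreover have "glue \<pi> ` B \<pi> \<subseteq> ?g ` ?I" using \<pi> by force
    ultimately show "t \<in> cfun.span (?g ` ?I)" using cfun.span_mono by blast
  qed
  then have "cfun.span (glued_harmonics S) \<subseteq> cfun.span (?g ` ?I)"
    by (metis cfun.span_mono cfun.span_span)
  then have span_I: "cfun.span (?g ` ?I) = forms S"
    using forms_subset_span_glued_harmonics[OF finS] cfun.span_minimal[OF gI_forms subspace_forms] by blast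
  \<comment> \<open>With \<open>C\<close> a basis inside the glued family,
    \<open>card C \<le> card ?I \<le> card ?P \<le> card C\<close>. So no member is redundant and no
    two indices give the same form.\<close>
  obtain C where C: "C \<subseteq> ?g ` ?I" "cfun.independent C" "?g ` ?I \<subseteq> cfun.span C"
    using cfun.maximal_independent_subset by blast
  have finC: "finite C" using C(1) fin_I finite_subset by blast
  have "?P \<subseteq> cfun.span C"
  proof -
    have "?P \<subseteq> forms S" by (auto intro: point_in_forms)
    also have "\<dots> \<subseteq> cfun.span C" unfolding span_I[symmetric]
      using C(3) by (metis cfun.span_mono cfun.span_span)
    finally show ?thesis .
  qed
  then have "card ?P \<le> card C"
    using cfun.independent_span_bound[OF finC independent_point[OF finS]] by simp
  then have le: "card ?I \<le> card C" using card_I by simp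
  have C_le: "card C \<le> card (?g ` ?I)" "card (?g ` ?I) \<le> card ?I"
    using C(1) fin_I by (auto intro: card_mono card_image_le)
  then have "card (?g ` ?I) = card ?I" "card C = card (?g ` ?I)" using le by auto
  then have inj: "inj_on ?g ?I" and "C = ?g ` ?I"
    using eq_card_imp_inj_on[OF fin_I, of ?g] card_subset_eq[OF finite_imageI[OF fin_I] C(1)] by blast+
  then show ?thesis using that[of B] fin B(2) span span_I C(2) by blast
qed

end

section \<open>The group actions on forms\<close>

text \<open>On a dual slot this is the transposed inverse, the matrix of the dual
  representation.\<close>

definition slot_entry :: "complex^'n^'n \<Rightarrow> slot \<Rightarrow> 'n \<Rightarrow> 'n \<Rightarrow> complex" where
  "slot_entry U s i j = (case s of Inl _ \<Rightarrow> U $ i $ j | Inr _ \<Rightarrow> matrix_inv U $ j $ i)"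

definition act :: "complex^'n^'n \<Rightarrow> slot set \<Rightarrow> 'n::finite form \<Rightarrow> 'n form" where
  "act U S t = (\<lambda>f. \<Sum>g\<in>assign S. (\<Prod>s\<in>S. slot_entry U s (f s) (g s)) * t g)"

definition permute :: "(nat \<Rightarrow> nat) \<Rightarrow> (nat \<Rightarrow> nat) \<Rightarrow> 'n form \<Rightarrow> 'n form" where
  "permute \<alpha> \<beta> t = (\<lambda>f. t (f \<circ> map_sum \<alpha> \<beta>))"

lemma clinear_permute_act: "clinear (permute \<alpha> \<beta> \<circ> act U S)"
  by (rule clinearI) (auto simp: act_def permute_def fun_eq_iff algebra_simps sum.distrib sum_distrib_left)

lemma act_0: "act U S 0 = 0"
  by (simp add: act_def fun_eq_iff)

lemma act_in_forms: "act U S t \<in> forms S"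
proof (rule formsI)
  fix f g :: "slot \<Rightarrow> 'a" assume "\<And>s. s \<in> S \<Longrightarrow> f s = g s"
  then show "act U S t f = act U S t g"
    unfolding act_def by (intro sum.cong arg_cong2[where f = "(*)"] prod.cong refl) simp
qed

lemma act_sum: "act U S (\<lambda>g. \<Sum>i\<in>I. h i g) f = (\<Sum>i\<in>I. act U S (h i) f)"
  unfolding act_def sum_distrib_left by (rule sum.swap)

lemma sum_PiE_insert:
  fixes h :: "('i \<Rightarrow> 'n::finite) \<Rightarrow> 'c::comm_monoid_add"
  assumes "a \<notin> S"
  shows "(\<Sum>g\<in>PiE (insert a S) (\<lambda>_. UNIV). h g) = (\<Sum>p\<in>UNIV. \<Sum>g\<in>PiE S (\<lambda>_. UNIV). h (g(a := p)))"
proof -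
  have "(\<Sum>g\<in>PiE (insert a S) (\<lambda>_. UNIV). h g) = (\<Sum>(p, g)\<in>UNIV \<times> PiE S (\<lambda>_. UNIV). h (g(a := p)))"
    unfolding PiE_insert_eq
    by (subst sum.reindex[OF inj_combinator[OF assms]]) (simp add: case_prod_unfold)
  then show ?thesis by (simp add: sum.cartesian_product)
qed

text \<open>Isolates the values \<open>p\<close>, \<open>q\<close> at one pair of slots, where an
  entry of \<open>U\<close> meets an entry of its inverse. The compatibility of the action with
  contraction and with gluing both rest on this.\<close>

lemma act_split:
  fixes t :: "'n::finite form"
  assumes S: "finite S" "Inl a \<in> S" "Inr b \<in> S"
  shows "act U S t f = (\<Sum>p\<in>UNIV. \<Sum>q\<in>UNIV. U $ f (Inl a) $ p * matrix_inv U $ q $ f (Inr b) *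
    act U (S - {Inl a, Inr b}) (\<lambda>g. t (g(Inl a := p, Inr b := q))) f)"
proof -
  let ?R = "S - {Inl a, Inr b}"
  have S_eq: "S = insert (Inl a) (insert (Inr b) ?R)" using S by auto
  have "act U S t f = (\<Sum>p\<in>UNIV. \<Sum>q\<in>UNIV. \<Sum>g\<in>assign ?R.
     (\<Prod>s\<in>S. slot_entry U s (f s) ((g(Inr b := q, Inl a := p)) s)) * t (g(Inr b := q, Inl a := p)))"
    unfolding act_def by (subst S_eq) (subst sum_PiE_insert, simp, subst sum_PiE_insert, simp, simp flip: S_eq)
  also have "\<dots> = (\<Sum>p\<in>UNIV. \<Sum>q\<in>UNIV. U $ f (Inl a) $ p * matrix_inv U $ q $ f (Inr b) *
    act U (S - {Inl a, Inr b}) (\<lambda>g. t (g(Inl a := p, Inr b := q))) f)"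
  proof (intro sum.cong refl)
    fix p q
    have "(\<Prod>s\<in>S. slot_entry U s (f s) ((g(Inr b := q, Inl a := p)) s))
      = U $ f (Inl a) $ p * matrix_inv U $ q $ f (Inr b) * (\<Prod>s\<in>?R. slot_entry U s (f s) (g s))" for g
    proof -
      have "(\<Prod>s\<in>S. slot_entry U s (f s) ((g(Inr b := q, Inl a := p)) s))
        = slot_entry U (Inl a) (f (Inl a)) p * (slot_entry U (Inr b) (f (Inr b)) q *
           (\<Prod>s\<in>?R. slot_entry U s (f s) ((g(Inr b := q, Inl a := p)) s)))"
        by (subst S_eq) (use S in simp)
      also have "(\<Prod>s\<in>?R. slot_entry U s (f s) ((g(Inr b := q, Inl a := p)) s))
        = (\<Prod>s\<in>?R. slot_entry U s (f s) (g s))"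
        by (intro prod.cong refl) auto
      finally show ?thesis by (simp only: slot_entry_def sum.case mult.assoc)
    qed
    moreover have "g(Inr b := q, Inl a := p) = g(Inl a := p, Inr b := q)" for g :: "slot \<Rightarrow> 'n"
      by (rule fun_upd_twist) simp
    ultimately show "(\<Sum>g\<in>assign ?R. (\<Prod>s\<in>S. slot_entry U s (f s) ((g(Inr b := q, Inl a := p)) s)) * t (g(Inr b := q, Inl a := p)))
      = U $ f (Inl a) $ p * matrix_inv U $ q $ f (Inr b) *
    act U (S - {Inl a, Inr b}) (\<lambda>g. t (g(Inl a := p, Inr b := q))) f"
      by (simp add: act_def sum_distrib_left mult.assoc)
  qed
  finally show ?thesis .
qed

lemma matrix_inv_entries:
  fixes U :: "complex^'n^'n"
  assumes "invertible U"
  shows "(\<Sum>k\<in>UNIV. matrix_inv U $ q $ k * U $ k $ p) = (if q = p then 1 else 0)"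
    and "(\<Sum>k\<in>UNIV. U $ q $ k * matrix_inv U $ k $ p) = (if q = p then 1 else 0)"
proof -
  have "U ** matrix_inv U = mat 1" "matrix_inv U ** U = mat 1"
    using someI_ex[OF assms[unfolded invertible_def]] by (auto simp: matrix_inv_def)
  then have "(matrix_inv U ** U) $ q $ p = mat 1 $ q $ p" "(U ** matrix_inv U) $ q $ p = mat 1 $ q $ p"
    by simp_all
  then show "(\<Sum>k\<in>UNIV. matrix_inv U $ q $ k * U $ k $ p) = (if q = p then 1 else 0)"
    "(\<Sum>k\<in>UNIV. U $ q $ k * matrix_inv U $ k $ p) = (if q = p then 1 else 0)"
    by (simp_all add: matrix_matrix_mult_def mat_def)
qed

text \<open>Contracting sums the product of the two isolated entries in the order that gives
  \<open>matrix_inv U ** U\<close>. Gluing, in \<open>act_glue_single\<close>, produces the opposite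
  order.\<close>

lemma pair_trace_act:
  fixes t :: "'n::finite form"
  assumes S: "finite S" "Inl a \<in> S" "Inr b \<in> S" and U: "invertible U"
  shows "pair_trace a b (act U S t) = act U (S - {Inl a, Inr b}) (pair_trace a b t)"
proof
  fix f
  let ?R = "S - {Inl a, Inr b}"
  let ?t = "\<lambda>p q g. t (g(Inl a := p, Inr b := q))"
  have upd: "act U ?R h (f(Inl a := k, Inr b := k)) = act U ?R h f" for h k
    by (rule formsD[OF act_in_forms]) auto
  have "pair_trace a b (act U S t) f = (\<Sum>k\<in>UNIV. \<Sum>p\<in>UNIV. \<Sum>q\<in>UNIV. U $ k $ p * matrix_inv U $ q $ k * act U ?R (?t p q) f)"
    unfolding pair_trace_def act_split[OF S] by (simp add: upd)
  also have "\<dots> = (\<Sum>p\<in>UNIV. \<Sum>q\<in>UNIV. \<Sum>k\<in>UNIV. U $ k $ p * matrix_inv U $ q $ k * act U ?R (?t p q) f)"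
    by (subst sum.swap, rule sum.cong[OF refl], rule sum.swap)
  also have "\<dots> = (\<Sum>p\<in>UNIV. \<Sum>q\<in>UNIV. (if q = p then 1 else 0) * act U ?R (?t p q) f)"
    by (simp only: matrix_inv_entries(1)[OF U, symmetric] sum_distrib_right mult.commute[of "U $ _ $ _"])
  also have "\<dots> = (\<Sum>p\<in>UNIV. act U ?R (?t p p) f)"
    by (simp add: if_distrib[of "\<lambda>x. x * _"] cong: if_cong)
  also have "\<dots> = act U ?R (pair_trace a b t) f"
    by (simp add: pair_trace_def act_sum)
  finally show "pair_trace a b (act U S t) f = act U ?R (pair_trace a b t) f" .
qed

lemma act_harmonic:
  assumes "finite S" "invertible U" "t \<in> harmonic S"
  shows "act U S t \<in> harmonic S"
  using assms by (auto simp: harmonic_def act_in_forms pair_trace_act act_0)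

lemma act_glue_single:
  fixes t :: "'n::finite form"
  assumes S: "finite S" "Inl a \<in> S" "Inr b \<in> S" and U: "invertible U"
    and t: "t \<in> forms (S - {Inl a, Inr b})"
  shows "act U S (glue {(a, b)} t) = glue {(a, b)} (act U (S - {Inl a, Inr b}) t)"
proof
  fix f
  let ?R = "S - {Inl a, Inr b}"
  have *: "(\<lambda>g. glue {(a, b)} t (g(Inl a := p, Inr b := q))) = (if p = q then t else 0)" for p q
  proof
    fix g :: "slot \<Rightarrow> 'n"
    have "t (g(Inl a := p, Inr b := q)) = t g" by (rule formsD[OF t]) auto
    then show "glue {(a, b)} t (g(Inl a := p, Inr b := q)) = (if p = q then t else 0) g"
      by (cases "p = q") (simp_all add: glue_def)
  qed
  have "act U S (glue {(a, b)} t) f = (\<Sum>p\<in>UNIV. \<Sum>q\<in>UNIV. U $ f (Inl a) $ p * matrix_inv U $ q $ f (Inr b) *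
    act U ?R (if p = q then t else 0) f)"
    unfolding act_split[OF S] * ..
  also have "\<dots> = (\<Sum>p\<in>UNIV. \<Sum>q\<in>UNIV. if p = q then U $ f (Inl a) $ p * matrix_inv U $ q $ f (Inr b) * act U ?R t f else 0)"
    by (intro sum.cong refl) (simp add: act_0)
  also have "\<dots> = (\<Sum>p\<in>UNIV. U $ f (Inl a) $ p * matrix_inv U $ p $ f (Inr b)) * act U ?R t f"
    by (simp add: sum_distrib_right)
  also have "\<dots> = glue {(a, b)} (act U ?R t) f"
    by (simp add: matrix_inv_entries(2)[OF U] glue_def)
  finally show "act U S (glue {(a, b)} t) f = glue {(a, b)} (act U ?R t) f" .
qed

lemma act_glue:
  fixes t :: "'n::finite form"
  assumes "finite S" "\<pi> \<in> matchings S" "invertible U" "t \<in> forms (S - cov \<pi>)"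
  shows "act U S (glue \<pi> t) = glue \<pi> (act U (S - cov \<pi>) t)"
proof -
  have "finite \<pi>" using finite_matching assms by blast
  then show ?thesis using assms
  proof (induction \<pi> arbitrary: S rule: finite_induct)
    case empty
    then show ?case by simp
  next
    case (insert e \<pi>)
    obtain a b where e: "e = (a, b)" by (cases e)
    let ?R = "S - {Inl a, Inr b}"
    have m: "matching \<pi>" "Inl a \<notin> cov \<pi>" "Inr b \<notin> cov \<pi>" and ab: "Inl a \<in> S" "Inr b \<in> S" and "cov \<pi> \<subseteq> S"
    proof -
      have "matching (insert (a, b) \<pi>)" "cov (insert (a, b) \<pi>) \<subseteq> S"
        using insert.prems(2) by (auto simp: e matchings_def)
      then show "matching \<pi>" "Inl a \<notin> cov \<pi>" "Inr b \<notin> cov \<pi>" "Inl a \<in> S" "Inr b \<in> S" "cov \<pi> \<subseteq> S"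
        using matching_insert[of a b \<pi>] insert.hyps(2) unfolding e cov_insert by blast+
    qed
    then have \<pi>: "\<pi> \<in> matchings ?R" by (auto simp: matchings_def)
    have R: "S - cov (insert e \<pi>) = ?R - cov \<pi>" by (auto simp: e cov_insert)
    have t: "t \<in> forms (?R - cov \<pi>)" using insert.prems(4) R by simp
    have "glue \<pi> t \<in> forms ?R"
      using \<pi> by (intro glue_in_forms[OF t]) (auto simp: matchings_def)
    then have "act U S (glue {(a, b)} (glue \<pi> t)) = glue {(a, b)} (act U ?R (glue \<pi> t))"
      by (rule act_glue_single[OF insert.prems(1) ab insert.prems(3)])
    also have "act U ?R (glue \<pi> t) = glue \<pi> (act U (?R - cov \<pi>) t)"
      using insert.prems \<pi> t by (intro insert.IH) auto
    finally show ?case unfolding R by (simp add: e glue_insert[of a b \<pi>])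
  qed
qed

section \<open>Permutations of slots acting on matchings\<close>

lemma permute_glue: "permute \<alpha> \<beta> (glue \<pi> t) = glue (map_prod \<alpha> \<beta> ` \<pi>) (permute \<alpha> \<beta> t)"
  by (auto simp: permute_def glue_def fun_eq_iff)

lemma cov_map_prod: "cov (map_prod \<alpha> \<beta> ` \<pi>) = map_sum \<alpha> \<beta> ` cov \<pi>"
  by (simp add: cov_def image_Un image_image)

lemma permute_in_forms: "t \<in> forms S \<Longrightarrow> permute \<alpha> \<beta> t \<in> forms (map_sum \<alpha> \<beta> ` S)"
  unfolding permute_def by (rule formsI) (rule formsD[of t S], auto)

lemma inj_map_sum: "inj \<alpha> \<Longrightarrow> inj \<beta> \<Longrightarrow> inj (map_sum \<alpha> \<beta>)"
  by (rule injI) (auto simp: map_sum_def split: sum.splits dest: injD)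

lemma permute_harmonic:
  fixes t :: "'n::finite form"
  assumes inj: "inj \<alpha>" "inj \<beta>" and t: "t \<in> harmonic S"
  shows "permute \<alpha> \<beta> t \<in> harmonic (map_sum \<alpha> \<beta> ` S)"
proof -
  have "pair_trace a b (permute \<alpha> \<beta> t) = 0"
    if ab: "Inl a \<in> map_sum \<alpha> \<beta> ` S" "Inr b \<in> map_sum \<alpha> \<beta> ` S" for a b
  proof
    fix f :: "slot \<Rightarrow> 'n"
    obtain a' where a': "a = \<alpha> a'" "Inl a' \<in> S" using ab(1) by (auto simp: map_sum_def split: sum.splits)
    obtain b' where b': "b = \<beta> b'" "Inr b' \<in> S" using ab(2) by (auto simp: map_sum_def split: sum.splits)
    have "f(Inl a := k, Inr b := k) \<circ> map_sum \<alpha> \<beta> = (f \<circ> map_sum \<alpha> \<beta>)(Inl a' := k, Inr b' := k)" for k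
    proof
      fix s show "(f(Inl a := k, Inr b := k) \<circ> map_sum \<alpha> \<beta>) s = ((f \<circ> map_sum \<alpha> \<beta>)(Inl a' := k, Inr b' := k)) s"
        using inj by (cases s) (simp_all add: a' b' inj_eq)
    qed
    then have "pair_trace a b (permute \<alpha> \<beta> t) f = pair_trace a' b' t (f \<circ> map_sum \<alpha> \<beta>)"
      by (simp add: pair_trace_def permute_def)
    then show "pair_trace a b (permute \<alpha> \<beta> t) f = 0 f"
      using t a' b' by (simp add: harmonic_def)
  qed
  then show ?thesis using permute_in_forms[OF harmonic_in_forms[OF t]] by (simp add: harmonic_def)
qed

lemma matching_map_prod:
  assumes "inj \<alpha>" "inj \<beta>" "matching \<pi>"
  shows "matching (map_prod \<alpha> \<beta> ` \<pi>)"
proof -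
  have "fst \<circ> map_prod \<alpha> \<beta> = \<alpha> \<circ> fst" "snd \<circ> map_prod \<alpha> \<beta> = \<beta> \<circ> snd" by auto
  moreover have "inj_on (\<alpha> \<circ> fst) \<pi>" "inj_on (\<beta> \<circ> snd) \<pi>"
    using assms unfolding matching_def by (meson comp_inj_on inj_on_subset subset_UNIV)+
  ultimately show ?thesis unfolding matching_def using inj_on_imageI by metis
qed

definition harmonic_trace ::
  "(nat \<Rightarrow> nat) \<Rightarrow> (nat \<Rightarrow> nat) \<Rightarrow> complex^'n^'n \<Rightarrow> slot set \<Rightarrow> complex" where
  "harmonic_trace \<alpha> \<beta> U S = cfun.trace_on (harmonic S) (permute \<alpha> \<beta> \<circ> act U S)"

text \<open>The trace in the basis of coordinate forms. The right-hand side links each slot to its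
  successor under the permutation and therefore factors over the cycles.\<close>

lemma trace_on_forms:
  fixes U :: "complex^'n::finite^'n"
  assumes S: "finite S" "map_sum \<alpha> \<beta> ` S = S"
  shows "cfun.trace_on (forms S) (permute \<alpha> \<beta> \<circ> act U S)
    = (\<Sum>x\<in>assign S. \<Prod>s\<in>S. slot_entry U s (x (map_sum \<alpha> \<beta> s)) (x s))"
proof -
  let ?G = "permute \<alpha> \<beta> \<circ> act U S" and ?P = "point S ` assign S :: 'n form set"
  have finP: "finite ?P" using finite_assign[OF S(1), where 'n='n] by blast
  have G: "?G t \<in> forms S" for t :: "'n form"
    using permute_in_forms[OF act_in_forms[of U S t], of \<alpha> \<beta>] S(2) by simp
  have "cfun.trace_on (forms S) ?G = (\<Sum>e\<in>?P. cfun.representation ?P (?G e) e)"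
    unfolding span_point[OF S(1), symmetric]
    by (rule cfun.trace_on_eq_sum[OF independent_point[OF S(1)] finP clinear_permute_act])
       (simp only: span_point[OF S(1)] G)
  also have "\<dots> = (\<Sum>x\<in>assign S. ?G (point S x) x)"
    by (subst sum.reindex[OF inj_on_point])
       (simp only: o_apply representation_point[OF S(1) G, unfolded o_apply] cong: sum.cong)
  also have "\<dots> = (\<Sum>x\<in>assign S. \<Prod>s\<in>S. slot_entry U s (x (map_sum \<alpha> \<beta> s)) (x s))"
  proof (intro sum.cong refl)
    fix x :: "slot \<Rightarrow> 'n" assume x: "x \<in> assign S"
    have "?G (point S x) x = (\<Sum>g\<in>assign S. if g = x then \<Prod>s\<in>S. slot_entry U s (x (map_sum \<alpha> \<beta> s)) (g s) else 0)"
      unfolding permute_def act_def o_apply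
      using x by (intro sum.cong refl) (auto simp: point_apply_assign)
    also have "\<dots> = (\<Prod>s\<in>S. slot_entry U s (x (map_sum \<alpha> \<beta> s)) (x s))"
      using x finite_assign[OF S(1), where 'n='n] by simp
    finally show "?G (point S x) x = (\<Prod>s\<in>S. slot_entry U s (x (map_sum \<alpha> \<beta> s)) (x s))" .
  qed
  finally show ?thesis .
qed

context index_numbering
begin

text \<open>In the glued basis the operator maps the block of \<open>\<pi>\<close> into that of
  \<open>?m \<pi>\<close>. Only blocks mapped to themselves meet the diagonal, and there gluing
  carries the trace back to the harmonic forms in the unmatched slots.\<close>

theorem trace_on_forms_eq_sum_harmonic:
  fixes U :: "complex^'n^'n"
  assumes S: "S \<subseteq> slots" "map_sum \<alpha> \<beta> ` S = S" and U: "invertible U" and inj: "inj \<alpha>" "inj \<beta>"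
  shows "cfun.trace_on (forms S) (permute \<alpha> \<beta> \<circ> act U S)
    = (\<Sum>\<pi> | \<pi> \<in> matchings S \<and> map_prod \<alpha> \<beta> ` \<pi> = \<pi>. harmonic_trace \<alpha> \<beta> U (S - cov \<pi>))"
proof -
  have finS: "finite S" using S(1) finite_slots by (rule finite_subset)
  note fin_m = finite_matchings[OF finS]
  obtain B :: "(nat \<times> nat) set \<Rightarrow> 'n form set" where
    B: "\<And>\<pi>. finite (B \<pi>)" "\<And>\<pi>. cfun.independent (B \<pi>)" "\<And>\<pi>. cfun.span (B \<pi>) = harmonic (S - cov \<pi>)"
    and inj_g: "inj_on (\<lambda>(\<pi>, b). glue \<pi> b) (Sigma (matchings S) B)"
    and ind: "cfun.independent ((\<lambda>(\<pi>, b). glue \<pi> b) ` Sigma (matchings S) B)"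
    and span: "cfun.span ((\<lambda>(\<pi>, b). glue \<pi> b) ` Sigma (matchings S) B) = forms S"
    using glued_basis[OF S(1)] by blast
  define C where "C = (\<lambda>(\<pi>, b). glue \<pi> b) ` Sigma (matchings S) B"
  define G where "G R = permute \<alpha> \<beta> \<circ> act U R" for R
  define R where "R = cfun.representation C"
  let ?m = "\<lambda>\<pi>. map_prod \<alpha> \<beta> ` \<pi>"
  have finI: "finite (Sigma (matchings S) B)" using B(1) fin_m by blast
  have G_lin: "clinear (G T)" for T unfolding G_def by (rule clinear_permute_act)
  have G_forms: "G S t \<in> forms S" for t
    using permute_in_forms[OF act_in_forms[of U S t], of \<alpha> \<beta>] S(2) by (simp add: G_def)
  have inj_\<sigma>: "inj (map_sum \<alpha> \<beta>)" using inj by (rule inj_map_sum)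
  have m: "?m \<pi> \<in> matchings S" if "\<pi> \<in> matchings S" for \<pi>
    using that matching_map_prod[OF inj] S(2) by (auto simp: matchings_def cov_map_prod)
  have S_diff: "map_sum \<alpha> \<beta> ` (S - cov \<pi>) = S - cov (?m \<pi>)" for \<pi>
    by (simp add: cov_map_prod image_set_diff[OF inj_\<sigma>] S(2))
  have G_harm: "G (S - cov \<pi>) b \<in> cfun.span (B (?m \<pi>))" if "b \<in> cfun.span (B \<pi>)" for b \<pi>
    using permute_harmonic[OF inj act_harmonic[OF _ U], of "S - cov \<pi>" b] that finS
    unfolding B(3) S_diff by (simp add: G_def)
  have G_glue: "G S (glue \<pi> b) = glue (?m \<pi>) (G (S - cov \<pi>) b)"
    if "\<pi> \<in> matchings S" "b \<in> cfun.span (B \<pi>)" for \<pi> b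
  proof -
    have "b \<in> forms (S - cov \<pi>)" using that(2) unfolding B(3) by (rule harmonic_in_forms)
    then show ?thesis
      using act_glue[OF finS that(1) U, of b] by (simp add: G_def permute_glue)
  qed
  have B_in_span: "b \<in> cfun.span (B \<pi>)" if "b \<in> B \<pi>" for b \<pi>
    using that by (rule cfun.span_base)
  \<comment> \<open>The coordinates of the image with respect to all of \<open>C\<close> may be
    computed in the block of \<open>?m \<pi>\<close> alone.\<close>
  have rep: "R (G S (glue \<pi> b)) = cfun.representation (glue (?m \<pi>) ` B (?m \<pi>)) (G S (glue \<pi> b))"
    if "\<pi> \<in> matchings S" "b \<in> B \<pi>" for \<pi> b
    unfolding R_def
  proof (rule cfun.representation_extend)
    show "cfun.independent C" unfolding C_def by (rule ind)
    show "G S (glue \<pi> b) \<in> cfun.span (glue (?m \<pi>) ` B (?m \<pi>))"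
      unfolding G_glue[OF that(1) B_in_span[OF that(2)]] cfun_pair.linear_span_image[OF clinear_glue]
      using G_harm[OF B_in_span[OF that(2)]] by blast
    show "glue (?m \<pi>) ` B (?m \<pi>) \<subseteq> C" unfolding C_def using m[OF that(1)] by force
  qed
  \<comment> \<open>Injectivity of the indexing of the glued basis keeps \<open>glue \<pi> b\<close>
    from being at the same time a member of another block.\<close>
  have zero: "R (G S (glue \<pi> b)) (glue \<pi> b) = 0"
    if "\<pi> \<in> matchings S" "?m \<pi> \<noteq> \<pi>" "b \<in> B \<pi>" for \<pi> b
  proof (rule ccontr)
    assume "R (G S (glue \<pi> b)) (glue \<pi> b) \<noteq> 0"
    then have "glue \<pi> b \<in> glue (?m \<pi>) ` B (?m \<pi>)"
      unfolding rep[OF that(1,3)] by (rule cfun.representation_ne_zero)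
    then obtain c where "c \<in> B (?m \<pi>)" "glue \<pi> b = glue (?m \<pi>) c" by blast
    then have "(\<pi>, b) = (?m \<pi>, c)"
      using that m[OF that(1)] by (intro inj_onD[OF inj_g]) auto
    then show False using that(2) by simp
  qed
  have fixed: "(\<Sum>b\<in>B \<pi>. R (G S (glue \<pi> b)) (glue \<pi> b)) = harmonic_trace \<alpha> \<beta> U (S - cov \<pi>)"
    if \<pi>: "\<pi> \<in> matchings S" "?m \<pi> = \<pi>" for \<pi>
  proof -
    let ?D = "glue \<pi> ` B \<pi>"
    have inj_B: "inj_on (glue \<pi>) (cfun.span (B \<pi>))"
      using \<pi>(1) harmonic_in_forms unfolding B(3)
      by (intro inj_on_subset[OF inj_on_glue[of \<pi> S]]) (auto simp: matchings_def)
    have inj_B': "inj_on (glue \<pi>) (B \<pi>)" using inj_B cfun.span_superset by (rule inj_on_subset)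
    have ind_D: "cfun.independent ?D"
      using ind unfolding C_def[symmetric] by (rule cfun.independent_mono) (use \<pi>(1) in \<open>force simp: C_def\<close>)
    have span_D: "cfun.span ?D = glue \<pi> ` cfun.span (B \<pi>)"
      by (rule cfun_pair.linear_span_image[OF clinear_glue])
    have G_D: "G S c \<in> cfun.span ?D" if "c \<in> ?D" for c
    proof -
      obtain b where b: "c = glue \<pi> b" "b \<in> cfun.span (B \<pi>)" using \<open>c \<in> ?D\<close> B_in_span by blast
      then show ?thesis
        unfolding b(1) G_glue[OF \<pi>(1) b(2)] span_D \<pi>(2) using G_harm[OF b(2)] \<pi>(2) by simp
    qed
    have "(\<Sum>b\<in>B \<pi>. R (G S (glue \<pi> b)) (glue \<pi> b))
      = (\<Sum>b\<in>B \<pi>. cfun.representation ?D (G S (glue \<pi> b)) (glue \<pi> b))"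
      using rep[OF \<pi>(1)] \<pi>(2) by simp
    also have "\<dots> = (\<Sum>c\<in>?D. cfun.representation ?D (G S c) c)"
      by (subst sum.reindex[OF inj_B']) simp
    also have "\<dots> = cfun.trace_on (cfun.span ?D) (G S)"
      using B(1) by (intro cfun.trace_on_eq_sum[symmetric, OF ind_D _ G_lin G_D]) auto
    also have "\<dots> = cfun.trace_on (cfun.span (B \<pi>)) (G (S - cov \<pi>))"
      unfolding span_D
    proof (rule cfun_pair.trace_on_image[OF B(2) B(1) clinear_glue inj_B G_lin _ G_lin])
      show "G (S - cov \<pi>) b \<in> cfun.span (B \<pi>)" "G S (glue \<pi> b) = glue \<pi> (G (S - cov \<pi>) b)" if "b \<in> B \<pi>" for b
        using G_harm[OF B_in_span[OF that]] G_glue[OF \<pi>(1) B_in_span[OF that]] \<pi>(2) by auto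
    qed
    finally show ?thesis unfolding B(3) G_def harmonic_trace_def .
  qed
  have "cfun.trace_on (forms S) (G S) = (\<Sum>c\<in>C. R (G S c) c)"
    unfolding span[symmetric] C_def[symmetric] R_def
    by (rule cfun.trace_on_eq_sum) (use ind finI G_lin G_forms span in \<open>auto simp: C_def\<close>)
  also have "\<dots> = (\<Sum>(\<pi>, b)\<in>Sigma (matchings S) B. R (G S (glue \<pi> b)) (glue \<pi> b))"
    unfolding C_def by (subst sum.reindex[OF inj_g]) (simp add: case_prod_unfold)
  also have "\<dots> = (\<Sum>\<pi>\<in>matchings S. \<Sum>b\<in>B \<pi>. R (G S (glue \<pi> b)) (glue \<pi> b))"
    using B(1) fin_m by (simp add: sum.Sigma)
  also have "\<dots> = (\<Sum>\<pi>\<in>matchings S. if ?m \<pi> = \<pi> then harmonic_trace \<alpha> \<beta> U (S - cov \<pi>) else 0)"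
    using fixed zero by (intro sum.cong refl) simp
  also have "\<dots> = (\<Sum>\<pi> | \<pi> \<in> matchings S \<and> ?m \<pi> = \<pi>. harmonic_trace \<alpha> \<beta> U (S - cov \<pi>))"
    by (rule sum.inter_filter[OF fin_m, symmetric])
  finally show ?thesis by (simp add: G_def)
qed

end

section \<open>The unitary group\<close>

lemma conj_transpose_mult: "conj_transpose (A ** B) = conj_transpose B ** conj_transpose A"
  by (simp add: conj_transpose_def matrix_matrix_mult_def vec_eq_iff mult.commute)

lemma matrix_inv_unique:
  fixes A B :: "complex^'n^'n"
  assumes "A ** B = mat 1" "B ** A = mat 1"
  shows "matrix_inv A = B"
proof -
  have "invertible A" using assms by (auto simp: invertible_def)
  then have A: "A ** matrix_inv A = mat 1" "matrix_inv A ** A = mat 1"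
    using someI_ex[of "\<lambda>A'. A ** A' = mat 1 \<and> A' ** A = mat 1"] by (auto simp: matrix_inv_def invertible_def)
  have "matrix_inv A = matrix_inv A ** (A ** B)" using assms by simp
  also have "\<dots> = B" using A by (simp add: matrix_mul_assoc)
  finally show ?thesis .
qed

lemma unitary_inv: "U \<in> unitary_group \<Longrightarrow> matrix_inv U = conj_transpose U"
  by (rule matrix_inv_unique) (auto simp: unitary_group_def)

lemma unitary_invertible: "U \<in> unitary_group \<Longrightarrow> invertible U"
  by (auto simp: unitary_group_def invertible_def)

lemma unitary_mult:
  assumes "U \<in> unitary_group" "V \<in> unitary_group"
  shows "V ** U \<in> unitary_group"
proof -
  have "conj_transpose U ** (conj_transpose V ** V) ** U = mat 1"
    "V ** (U ** conj_transpose U) ** conj_transpose V = mat 1"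
    using assms by (simp_all add: unitary_group_def)
  then show ?thesis
    by (simp add: unitary_group_def conj_transpose_mult matrix_mul_assoc)
qed

lemma slot_entry_unitary:
  "U \<in> unitary_group \<Longrightarrow> slot_entry U s i j = (case s of Inl _ \<Rightarrow> U $ i $ j | Inr _ \<Rightarrow> cnj (U $ i $ j))"
  by (simp add: slot_entry_def unitary_inv conj_transpose_def split: sum.splits)

lemma slot_entry_mult:
  assumes "U \<in> unitary_group" "V \<in> unitary_group"
  shows "slot_entry (V ** U) s i h = (\<Sum>j\<in>UNIV. slot_entry V s i j * slot_entry U s j h)"
  unfolding slot_entry_unitary[OF assms(1)] slot_entry_unitary[OF assms(2)] slot_entry_unitary[OF unitary_mult[OF assms]]
  by (simp add: matrix_matrix_mult_def split: sum.splits)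

lemma act_mult:
  fixes U V :: "complex^'n::finite^'n"
  assumes S: "finite S" and UV: "U \<in> unitary_group" "V \<in> unitary_group"
  shows "act V S (act U S t) = act (V ** U) S t"
proof
  fix f :: "slot \<Rightarrow> 'n"
  have "act V S (act U S t) f = (\<Sum>g\<in>assign S. \<Sum>h\<in>assign S.
     (\<Prod>s\<in>S. slot_entry V s (f s) (g s) * slot_entry U s (g s) (h s)) * t h)"
    by (simp add: act_def sum_distrib_left prod.distrib mult.assoc)
  also have "\<dots> = (\<Sum>h\<in>assign S. (\<Sum>g\<in>assign S. \<Prod>s\<in>S. slot_entry V s (f s) (g s) * slot_entry U s (g s) (h s)) * t h)"
    by (subst sum.swap) (simp add: sum_distrib_right)
  also have "\<dots> = (\<Sum>h\<in>assign S. (\<Prod>s\<in>S. \<Sum>j\<in>UNIV. slot_entry V s (f s) j * slot_entry U s j (h s)) * t h)"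
    using S by (subst prod_sum_PiE) auto
  also have "\<dots> = act (V ** U) S t f"
    by (simp add: act_def slot_entry_mult[OF UV])
  finally show "act V S (act U S t) f = act (V ** U) S t f" .
qed

text \<open>For a unit vector \<open>v\<close> this multiplies \<open>v\<close> by \<open>z\<close>
  and fixes its orthogonal complement. Since the projection onto \<open>v\<close> is idempotent,
  these matrices are multiplicative in \<open>z\<close>, which gives explicit one-parameter
  subgroups of the unitary group.\<close>

definition phase_reflection :: "('n \<Rightarrow> complex) \<Rightarrow> complex \<Rightarrow> complex^'n^'n" where
  "phase_reflection v z = (\<chi> i j. (if i = j then 1 else 0) + (z - 1) * (v i * cnj (v j)))"

lemma phase_reflection_mult:
  fixes v :: "'n::finite \<Rightarrow> complex"
  assumes "(\<Sum>i\<in>UNIV. v i * cnj (v i)) = 1"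
  shows "phase_reflection v z ** phase_reflection v w = phase_reflection v (z * w)"
proof -
  have "(\<Sum>k\<in>UNIV. ((if i = k then 1 else 0) + (z - 1) * (v i * cnj (v k))) *
      ((if k = j then 1 else 0) + (w - 1) * (v k * cnj (v j))))
    = (if i = j then 1 else 0) + (z * w - 1) * (v i * cnj (v j))" for i j
  proof -
    have "(\<Sum>k\<in>UNIV. ((if i = k then 1 else 0) + (z - 1) * (v i * cnj (v k))) *
      ((if k = j then 1 else 0) + (w - 1) * (v k * cnj (v j))))
      = (\<Sum>k\<in>UNIV. (if i = k then (if k = j then 1 else 0) + (w - 1) * (v k * cnj (v j)) else 0)
        + (if k = j then (z - 1) * (v i * cnj (v k)) else 0)
        + ((z - 1) * (w - 1) * v i * cnj (v j)) * (v k * cnj (v k)))"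
      by (intro sum.cong refl) (auto simp: algebra_simps)
    also have "\<dots> = (if i = j then 1 else 0) + (w - 1) * (v i * cnj (v j)) + (z - 1) * (v i * cnj (v j))
        + ((z - 1) * (w - 1) * v i * cnj (v j)) * (\<Sum>k\<in>UNIV. v k * cnj (v k))"
      by (simp add: sum.distrib sum_distrib_left)
    finally show ?thesis by (simp add: assms algebra_simps)
  qed
  then show ?thesis by (simp add: phase_reflection_def matrix_matrix_mult_def vec_eq_iff)
qed

lemma phase_reflection_unitary:
  fixes v :: "'n::finite \<Rightarrow> complex"
  assumes "(\<Sum>i\<in>UNIV. v i * cnj (v i)) = 1" "cmod z = 1"
  shows "phase_reflection v z \<in> unitary_group"
proof -
  have "conj_transpose (phase_reflection v z) = phase_reflection v (cnj z)"
    by (simp add: conj_transpose_def phase_reflection_def vec_eq_iff)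
  moreover have "z * cnj z = 1" using assms(2) by (simp add: complex_norm_square[symmetric])
  moreover have "phase_reflection v 1 = mat 1"
    by (simp add: phase_reflection_def mat_def vec_eq_iff)
  ultimately show ?thesis
    by (simp add: unitary_group_def phase_reflection_mult[OF assms(1)] mult.commute)
qed

section \<open>Invariant traceless forms vanish\<close>

text \<open>The derivative of \<open>slot_entry\<close> at the identity: minus the transpose on dual
  slots.\<close>

definition lie_entry :: "('n \<Rightarrow> 'n \<Rightarrow> complex) \<Rightarrow> slot \<Rightarrow> 'n \<Rightarrow> 'n \<Rightarrow> complex" where
  "lie_entry X s i j = (case s of Inl _ \<Rightarrow> X i j | Inr _ \<Rightarrow> - X j i)"

text \<open>The action of the Lie algebra gl(N) by the Leibniz rule, on one slot at a time.\<close>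

definition lie_act :: "('n \<Rightarrow> 'n \<Rightarrow> complex) \<Rightarrow> slot set \<Rightarrow> 'n::finite form \<Rightarrow> 'n form" where
  "lie_act X S t = (\<lambda>f. \<Sum>s\<in>S. \<Sum>j\<in>UNIV. lie_entry X s (f s) j * t (f(s := j)))"

lemma lie_act_add: "lie_act (\<lambda>i j. X i j + Y i j) S t f = lie_act X S t f + lie_act Y S t f"
proof -
  have "lie_entry (\<lambda>i j. X i j + Y i j) s i j = lie_entry X s i j + lie_entry Y s i j" for s i j
    by (simp add: lie_entry_def split: sum.splits)
  then show ?thesis by (simp add: lie_act_def distrib_right sum.distrib)
qed

lemma lie_act_scale: "lie_act (\<lambda>i j. c * X i j) S t f = c * lie_act X S t f"
proof -
  have "lie_entry (\<lambda>i j. c * X i j) s i j = c * lie_entry X s i j" for s i j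
    by (simp add: lie_entry_def split: sum.splits)
  then show ?thesis by (simp add: lie_act_def sum_distrib_left mult.assoc)
qed

text \<open>Differentiating a product over slots at the identity leaves Kronecker deltas in all
  slots but one; the sum over assignments then collapses to the value in that slot.\<close>

lemma sum_assign_single_slot:
  fixes t :: "'n::finite form"
  assumes S: "finite S" "s \<in> S" and t: "t \<in> forms S"
  shows "(\<Sum>g\<in>assign S. c (g s) * (\<Prod>r\<in>S - {s}. if f r = g r then 1 else 0) * t g)
    = (\<Sum>j\<in>UNIV. c j * t (f(s := j)))"
proof -
  let ?R = "S - {s}"
  have S_eq: "S = insert s ?R" using S by auto
  have "(\<Sum>g\<in>assign S. c (g s) * (\<Prod>r\<in>?R. if f r = g r then 1 else 0) * t g)
    = (\<Sum>j\<in>UNIV. \<Sum>g\<in>assign ?R. c j * (\<Prod>r\<in>?R. if f r = (g(s := j)) r then 1 else 0) * t (g(s := j)))"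
    by (subst S_eq, subst sum_PiE_insert) simp_all
  also have "\<dots> = (\<Sum>j\<in>UNIV. \<Sum>g\<in>assign ?R. if g = restrict f ?R then c j * t (f(s := j)) else 0)"
  proof (intro sum.cong refl)
    fix j and g :: "slot \<Rightarrow> 'n" assume g: "g \<in> assign ?R"
    show "c j * (\<Prod>r\<in>?R. if f r = (g(s := j)) r then 1 else 0) * t (g(s := j))
      = (if g = restrict f ?R then c j * t (f(s := j)) else 0)"
    proof (cases "g = restrict f ?R")
      case True
      have "(\<Prod>r\<in>?R. if f r = (g(s := j)) r then 1 else (0 :: complex)) = 1"
        by (rule prod.neutral) (simp add: True)
      moreover have "t (g(s := j)) = t (f(s := j))"
        by (rule formsD[OF t]) (simp add: True)
      ultimately show ?thesis using True by simp
    next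
      case False
      have "\<exists>r\<in>?R. f r \<noteq> g r"
      proof (rule ccontr)
        assume "\<not> ?thesis"
        then have "g = restrict f ?R" by (intro assign_eqI[OF g]) auto
        then show False using False by contradiction
      qed
      then obtain r where "r \<in> ?R" "f r \<noteq> g r" by blast
      then have "(\<Prod>r\<in>?R. if f r = (g(s := j)) r then 1 else (0 :: complex)) = 0"
        using S(1) by (intro prod_zero) auto
      then show ?thesis using False by simp
    qed
  qed
  also have "\<dots> = (\<Sum>j\<in>UNIV. c j * t (f(s := j)))"
  proof -
    have "restrict f ?R \<in> assign ?R" by auto
    moreover have "finite (assign ?R :: (slot \<Rightarrow> 'n) set)" using S(1) by (intro finite_assign) simp
    ultimately show ?thesis by simp
  qed
  finally show ?thesis .
qed

text \<open>Differentiating the invariance under the phase reflections \<open>1 + (e\<^sup>i\<^sup>\<theta> - 1) v v\<^sup>*\<close> at \<open>\<theta> = 0\<close>.\<close>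

lemma lie_act_projection_eq_0:
  fixes t :: "'n::finite form"
  assumes S: "finite S" and t: "t \<in> forms S" and inv: "\<And>V. V \<in> unitary_group \<Longrightarrow> act V S t = t"
    and v: "(\<Sum>i\<in>UNIV. v i * cnj (v i)) = 1"
  shows "lie_act (\<lambda>i j. v i * cnj (v j)) S t f = 0"
proof -
  let ?P = "\<lambda>i j. v i * cnj (v j)"
  \<comment> \<open>The derivatives at 0 of the phase and of its conjugate, the latter acting on the
    dual slots.\<close>
  define sg :: "slot \<Rightarrow> complex" where "sg s = (case s of Inl _ \<Rightarrow> \<i> | Inr _ \<Rightarrow> - \<i>)" for s
  define pe :: "slot \<Rightarrow> 'n \<Rightarrow> 'n \<Rightarrow> complex" where
    "pe s i j = (case s of Inl _ \<Rightarrow> v i * cnj (v j) | Inr _ \<Rightarrow> v j * cnj (v i))" for s i j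
  \<comment> \<open>For real \<open>z\<close> these are the slot entries of a phase reflection.
    Writing the conjugate phase as the exponential of \<open>- \<i> * z\<close> makes the entries
    holomorphic, so complex derivatives apply.\<close>
  define E where "E s i j z = (if i = j then 1 else 0) + (exp (sg s * z) - 1) * pe s i j" for s i j and z :: complex
  define \<Psi> where "\<Psi> z = (\<Sum>g\<in>assign S. (\<Prod>s\<in>S. E s (f s) (g s) z) * t g)" for z
  have const: "\<Psi> (of_real \<theta>) = t f" for \<theta>
  proof -
    let ?W = "phase_reflection v (exp (\<i> * of_real \<theta>))"
    have W: "?W \<in> unitary_group"
      by (rule phase_reflection_unitary[OF v]) simp
    have "slot_entry ?W s i j = E s i j (of_real \<theta>)" for s i j
      unfolding slot_entry_unitary[OF W]
      by (cases s) (auto simp: E_def sg_def pe_def phase_reflection_def exp_cnj)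
    then have "act ?W S t f = \<Psi> (of_real \<theta>)" by (simp add: act_def \<Psi>_def)
    then show ?thesis using inv[OF W] by simp
  qed
  define d where "d = (\<Sum>g\<in>assign S. (\<Sum>s\<in>S. sg s * pe s (f s) (g s) * (\<Prod>r\<in>S - {s}. if f r = g r then 1 else 0)) * t g)"
  have dE: "(E s i j has_field_derivative sg s * pe s i j) (at 0)" for s i j
    unfolding E_def by (auto intro!: derivative_eq_intros)
  have "(\<Psi> has_field_derivative d) (at 0)"
    unfolding \<Psi>_def d_def
  proof (intro DERIV_sum DERIV_cmult_right)
    fix g
    have "((\<lambda>z. \<Prod>s\<in>S. E s (f s) (g s) z) has_field_derivative
      (\<Sum>s\<in>S. sg s * pe s (f s) (g s) * (\<Prod>r\<in>S - {s}. E r (f r) (g r) 0))) (at 0)"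
      by (rule has_field_derivative_prod) (rule dE)
    then show "((\<lambda>z. \<Prod>s\<in>S. E s (f s) (g s) z) has_field_derivative
      (\<Sum>s\<in>S. sg s * pe s (f s) (g s) * (\<Prod>r\<in>S - {s}. if f r = g r then 1 else 0))) (at 0)"
      by (simp add: E_def)
  qed
  \<comment> \<open>Invariance makes the function constant on the real line, so its derivative
    \<open>d\<close> vanishes.\<close>
  then have "((\<lambda>\<theta>. \<Psi> (of_real \<theta>)) has_vector_derivative d) (at 0)"
    by (intro has_vector_derivative_real_field) simp
  then have "((\<lambda>\<theta>. t f) has_vector_derivative d) (at (0::real))"
    by (simp add: const)
  then have "d = 0"
    using has_vector_derivative_const vector_derivative_unique_at by blast
  moreover have "d = \<i> * lie_act ?P S t f"
  proof -
    have sg: "sg s * pe s i j = \<i> * lie_entry ?P s i j" for s i j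
      by (simp add: sg_def pe_def lie_entry_def split: sum.splits)
    have "d = (\<Sum>s\<in>S. \<Sum>g\<in>assign S. sg s * pe s (f s) (g s) * (\<Prod>r\<in>S - {s}. if f r = g r then 1 else 0) * t g)"
      unfolding d_def sum_distrib_right by (rule sum.swap)
    also have "\<dots> = (\<Sum>s\<in>S. \<Sum>j\<in>UNIV. sg s * pe s (f s) j * t (f(s := j)))"
      by (intro sum.cong refl sum_assign_single_slot[OF S _ t, where c = "\<lambda>j. sg _ * pe _ (f _) j"])
    also have "\<dots> = \<i> * lie_act ?P S t f"
      unfolding sg lie_act_def sum_distrib_left mult.assoc ..
    finally show ?thesis .
  qed
  ultimately show ?thesis by simp
qed

text \<open>Invariance annihilates \<open>t\<close> under all rank-one projections. Their complex
  combinations contain the matrix units, and \<open>lie_act\<close> is complex linear in the matrix;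
  this passes from u(N) to gl(N).\<close>

lemma lie_act_eq_0:
  fixes t :: "'n::finite form"
  assumes S: "finite S" and t: "t \<in> forms S" and inv: "\<And>V. V \<in> unitary_group \<Longrightarrow> act V S t = t"
  shows "lie_act (\<lambda>i j. (if i = l then 1 else 0) * (if j = k then 1 else 0)) S t f = 0"
proof -
  have proj: "lie_act (\<lambda>i j. v i * cnj (v j)) S t f = 0" for v :: "'n \<Rightarrow> complex"
  proof (cases "v = (\<lambda>i. 0)")
    case True
    then show ?thesis using lie_act_scale[of 0 "\<lambda>i j. 0" S t f] by simp
  next
    case False
    define r where "r = sqrt (\<Sum>i\<in>UNIV. (cmod (v i))\<^sup>2)"
    obtain i where "v i \<noteq> 0" using False by auto
    then have "0 < (\<Sum>i\<in>UNIV. (cmod (v i))\<^sup>2)"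
      by (intro sum_pos2[of _ i]) auto
    then have r: "r > 0" and r2: "r\<^sup>2 = (\<Sum>i\<in>UNIV. (cmod (v i))\<^sup>2)" by (auto simp: r_def)
    define u where "u i = v i / of_real r" for i
    have "(\<Sum>i\<in>UNIV. u i * cnj (u i)) = (\<Sum>i\<in>UNIV. v i * cnj (v i)) / of_real (r\<^sup>2)"
      by (simp add: u_def sum_divide_distrib power2_eq_square)
    also have "(\<Sum>i\<in>UNIV. v i * cnj (v i)) = of_real (r\<^sup>2)"
      unfolding r2 of_real_sum complex_norm_square ..
    finally have "(\<Sum>i\<in>UNIV. u i * cnj (u i)) = 1" using r by simp
    then have "lie_act (\<lambda>i j. u i * cnj (u j)) S t f = 0"
      using lie_act_projection_eq_0[OF S t inv, of u f] by blast
    moreover have "(\<lambda>i j. v i * cnj (v j)) = (\<lambda>i j. of_real (r\<^sup>2) * (u i * cnj (u j)))"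
      using r by (simp add: u_def power2_eq_square fun_eq_iff)
    ultimately show ?thesis by (simp only: lie_act_scale) simp
  qed
  define a b :: "'n \<Rightarrow> complex" where "a i = (if i = l then 1 else 0)" and "b i = (if i = k then 1 else 0)" for i
  define p where "p w i = a i + w * b i" for w i
  \<comment> \<open>Polarization with the fourth roots of unity \<open>w\<close> as weights: in the
    sum of \<open>w\<close> times the rank-one matrix of \<open>p w\<close>, only the mixed term of
    \<open>a\<close> with the conjugate of \<open>b\<close> survives, with factor 4.\<close>
  have polar: "(\<lambda>i j. (if i = l then 1 else 0) * (if j = k then 1 else 0)) =
    (\<lambda>i j. (1/4) * (p 1 i * cnj (p 1 j)) + (\<i>/4 * (p \<i> i * cnj (p \<i> j))
       + (-(1/4) * (p (-1) i * cnj (p (-1) j)) + -(\<i>/4) * (p (-\<i>) i * cnj (p (-\<i>) j)))))"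
    by (intro ext) (simp add: p_def a_def b_def)
  show ?thesis
    unfolding polar lie_act_add lie_act_scale proj by simp
qed

text \<open>This spells out that the matrix unit at \<open>(l, k)\<close> annihilates
  \<open>t\<close>: it turns a value \<open>l\<close> in a \<open>V\<close> slot into
  \<open>k\<close>, and, with a minus sign, a value \<open>k\<close> in a dual slot into
  \<open>l\<close>.\<close>

lemma invariant_exchange:
  fixes t :: "'n::finite form"
  assumes S: "finite S" and t: "t \<in> forms S" and inv: "\<And>V. V \<in> unitary_group \<Longrightarrow> act V S t = t"
  shows "(\<Sum>a\<in>Inl -` S. if f (Inl a) = l then t (f(Inl a := k)) else 0)
    = (\<Sum>b\<in>Inr -` S. if f (Inr b) = k then t (f(Inr b := l)) else 0)"
proof -
  let ?X = "\<lambda>i j. (if i = l then 1 else 0) * (if j = k then 1 else (0 :: complex))"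
  have fin: "finite (Inl -` S)" "finite (Inr -` S)" using S by (auto intro!: finite_vimageI)
  have S_eq: "S = Inl ` (Inl -` S) \<union> Inr ` (Inr -` S)"
    by (auto simp: image_iff) (metis old.sum.exhaust)
  have Inl: "(\<Sum>j\<in>UNIV. lie_entry ?X (Inl a) i j * h j) = (if i = l then h k else 0)" for a i and h :: "'n \<Rightarrow> complex"
    by (simp add: lie_entry_def if_distrib[of "\<lambda>x. x * _"] cong: if_cong)
  have Inr: "(\<Sum>j\<in>UNIV. lie_entry ?X (Inr b) i j * h j) = - (if i = k then h l else 0)" for b i and h :: "'n \<Rightarrow> complex"
    by (simp add: lie_entry_def if_distrib[of "\<lambda>x. x * _"] if_distrib[of uminus] cong: if_cong)
  have "0 = lie_act ?X S t f" by (rule lie_act_eq_0[OF assms, symmetric])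
  also have "\<dots> = (\<Sum>s\<in>Inl ` (Inl -` S) \<union> Inr ` (Inr -` S). \<Sum>j\<in>UNIV. lie_entry ?X s (f s) j * t (f(s := j)))"
    unfolding lie_act_def S_eq[symmetric] ..
  also have "\<dots> = (\<Sum>a\<in>Inl -` S. if f (Inl a) = l then t (f(Inl a := k)) else 0)
    - (\<Sum>b\<in>Inr -` S. if f (Inr b) = k then t (f(Inr b := l)) else 0)"
    using fin by (subst sum.union_disjoint)
      (auto simp: sum.reindex Inl Inr sum_negf simp del: image_vimage_eq)
  finally show ?thesis by simp
qed

text \<open>A maximum principle: where the modulus of \<open>t\<close> is largest, N times the
  maximum is bounded by \<open>card T\<close> times the maximum.\<close>

lemma dominated_form_eq_0:
  fixes t :: "'n::finite form"
  assumes S: "finite S" and t: "t \<in> forms S" and T: "finite T" "card T < CARD('n)"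
    and dom: "\<And>f. \<exists>h. of_nat CARD('n) * t f + (\<Sum>i\<in>T. h i) = 0 \<and> (\<forall>i\<in>T. h i \<in> insert 0 (range t))"
  shows "t = 0"
proof -
  let ?A = "(\<lambda>x. cmod (t x)) ` assign S"
  have fin: "finite ?A" using finite_assign[OF S, where 'n='n] by blast
  have in_A: "cmod (t f) \<in> ?A" for f
    using forms_restrict[OF t, of f] by (force intro: image_eqI[of _ _ "restrict f S"])
  have le: "cmod (t f) \<le> Max ?A" for f using fin in_A by (rule Max_ge)
  have "Max ?A \<in> ?A" using fin in_A by (intro Max_in) auto
  then obtain f where f: "cmod (t f) = Max ?A" by auto
  obtain h where h: "of_nat CARD('n) * t f + (\<Sum>i\<in>T. h i) = 0" "\<And>i. i \<in> T \<Longrightarrow> h i \<in> insert 0 (range t)"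
    using dom[of f] by blast
  have nonneg: "0 \<le> Max ?A" using le[of f] norm_ge_zero order_trans by blast
  have "cmod (h i) \<le> Max ?A" if "i \<in> T" for i using h(2)[OF that] le nonneg by auto
  then have "cmod (\<Sum>i\<in>T. h i) \<le> of_nat (card T) * Max ?A" by (rule sum_norm_bound)
  moreover have "of_nat CARD('n) * t f = - (\<Sum>i\<in>T. h i)" using h(1) by (simp add: eq_neg_iff_add_eq_0)
  then have "of_nat CARD('n) * cmod (t f) = cmod (\<Sum>i\<in>T. h i)"
    by (metis norm_minus_cancel norm_mult norm_of_nat)
  ultimately have "(of_nat CARD('n) - of_nat (card T)) * Max ?A \<le> 0"
    using f by (simp add: left_diff_distrib)
  then have "Max ?A \<le> 0" using T(2) by (simp add: mult_le_0_iff)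
  then have "t f = 0" for f using le[of f] by (meson norm_le_zero_iff order_trans)
  then show ?thesis by (simp add: fun_eq_iff)
qed

text \<open>
  Summing \<open>invariant_exchange\<close> over all values in one slot turns the opposite slots into
  contractions, which vanish, and leaves \<open>N t\<close> plus fewer than \<open>N\<close> transposed copies of \<open>t\<close>.
\<close>

lemma invariant_harmonic_eq_0:
  fixes t :: "'n::finite form"
  assumes S: "finite S" "S \<noteq> {}" "card S \<le> CARD('n)" and t: "t \<in> harmonic S"
    and inv: "\<And>V. V \<in> unitary_group \<Longrightarrow> act V S t = t"
  shows "t = 0"
proof -
  have tf: "t \<in> forms S" using t by (rule harmonic_in_forms)
  have fin: "finite (Inl -` S)" "finite (Inr -` S)" using S(1) by (auto intro!: finite_vimageI)
  have "card (Inl -` S) \<le> card S" "card (Inr -` S) \<le> card S"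
    using S(1) by (auto intro: card_inj_on_le[of Inl] card_inj_on_le[of Inr])
  then have card_le: "card (Inl -` S) \<le> CARD('n)" "card (Inr -` S) \<le> CARD('n)"
    using S(3) by simp_all
  have contr: "(\<Sum>k\<in>UNIV. t (f(Inl a := k, Inr b := k))) = 0" "(\<Sum>k\<in>UNIV. t (f(Inr b := k, Inl a := k))) = 0"
    if "Inl a \<in> S" "Inr b \<in> S" for a b f
  proof -
    have "pair_trace a b t f = 0" using t that by (simp add: harmonic_def)
    then show "(\<Sum>k\<in>UNIV. t (f(Inl a := k, Inr b := k))) = 0" by (simp add: pair_trace_def)
    moreover have "f(Inr b := k, Inl a := k) = f(Inl a := k, Inr b := k)" for k
      by (rule fun_upd_twist) simp
    ultimately show "(\<Sum>k\<in>UNIV. t (f(Inr b := k, Inl a := k))) = 0" by simp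
  qed
  obtain s where "s \<in> S" using S(2) by blast
  show ?thesis
  \<comment> \<open>Slots of one kind may be missing, so the argument starts from whichever kind is
    present; the two cases are dual to each other.\<close>
  proof (cases s)
    case (Inl a0)
    let ?T = "Inl -` S - {a0}"
    have a0: "a0 \<in> Inl -` S" using Inl \<open>s \<in> S\<close> by simp
    have "card ?T < card (Inl -` S)" using a0 fin(1) by (intro psubset_card_mono) auto
    show ?thesis
    proof (rule dominated_form_eq_0[OF S(1) tf])
      show "finite ?T" "card ?T < CARD('n)" using fin card_le \<open>card ?T < _\<close> by auto
      fix f :: "slot \<Rightarrow> 'n"
      let ?k = "f (Inl a0)"
      \<comment> \<open>In the exchange relation at \<open>f(Inl a0 := l)\<close> the slot
        \<open>Inl a0\<close> itself goes from \<open>l\<close> back to \<open>?k\<close> and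
        restores \<open>f\<close>, whatever \<open>l\<close> is. Summing over \<open>l\<close>
        produces the N copies of \<open>t f\<close>.\<close>
      have ex: "(\<Sum>a\<in>Inl -` S. if (f(Inl a0 := l)) (Inl a) = l then t (f(Inl a0 := l, Inl a := ?k)) else 0)
        = (\<Sum>b\<in>Inr -` S. if f (Inr b) = ?k then t (f(Inl a0 := l, Inr b := l)) else 0)" for l
        using invariant_exchange[OF S(1) tf inv, of "f(Inl a0 := l)" l ?k] by (simp cong: if_cong)
      have split: "(\<Sum>a\<in>Inl -` S. if (f(Inl a0 := l)) (Inl a) = l then t (f(Inl a0 := l, Inl a := ?k)) else 0)
        = t f + (\<Sum>a\<in>?T. if f (Inl a) = l then t (f(Inl a0 := l, Inl a := ?k)) else 0)" for l
        by (subst sum.remove[OF fin(1) a0]) (auto intro!: arg_cong2[where f = "(+)"] sum.cong)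
      have "(\<Sum>l\<in>UNIV. t f + (\<Sum>a\<in>?T. if f (Inl a) = l then t (f(Inl a0 := l, Inl a := ?k)) else 0))
        = (\<Sum>l\<in>UNIV. \<Sum>b\<in>Inr -` S. if f (Inr b) = ?k then t (f(Inl a0 := l, Inr b := l)) else 0)"
        by (intro sum.cong refl) (metis ex split)
      \<comment> \<open>On this side \<open>Inl a0\<close> and \<open>Inr b\<close> carry the same
        value \<open>l\<close>, so the sum over \<open>l\<close> is a contraction.\<close>
      also have "\<dots> = (\<Sum>b\<in>Inr -` S. if f (Inr b) = ?k then \<Sum>l\<in>UNIV. t (f(Inl a0 := l, Inr b := l)) else 0)"
        by (subst sum.swap) (intro sum.cong refl, simp)
      also have "\<dots> = 0"
        using a0 by (intro sum.neutral) (auto simp: contr)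
      \<comment> \<open>For each other slot \<open>Inl a\<close> only \<open>l = f (Inl a)\<close>
        contributes, leaving \<open>t\<close> with the values at the two slots interchanged.\<close>
      also have "(\<Sum>l\<in>UNIV. t f + (\<Sum>a\<in>?T. if f (Inl a) = l then t (f(Inl a0 := l, Inl a := ?k)) else 0))
        = of_nat CARD('n) * t f + (\<Sum>a\<in>?T. t (f(Inl a0 := f (Inl a), Inl a := ?k)))"
        by (simp add: sum.distrib) (subst sum.swap, simp)
      finally show "\<exists>h. of_nat CARD('n) * t f + (\<Sum>i\<in>?T. h i) = 0 \<and> (\<forall>i\<in>?T. h i \<in> insert 0 (range t))"
        by (intro exI[of _ "\<lambda>a. t (f(Inl a0 := f (Inl a), Inl a := ?k))"]) auto
    qed
  next
    case (Inr b0)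
    let ?T = "Inr -` S - {b0}"
    have b0: "b0 \<in> Inr -` S" using Inr \<open>s \<in> S\<close> by simp
    have "card ?T < card (Inr -` S)" using b0 fin(2) by (intro psubset_card_mono) auto
    show ?thesis
    proof (rule dominated_form_eq_0[OF S(1) tf])
      show "finite ?T" "card ?T < CARD('n)" using fin card_le \<open>card ?T < _\<close> by auto
      fix f :: "slot \<Rightarrow> 'n"
      let ?l = "f (Inr b0)"
      have ex: "(\<Sum>b\<in>Inr -` S. if (f(Inr b0 := k)) (Inr b) = k then t (f(Inr b0 := k, Inr b := ?l)) else 0)
        = (\<Sum>a\<in>Inl -` S. if f (Inl a) = ?l then t (f(Inr b0 := k, Inl a := k)) else 0)" for k
        using invariant_exchange[OF S(1) tf inv, of "f(Inr b0 := k)" ?l k] by (simp cong: if_cong)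
      have split: "(\<Sum>b\<in>Inr -` S. if (f(Inr b0 := k)) (Inr b) = k then t (f(Inr b0 := k, Inr b := ?l)) else 0)
        = t f + (\<Sum>b\<in>?T. if f (Inr b) = k then t (f(Inr b0 := k, Inr b := ?l)) else 0)" for k
        by (subst sum.remove[OF fin(2) b0]) (auto intro!: arg_cong2[where f = "(+)"] sum.cong)
      have "(\<Sum>k\<in>UNIV. t f + (\<Sum>b\<in>?T. if f (Inr b) = k then t (f(Inr b0 := k, Inr b := ?l)) else 0))
        = (\<Sum>k\<in>UNIV. \<Sum>a\<in>Inl -` S. if f (Inl a) = ?l then t (f(Inr b0 := k, Inl a := k)) else 0)"
        by (intro sum.cong refl) (metis ex split)
      also have "\<dots> = (\<Sum>a\<in>Inl -` S. if f (Inl a) = ?l then \<Sum>k\<in>UNIV. t (f(Inr b0 := k, Inl a := k)) else 0)"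
        by (subst sum.swap) (intro sum.cong refl, simp)
      also have "\<dots> = 0"
        using b0 by (intro sum.neutral) (auto simp: contr)
      also have "(\<Sum>k\<in>UNIV. t f + (\<Sum>b\<in>?T. if f (Inr b) = k then t (f(Inr b0 := k, Inr b := ?l)) else 0))
        = of_nat CARD('n) * t f + (\<Sum>b\<in>?T. t (f(Inr b0 := f (Inr b), Inr b := ?l)))"
        by (simp add: sum.distrib) (subst sum.swap, simp)
      finally show "\<exists>h. of_nat CARD('n) * t f + (\<Sum>i\<in>?T. h i) = 0 \<and> (\<forall>i\<in>?T. h i \<in> insert 0 (range t))"
        by (intro exI[of _ "\<lambda>b. t (f(Inr b0 := f (Inr b), Inr b := ?l))"]) auto
    qed
  qed
qed

section \<open>Haar averages\<close>

lemma unitary_group_eq: "unitary_group = {U. conj_transpose U ** U = mat 1} \<inter> {U. U ** conj_transpose U = mat 1}"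
  by (auto simp: unitary_group_def)

lemma unitary_entry_le_1:
  assumes "U \<in> unitary_group"
  shows "cmod (U $ i $ j) \<le> 1"
proof -
  have "(U ** conj_transpose U) $ i $ i = 1" using assms by (simp add: unitary_group_def mat_def)
  then have "(\<Sum>k\<in>UNIV. U $ i $ k * cnj (U $ i $ k)) = 1"
    by (simp add: matrix_matrix_mult_def conj_transpose_def)
  then have "complex_of_real (\<Sum>k\<in>UNIV. (cmod (U $ i $ k))\<^sup>2) = 1"
    unfolding of_real_sum complex_norm_square .
  then have "(\<Sum>k\<in>UNIV. (cmod (U $ i $ k))\<^sup>2) = 1" by (metis of_real_eq_1_iff)
  moreover have "(cmod (U $ i $ j))\<^sup>2 \<le> (\<Sum>k\<in>UNIV. (cmod (U $ i $ k))\<^sup>2)"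
    by (rule member_le_sum) auto
  ultimately show ?thesis by (simp add: power_le_one_iff abs_square_le_1)
qed

lemma compact_unitary_group: "compact (unitary_group :: (complex^'n::finite^'n) set)"
proof -
  have "continuous_on UNIV (\<lambda>U :: complex^'n^'n. conj_transpose U ** U)"
    "continuous_on UNIV (\<lambda>U :: complex^'n^'n. U ** conj_transpose U)"
    unfolding conj_transpose_def matrix_matrix_mult_def
    by (intro continuous_on_vec_lambda continuous_on_sum continuous_on_mult continuous_on_cnj
        continuous_on_component; simp add: continuous_on_component)+
  then have "closed (unitary_group :: (complex^'n^'n) set)"
    unfolding unitary_group_eq by (intro closed_Int closed_Collect_eq continuous_on_const)
  moreover have "bounded (unitary_group :: (complex^'n^'n) set)"
  proof (rule boundedI)
    fix U :: "complex^'n^'n" assume U: "U \<in> unitary_group"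
    have "norm U \<le> (\<Sum>i\<in>UNIV. norm (U $ i))"
      unfolding norm_vec_def by (rule L2_set_le_sum) simp
    also have "\<dots> \<le> (\<Sum>i\<in>(UNIV :: 'n set). \<Sum>j\<in>(UNIV :: 'n set). 1)"
    proof (rule sum_mono)
      fix i
      have "norm (U $ i) \<le> (\<Sum>j\<in>UNIV. cmod (U $ i $ j))"
        unfolding norm_vec_def[of "U $ i"] by (rule L2_set_le_sum) simp
      also have "\<dots> \<le> (\<Sum>j\<in>(UNIV :: 'n set). 1)"
        by (rule sum_mono) (rule unitary_entry_le_1[OF U])
      finally show "norm (U $ i) \<le> (\<Sum>j\<in>(UNIV :: 'n set). 1)" .
    qed
    finally show "norm U \<le> (\<Sum>i\<in>(UNIV :: 'n set). \<Sum>j\<in>(UNIV :: 'n set). 1)" .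
  qed
  ultimately show ?thesis by (simp add: compact_eq_bounded_closed)
qed

lemma space_haar: "haar_measure_unitary M \<Longrightarrow> space M = unitary_group"
  unfolding haar_measure_unitary_def
  by (metis sets_eq_imp_space_eq space_restrict_space2 space_borel space_restrict_space Int_UNIV_right inf_top.right_neutral)

lemma haar_measurable:
  fixes M :: "(complex^'n::finite^'n) measure"
  assumes "haar_measure_unitary M" "continuous_on unitary_group \<phi>"
  shows "\<phi> \<in> borel_measurable M"
proof -
  have "sets M = sets (restrict_space borel unitary_group)"
    using assms(1) by (simp add: haar_measure_unitary_def)
  then show ?thesis
    using borel_measurable_continuous_on_restrict[OF assms(2)] measurable_cong_sets[OF _ refl] by blast
qed

lemma haar_integrable:
  fixes M :: "(complex^'n::finite^'n) measure" and \<phi> :: "complex^'n^'n \<Rightarrow> complex"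
  assumes M: "haar_measure_unitary M" and \<phi>: "continuous_on unitary_group \<phi>"
  shows "integrable M \<phi>"
proof -
  interpret prob_space M using M by (simp add: haar_measure_unitary_def)
  have "bounded (\<phi> ` unitary_group)"
    using compact_continuous_image[OF \<phi> compact_unitary_group] by (rule compact_imp_bounded)
  then obtain B where B: "\<And>U. U \<in> unitary_group \<Longrightarrow> norm (\<phi> U) \<le> B"
    unfolding bounded_iff by blast
  show ?thesis
    by (rule integrable_const_bound[of _ B])
       (use B space_haar[OF M] haar_measurable[OF M \<phi>] in auto)
qed

lemma haar_translate:
  fixes M :: "(complex^'n::finite^'n) measure" and \<phi> :: "complex^'n^'n \<Rightarrow> complex"
  assumes M: "haar_measure_unitary M" and \<phi>: "continuous_on unitary_group \<phi>" and V: "V \<in> unitary_group"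
  shows "(LINT U|M. \<phi> (V ** U)) = (LINT U|M. \<phi> U)"
proof -
  have sets: "sets M = sets (restrict_space borel unitary_group)"
    using M by (simp add: haar_measure_unitary_def)
  have "continuous_on unitary_group (\<lambda>U. V ** U)"
    unfolding matrix_matrix_mult_def
    by (intro continuous_on_vec_lambda continuous_on_sum continuous_on_mult continuous_on_const
        continuous_on_component continuous_on_id)
  then have "(\<lambda>U. V ** U) \<in> M \<rightarrow>\<^sub>M borel" by (rule haar_measurable[OF M])
  then have "(\<lambda>U. V ** U) \<in> M \<rightarrow>\<^sub>M restrict_space borel unitary_group"
    using unitary_mult[OF _ V] by (intro measurable_restrict_space2) (auto simp: space_haar[OF M])
  then have "(\<lambda>U. V ** U) \<in> M \<rightarrow>\<^sub>M M"
    using measurable_cong_sets[OF refl sets] by blast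
  from integral_distr[OF this haar_measurable[OF M \<phi>]]
  show ?thesis using M V by (simp add: haar_measure_unitary_def)
qed

lemma continuous_on_act: "continuous_on unitary_group (\<lambda>U :: complex^'n::finite^'n. act U S t f)"
proof -
  have "continuous_on unitary_group (\<lambda>U :: complex^'n^'n. slot_entry U s i j)" for s i j
  proof -
    \<comment> \<open>On the group the inverse is the conjugate transpose, whose entries are visibly
      continuous.\<close>
    have "continuous_on unitary_group (\<lambda>U :: complex^'n^'n. case s of Inl _ \<Rightarrow> U $ i $ j | Inr _ \<Rightarrow> cnj (U $ i $ j))"
      by (cases s) (auto intro!: continuous_intros)
    then show ?thesis
      by (rule continuous_on_eq) (simp add: slot_entry_unitary)
  qed
  then show ?thesis
    unfolding act_def by (intro continuous_on_sum continuous_on_mult continuous_on_prod continuous_on_const)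
qed

text \<open>Averaging over the group projects to the invariants. The average of a harmonic form is
  again harmonic, and by translation invariance of the measure it is invariant, hence zero.\<close>

lemma haar_mean_act_harmonic:
  fixes M :: "(complex^'n::finite^'n) measure"
  assumes M: "haar_measure_unitary M" and S: "finite S" "S \<noteq> {}" "card S \<le> CARD('n)"
    and t: "t \<in> harmonic S"
  shows "(LINT U|M. act U S t f) = 0"
proof -
  define P where "P = (\<lambda>f. LINT U|M. act U S t f)"
  have int: "integrable M (\<lambda>U. act U S t f)" for f
    by (rule haar_integrable[OF M continuous_on_act])
  have P_forms: "P \<in> forms S"
  proof (rule formsI)
    fix f g :: "slot \<Rightarrow> 'n" assume fg: "\<And>s. s \<in> S \<Longrightarrow> f s = g s"
    have "act U S t f = act U S t g" for U
      by (rule formsD[OF act_in_forms]) (rule fg)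
    then show "P f = P g" by (simp add: P_def)
  qed
  have "pair_trace a b P = 0" if ab: "Inl a \<in> S" "Inr b \<in> S" for a b
  proof
    fix f
    have "pair_trace a b P f = (LINT U|M. (\<Sum>k\<in>UNIV. act U S t (f(Inl a := k, Inr b := k))))"
      unfolding pair_trace_def P_def by (rule Bochner_Integration.integral_sum[symmetric]) (rule int)
    also have "\<dots> = (LINT U|M. 0)"
    proof (rule Bochner_Integration.integral_cong[OF refl])
      fix U assume "U \<in> space M"
      then have "invertible U" using space_haar[OF M] unitary_invertible by blast
      from act_harmonic[OF S(1) this t] have "pair_trace a b (act U S t) f = 0"
        using ab by (simp add: harmonic_def)
      then show "(\<Sum>k\<in>UNIV. act U S t (f(Inl a := k, Inr b := k))) = 0"
        by (simp add: pair_trace_def)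
    qed
    finally show "pair_trace a b P f = 0 f" by simp
  qed
  then have P_harm: "P \<in> harmonic S" using P_forms by (simp add: harmonic_def)
  have "act V S P = P" if V: "V \<in> unitary_group" for V
  proof
    fix f
    have "act V S P f = (\<Sum>g\<in>assign S. LINT U|M. (\<Prod>s\<in>S. slot_entry V s (f s) (g s)) * act U S t g)"
      by (simp add: act_def[of V] P_def)
    also have "\<dots> = (LINT U|M. (\<Sum>g\<in>assign S. (\<Prod>s\<in>S. slot_entry V s (f s) (g s)) * act U S t g))"
      by (rule Bochner_Integration.integral_sum[symmetric]) (intro integrable_mult_right int)
    also have "\<dots> = (LINT U|M. act (V ** U) S t f)"
    proof (rule Bochner_Integration.integral_cong[OF refl])
      fix U assume "U \<in> space M"
      then have U: "U \<in> unitary_group" using space_haar[OF M] by simp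
      show "(\<Sum>g\<in>assign S. (\<Prod>s\<in>S. slot_entry V s (f s) (g s)) * act U S t g) = act (V ** U) S t f"
        unfolding act_mult[OF S(1) U V, symmetric] by (simp add: act_def[of V])
    qed
    also have "\<dots> = P f" unfolding P_def by (rule haar_translate[OF M continuous_on_act V])
    finally show "act V S P f = P f" .
  qed
  then have "P = 0" by (rule invariant_harmonic_eq_0[OF S P_harm])
  then show ?thesis by (simp add: P_def fun_eq_iff)
qed

text \<open>The trace is a finite combination, with coefficients not depending on \<open>U\<close>,
  of coordinates of \<open>act U S b\<close> for harmonic \<open>b\<close>; each of these has mean
  zero.\<close>

lemma haar_mean_harmonic_trace:
  fixes M :: "(complex^'n::finite^'n) measure"
  assumes M: "haar_measure_unitary M" and S: "finite S" "S \<noteq> {}" "card S \<le> CARD('n)"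
    and \<sigma>: "inj \<alpha>" "inj \<beta>" "map_sum \<alpha> \<beta> ` S = S"
  shows "integrable M (\<lambda>U. harmonic_trace \<alpha> \<beta> U S)"
    and "(LINT U|M. harmonic_trace \<alpha> \<beta> U S) = 0"
proof -
  obtain B where B: "B \<subseteq> harmonic S" "cfun.independent B" "(harmonic S :: 'n form set) \<subseteq> cfun.span B"
    using cfun.maximal_independent_subset by blast
  have span: "cfun.span B = harmonic S"
    using B(3) cfun.span_minimal[OF B(1) subspace_harmonic] by blast
  have "B \<subseteq> forms S" using B(1) harmonic_in_forms by blast
  \<comment> \<open>A coordinate form need not be harmonic. Extending \<open>B\<close> to a basis of
    all forms makes the coefficient at \<open>b\<close> available on every
    \<open>point S x\<close>.\<close>
  then obtain C where C: "B \<subseteq> C" "C \<subseteq> forms S" "cfun.independent C" "(forms S :: 'n form set) \<subseteq> cfun.span C"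
    using cfun.maximal_independent_subset_extend[OF _ B(2)] by blast
  have finP: "finite (point S ` assign S :: 'n form set)" using finite_assign[OF S(1), where 'n='n] by blast
  have "finite B"
    using cfun.independent_span_bound[OF finP B(2)] \<open>B \<subseteq> forms S\<close> span_point[OF S(1), where 'n='n] by simp
  have trace: "harmonic_trace \<alpha> \<beta> U S
    = (\<Sum>b\<in>B. \<Sum>x\<in>assign S. act U S b (x \<circ> map_sum \<alpha> \<beta>) * cfun.representation C (point S x) b)"
    if U: "U \<in> unitary_group" for U
  proof -
    let ?G = "permute \<alpha> \<beta> \<circ> act U S"
    have G: "?G b \<in> harmonic S" if "b \<in> B" for b
      using permute_harmonic[OF \<sigma>(1,2) act_harmonic[OF S(1) unitary_invertible[OF U]]] that B(1)
      by (auto simp: \<sigma>(3))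
    have "harmonic_trace \<alpha> \<beta> U S = (\<Sum>b\<in>B. cfun.representation B (?G b) b)"
      unfolding harmonic_trace_def span[symmetric]
      by (rule cfun.trace_on_eq_sum[OF B(2) \<open>finite B\<close> clinear_permute_act]) (use G span in simp)
    also have "\<dots> = (\<Sum>b\<in>B. \<Sum>x\<in>assign S. act U S b (x \<circ> map_sum \<alpha> \<beta>) * cfun.representation C (point S x) b)"
    proof (rule sum.cong[OF refl])
      fix b assume b: "b \<in> B"
      have "cfun.representation B (?G b) = cfun.representation C (?G b)"
        by (rule cfun.representation_extend[symmetric, OF C(3) _ C(1)]) (use G[OF b] span in simp)
      also have "\<dots> = cfun.representation C (\<Sum>x\<in>assign S. cscale (?G b x) (point S x))"
        using forms_expand[OF S(1) harmonic_in_forms[OF G[OF b]]] by simp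
      also have "\<dots> = (\<lambda>c. \<Sum>x\<in>assign S. cfun.representation C (cscale (?G b x) (point S x)) c)"
        by (rule cfun.representation_sum[OF C(3)]) (use C(4) point_in_forms in \<open>blast intro: cfun.span_scale\<close>)
      also have "\<dots> = (\<lambda>c. \<Sum>x\<in>assign S. ?G b x * cfun.representation C (point S x) c)"
        using C(4) point_in_forms by (intro ext sum.cong refl) (subst cfun.representation_scale[OF C(3)], auto)
      finally show "cfun.representation B (?G b) b
        = (\<Sum>x\<in>assign S. act U S b (x \<circ> map_sum \<alpha> \<beta>) * cfun.representation C (point S x) b)"
        by (simp add: permute_def)
    qed
    finally show ?thesis .
  qed
  let ?h = "\<lambda>U. \<Sum>b\<in>B. \<Sum>x\<in>assign S. act U S b (x \<circ> map_sum \<alpha> \<beta>) * cfun.representation C (point S x) b"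
  have int: "integrable M (\<lambda>U. act U S b f * c)" for b f c
    by (intro integrable_mult_left haar_integrable[OF M continuous_on_act])
  have "integrable M ?h" by (intro Bochner_Integration.integrable_sum int)
  moreover have "(LINT U|M. ?h U) = (\<Sum>b\<in>B. \<Sum>x\<in>assign S. LINT U|M. act U S b (x \<circ> map_sum \<alpha> \<beta>) * cfun.representation C (point S x) b)"
    by (simp add: Bochner_Integration.integral_sum int Bochner_Integration.integrable_sum)
  moreover have "\<dots> = 0"
    using B(1) by (intro sum.neutral ballI) (auto simp: haar_mean_act_harmonic[OF M S])
  ultimately show "integrable M (\<lambda>U. harmonic_trace \<alpha> \<beta> U S)" "(LINT U|M. harmonic_trace \<alpha> \<beta> U S) = 0"
    using Bochner_Integration.integrable_cong[OF refl trace, of M] Bochner_Integration.integral_cong[OF refl trace, of M]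
    by (simp_all add: space_haar[OF M])
qed

section \<open>Explicit Wick products\<close>

text \<open>The inverse of the moment function \<open>E\<close> under convolution over subsets, the
  recursion being solved for the term of the full set. It serves as the constant term of the Wick
  polynomial of \<open>S\<close>.\<close>

function wick_coeff :: "('i set \<Rightarrow> complex) \<Rightarrow> 'i set \<Rightarrow> complex" where
  "wick_coeff E S = (if finite S \<and> S \<noteq> {} then - (\<Sum>T | T \<subset> S. wick_coeff E T * E (S - T)) else 1)"
  by pat_completeness auto
termination
  by (relation "Wellfounded.measure (\<lambda>(E, S). card S)") (auto intro: psubset_card_mono)

declare wick_coeff.simps [simp del]

lemma wick_coeff_empty [simp]: "wick_coeff E {} = 1"
  by (simp add: wick_coeff.simps)

lemma sum_Pow_complement: "(\<Sum>T\<in>Pow S. h T (S - T)) = (\<Sum>T\<in>Pow S. h (S - T) T)"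
  by (rule sum.reindex_bij_witness[where i = "\<lambda>T. S - T" and j = "\<lambda>T. S - T"])
     (auto simp: double_diff)

lemma wick_coeff_convolution:
  assumes "finite S" "E {} = 1"
  shows "(\<Sum>T\<in>Pow S. wick_coeff E T * E (S - T)) = (if S = {} then 1 else 0)"
proof (cases "S = {}")
  case False
  have "Pow S = insert S {T. T \<subset> S}" by auto
  moreover have "finite {T. T \<subset> S}" using assms(1) by (auto intro: finite_subset[of _ "Pow S"])
  ultimately have "(\<Sum>T\<in>Pow S. wick_coeff E T * E (S - T))
    = wick_coeff E S + (\<Sum>T | T \<subset> S. wick_coeff E T * E (S - T))"
    using assms(2) by simp
  then show ?thesis using False assms(1) wick_coeff.simps[of E S] by simp
qed (simp add: assms(2))

text \<open>The convolution of \<open>wick_coeff m\<close> with \<open>Y\<close> solves the same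
  equation as \<open>F\<close>. Since \<open>m {} = 1\<close> the system is triangular and its
  solution is unique.\<close>

lemma wick_inversion:
  assumes I: "finite I" "m {} = 1"
    and Y: "\<And>s. s \<subseteq> I \<Longrightarrow> Y s = (\<Sum>T\<in>Pow s. m T * F (s - T))"
  shows "s \<subseteq> I \<Longrightarrow> F s = (\<Sum>A\<in>Pow s. wick_coeff m (s - A) * Y A)"
proof (induction "card s" arbitrary: s rule: less_induct)
  case less
  have s: "finite s" using less.prems I(1) by (rule finite_subset)
  define W where "W s = (\<Sum>A\<in>Pow s. wick_coeff m (s - A) * Y A)" for s
  have "(\<Sum>T\<in>Pow s. m T * W (s - T)) = (\<Sum>T\<in>Pow s. \<Sum>A\<in>Pow (s - T). m T * wick_coeff m (s - T - A) * Y A)"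
    by (simp add: W_def sum_distrib_left mult.assoc)
  also have "\<dots> = (\<Sum>A\<in>Pow s. \<Sum>T\<in>Pow (s - A). m T * wick_coeff m (s - T - A) * Y A)"
    unfolding sum.Sigma[OF finite_Pow_iff[THEN iffD2, OF s] ballI[OF finite_Pow_iff[THEN iffD2, OF finite_Diff[OF s]]]]
    by (rule sum.reindex_bij_witness[where i = "\<lambda>(A, T). (T, A)" and j = "\<lambda>(T, A). (A, T)"]) auto
  also have "\<dots> = (\<Sum>A\<in>Pow s. if A = s then Y A else 0)"
  proof (rule sum.cong[OF refl])
    fix A assume A: "A \<in> Pow s"
    have "(\<Sum>T\<in>Pow (s - A). m T * wick_coeff m (s - T - A)) = (\<Sum>T\<in>Pow (s - A). m T * wick_coeff m ((s - A) - T))"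
      by (intro sum.cong refl arg_cong2[where f = "(*)"] arg_cong[where f = "wick_coeff m"]) auto
    also have "\<dots> = (\<Sum>T\<in>Pow (s - A). wick_coeff m T * m ((s - A) - T))"
      by (subst sum_Pow_complement) (simp add: mult.commute)
    also have "\<dots> = (if s - A = {} then 1 else 0)"
      using s I(2) by (intro wick_coeff_convolution) auto
    finally show "(\<Sum>T\<in>Pow (s - A). m T * wick_coeff m (s - T - A) * Y A) = (if A = s then Y A else 0)"
      using A by (auto simp flip: sum_distrib_right)
  qed
  also have "\<dots> = Y s" using s by simp
  finally have W: "(\<Sum>T\<in>Pow s. m T * W (s - T)) = Y s" .
  have "(\<Sum>T\<in>Pow s. m T * (F (s - T) - W (s - T))) = 0"
    using W Y[OF less.prems] by (simp add: right_diff_distrib sum_subtractf)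
  \<comment> \<open>By induction \<open>F\<close> and \<open>W\<close> agree on proper subsets, so
    only \<open>T = {}\<close> is left.\<close>
  moreover have "(\<Sum>T\<in>Pow s. m T * (F (s - T) - W (s - T))) = (\<Sum>T\<in>{{}}. m T * (F (s - T) - W (s - T)))"
  proof (rule sum.mono_neutral_right)
    show "\<forall>T\<in>Pow s - {{}}. m T * (F (s - T) - W (s - T)) = 0"
    proof
      fix T assume T: "T \<in> Pow s - {{}}"
      then have "card (s - T) < card s" using s by (intro psubset_card_mono) auto
      then have "F (s - T) = W (s - T)" unfolding W_def using less.prems by (intro less.hyps) auto
      then show "m T * (F (s - T) - W (s - T)) = 0" by simp
    qed
  qed (use s in auto)
  ultimately show ?case using I(2) by (simp add: W_def)
qed

section \<open>Polynomials with squarefree monomials\<close>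

definition squarefree_monom :: "nat set \<Rightarrow> nat \<Rightarrow>\<^sub>0 nat" where
  "squarefree_monom A = (\<Sum>i\<in>A. Poly_Mapping.single i 1)"

lemma lookup_squarefree_monom:
  "finite A \<Longrightarrow> Poly_Mapping.lookup (squarefree_monom A) j = (if j \<in> A then 1 else 0)"
  by (simp add: squarefree_monom_def lookup_sum lookup_single when_def)

lemma keys_squarefree_monom: "finite A \<Longrightarrow> Poly_Mapping.keys (squarefree_monom A) = A"
  by (auto simp: in_keys_iff lookup_squarefree_monom split: if_splits)

lemma squarefree_monom_minus:
  "finite A \<Longrightarrow> i \<in> A \<Longrightarrow> squarefree_monom A - Poly_Mapping.single i 1 = squarefree_monom (A - {i})"
  by (rule poly_mapping_eqI) (auto simp: lookup_minus lookup_squarefree_monom lookup_single when_def)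

lemma mpoly_eval_superset:
  assumes "finite K" "Poly_Mapping.keys P \<subseteq> K"
  shows "mpoly_eval P y = (\<Sum>m\<in>K. Poly_Mapping.lookup P m * (\<Prod>i\<in>Poly_Mapping.keys m. y i ^ Poly_Mapping.lookup m i))"
  unfolding mpoly_eval_def using assms by (intro sum.mono_neutral_left) (auto simp: in_keys_iff)

lemma mpoly_deriv_superset:
  assumes "finite K" "Poly_Mapping.keys P \<subseteq> K"
  shows "mpoly_deriv i P = (\<Sum>m\<in>K. Poly_Mapping.single (m - Poly_Mapping.single i 1)
     (of_nat (Poly_Mapping.lookup m i) * Poly_Mapping.lookup P m))"
  unfolding mpoly_deriv_def using assms by (intro sum.mono_neutral_left) (auto simp: in_keys_iff)

lemma lookup_mpoly_deriv:
  "Poly_Mapping.lookup (mpoly_deriv i Q) m'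
    = of_nat (Suc (Poly_Mapping.lookup m' i)) * Poly_Mapping.lookup Q (m' + Poly_Mapping.single i 1)"
proof -
  let ?e = "Poly_Mapping.single i (1::nat)"
  have "Poly_Mapping.lookup (mpoly_deriv i Q) m' = (\<Sum>m\<in>Poly_Mapping.keys Q.
      if m - ?e = m' then of_nat (Poly_Mapping.lookup m i) * Poly_Mapping.lookup Q m else 0)"
    by (simp add: mpoly_deriv_def lookup_sum lookup_single when_def)
  also have "\<dots> = (\<Sum>m\<in>Poly_Mapping.keys Q. if m = m' + ?e then of_nat (Poly_Mapping.lookup m i) * Poly_Mapping.lookup Q m else 0)"
  proof (rule sum.cong[OF refl])
    fix m
    show "(if m - ?e = m' then of_nat (Poly_Mapping.lookup m i) * Poly_Mapping.lookup Q m else 0)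
      = (if m = m' + ?e then of_nat (Poly_Mapping.lookup m i) * Poly_Mapping.lookup Q m else 0)"
    \<comment> \<open>Subtraction of exponents is truncated, so \<open>m - ?e = m'\<close> can also
      hold for an \<open>m\<close> without the variable \<open>i\<close>; the factor
      \<open>lookup m i\<close> removes such terms.\<close>
    proof (cases "Poly_Mapping.lookup m i = 0")
      case False
      have "m - ?e + ?e = m"
        using False by (intro poly_mapping_eqI) (auto simp: lookup_add lookup_minus lookup_single when_def)
      then have "m - ?e = m' \<longleftrightarrow> m = m' + ?e" by (metis add_diff_cancel_right')
      then show ?thesis by simp
    qed simp
  qed
  also have "\<dots> = of_nat (Suc (Poly_Mapping.lookup m' i)) * Poly_Mapping.lookup Q (m' + ?e)"
    by (simp add: in_keys_iff lookup_add lookup_single)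
  finally show ?thesis .
qed

text \<open>A nonconstant monomial in the variables of \<open>S\<close> is seen by the derivative in
  one of its variables. Monomials with other variables are excluded by the bound on
  \<open>mpoly_vars\<close>.\<close>

lemma mpoly_eq_if_derivs_eq:
  assumes vars: "mpoly_vars P \<subseteq> S" "mpoly_vars Q \<subseteq> S"
    and deriv: "\<And>i. i \<in> S \<Longrightarrow> mpoly_deriv i P = mpoly_deriv i Q" and m: "m \<noteq> 0"
  shows "Poly_Mapping.lookup P m = Poly_Mapping.lookup Q m"
proof (cases "Poly_Mapping.keys m \<subseteq> S")
  case True
  obtain i where i: "i \<in> Poly_Mapping.keys m" using m by (metis all_not_in_conv keys_eq_empty)
  let ?e = "Poly_Mapping.single i (1::nat)"
  have "m - ?e + ?e = m"
    using i by (intro poly_mapping_eqI) (auto simp: lookup_add lookup_minus lookup_single when_def in_keys_iff)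
  moreover have "Poly_Mapping.lookup (mpoly_deriv i P) (m - ?e) = Poly_Mapping.lookup (mpoly_deriv i Q) (m - ?e)"
    using deriv[of i] i True by auto
  ultimately show ?thesis unfolding lookup_mpoly_deriv by (simp del: of_nat_Suc)
next
  case False
  then have "m \<notin> Poly_Mapping.keys P" "m \<notin> Poly_Mapping.keys Q"
    using vars by (auto simp: mpoly_vars_def)
  then show ?thesis by (simp add: in_keys_iff)
qed

definition explicit_wick_poly :: "(nat set \<Rightarrow> complex) \<Rightarrow> nat set \<Rightarrow> mpolynomial" where
  "explicit_wick_poly E S = (\<Sum>A\<in>Pow S. Poly_Mapping.single (squarefree_monom A) (wick_coeff E (S - A)))"

lemma keys_explicit_wick_poly:
  "finite S \<Longrightarrow> Poly_Mapping.keys (explicit_wick_poly E S) \<subseteq> squarefree_monom ` Pow S"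
  unfolding explicit_wick_poly_def
  by (rule order_trans[OF keys_sum]) (auto split: if_splits)

lemma inj_on_squarefree_monom: "finite S \<Longrightarrow> inj_on squarefree_monom (Pow S)"
  by (rule inj_onI) (metis PowD finite_subset keys_squarefree_monom)

lemma lookup_explicit_wick_poly:
  assumes "finite S" "A \<subseteq> S"
  shows "Poly_Mapping.lookup (explicit_wick_poly E S) (squarefree_monom A) = wick_coeff E (S - A)"
proof -
  have "Poly_Mapping.lookup (explicit_wick_poly E S) (squarefree_monom A)
    = (\<Sum>B\<in>Pow S. if B = A then wick_coeff E (S - B) else 0)"
    unfolding explicit_wick_poly_def lookup_sum lookup_single when_def
    using inj_on_squarefree_monom[OF assms(1)] assms(2)
    by (intro sum.cong refl) (auto dest: inj_onD)
  then show ?thesis using assms by simp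
qed

lemma eval_explicit_wick_poly:
  assumes "finite S"
  shows "mpoly_eval (explicit_wick_poly E S) y = (\<Sum>A\<in>Pow S. wick_coeff E (S - A) * (\<Prod>i\<in>A. y i))"
proof -
  have "mpoly_eval (explicit_wick_poly E S) y = (\<Sum>A\<in>Pow S. wick_coeff E (S - A) *
     (\<Prod>i\<in>Poly_Mapping.keys (squarefree_monom A). y i ^ Poly_Mapping.lookup (squarefree_monom A) i))"
    using assms by (subst mpoly_eval_superset[OF _ keys_explicit_wick_poly])
      (simp_all add: sum.reindex inj_on_squarefree_monom lookup_explicit_wick_poly)
  also have "\<dots> = (\<Sum>A\<in>Pow S. wick_coeff E (S - A) * (\<Prod>i\<in>A. y i))"
  proof (intro sum.cong refl arg_cong2[where f = "(*)"])
    fix A assume "A \<in> Pow S"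
    then have "finite A" using assms finite_subset by blast
    then show "(\<Prod>i\<in>Poly_Mapping.keys (squarefree_monom A). y i ^ Poly_Mapping.lookup (squarefree_monom A) i) = (\<Prod>i\<in>A. y i)"
      by (simp add: keys_squarefree_monom lookup_squarefree_monom)
  qed
  finally show ?thesis .
qed

text \<open>The derivative removes \<open>i\<close> from \<open>A\<close> and from \<open>S\<close>
  at once, so \<open>S - A\<close>, and with it the coefficient, stays the same.\<close>

lemma deriv_explicit_wick_poly:
  assumes S: "finite S" "i \<in> S"
  shows "mpoly_deriv i (explicit_wick_poly E S) = explicit_wick_poly E (S - {i})"
proof -
  let ?m = squarefree_monom
  have "mpoly_deriv i (explicit_wick_poly E S) = (\<Sum>A\<in>Pow S. Poly_Mapping.single (?m A - Poly_Mapping.single i 1)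
     (of_nat (Poly_Mapping.lookup (?m A) i) * wick_coeff E (S - A)))"
    using S by (subst mpoly_deriv_superset[OF _ keys_explicit_wick_poly])
      (simp_all add: sum.reindex inj_on_squarefree_monom lookup_explicit_wick_poly)
  also have "\<dots> = (\<Sum>A\<in>{A \<in> Pow S. i \<in> A}. Poly_Mapping.single (?m (A - {i})) (wick_coeff E (S - A)))"
  proof (rule sum.mono_neutral_cong_right)
    show "\<forall>A\<in>Pow S - {A \<in> Pow S. i \<in> A}. Poly_Mapping.single (?m A - Poly_Mapping.single i 1)
     (of_nat (Poly_Mapping.lookup (?m A) i) * wick_coeff E (S - A)) = 0"
    proof
      fix A assume A: "A \<in> Pow S - {A \<in> Pow S. i \<in> A}"
      then have "finite A" "i \<notin> A" using S finite_subset by auto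
      then show "Poly_Mapping.single (?m A - Poly_Mapping.single i 1)
         (of_nat (Poly_Mapping.lookup (?m A) i) * wick_coeff E (S - A)) = 0"
        by (simp add: lookup_squarefree_monom)
    qed
    fix A assume "A \<in> {A \<in> Pow S. i \<in> A}"
    then have "finite A" "i \<in> A" using S finite_subset by auto
    then show "Poly_Mapping.single (?m A - Poly_Mapping.single i 1)
         (of_nat (Poly_Mapping.lookup (?m A) i) * wick_coeff E (S - A))
      = Poly_Mapping.single (?m (A - {i})) (wick_coeff E (S - A))"
      by (simp add: lookup_squarefree_monom squarefree_monom_minus[simplified])
  qed (use S in auto)
  also have "\<dots> = explicit_wick_poly E (S - {i})"
    unfolding explicit_wick_poly_def
    by (rule sum.reindex_bij_witness[where i = "insert i" and j = "\<lambda>A. A - {i}"])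
       (use S in \<open>auto intro!: arg_cong2[where f = Poly_Mapping.single] arg_cong[where f = "wick_coeff E"]\<close>)
  finally show ?thesis .
qed

text \<open>The derivatives fix all coefficients but the constant one, and the mean fixes that. The
  mean of the explicit polynomial vanishes by the convolution identity for
  \<open>wick_coeff\<close>.\<close>

theorem wick_poly_eq_explicit:
  fixes X :: "nat \<Rightarrow> 'a \<Rightarrow> complex"
  assumes "prob_space M" and I: "finite I"
    and int: "\<And>A. A \<subseteq> I \<Longrightarrow> integrable M (\<lambda>\<omega>. \<Prod>i\<in>A. X i \<omega>)"
    and E: "\<And>A. A \<subseteq> I \<Longrightarrow> E A = (LINT \<omega>|M. (\<Prod>i\<in>A. X i \<omega>))"
  shows "S \<subseteq> I \<Longrightarrow> wick_poly M X S = explicit_wick_poly E S"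
proof (induction "card S" arbitrary: S rule: less_induct)
  case less
  interpret prob_space M by fact
  have S: "finite S" using less.prems I by (rule finite_subset)
  have E0: "E {} = 1" using E[of "{}"] by (simp add: prob_space)
  show ?case
  proof (cases "S = {}")
    case True
    have "squarefree_monom {} = 0" by (simp add: squarefree_monom_def)
    then show ?thesis using True by (subst wick_poly.simps) (simp add: explicit_wick_poly_def)
  next
    case False
    let ?P = "explicit_wick_poly E S"
    let ?ok = "\<lambda>P. mpoly_vars P \<subseteq> S \<and> (\<forall>i\<in>S. mpoly_deriv i P = wick_poly M X (S - {i})) \<and>
                (LINT \<omega>|M. mpoly_eval P (\<lambda>i. X i \<omega>)) = 0"
    have sub: "A \<subseteq> I" if "A \<in> Pow S" for A using that less.prems by blast
    have int_P: "integrable M (\<lambda>\<omega>. mpoly_eval ?P (\<lambda>i. X i \<omega>))"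
      unfolding eval_explicit_wick_poly[OF S]
      by (intro Bochner_Integration.integrable_sum integrable_mult_right int sub)
    have "(LINT \<omega>|M. mpoly_eval ?P (\<lambda>i. X i \<omega>)) = (\<Sum>A\<in>Pow S. wick_coeff E (S - A) * E A)"
      unfolding eval_explicit_wick_poly[OF S]
      by (subst Bochner_Integration.integral_sum) (auto intro!: integrable_mult_right int sub simp: E[OF sub])
    also have "\<dots> = (\<Sum>A\<in>Pow S. wick_coeff E A * E (S - A))"
      by (rule sum_Pow_complement)
    also have "\<dots> = 0" using wick_coeff_convolution[where E = E, OF S E0] False by simp
    finally have mean_P: "(LINT \<omega>|M. mpoly_eval ?P (\<lambda>i. X i \<omega>)) = 0" .
    have "mpoly_vars ?P \<subseteq> S"
    proof -
      have "Poly_Mapping.keys m \<subseteq> S" if "m \<in> squarefree_monom ` Pow S" for m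
      proof -
        obtain A where A: "m = squarefree_monom A" "A \<subseteq> S"
          using \<open>m \<in> squarefree_monom ` Pow S\<close> by blast
        then have "finite A" using S finite_subset by blast
        then show ?thesis using A keys_squarefree_monom by simp
      qed
      then show ?thesis
        unfolding mpoly_vars_def using keys_explicit_wick_poly[OF S, of E] by (meson UN_least subsetD)
    qed
    moreover have "mpoly_deriv i ?P = wick_poly M X (S - {i})" if "i \<in> S" for i
    proof -
      have "card (S - {i}) < card S" using that S by (rule card_Diff1_less[rotated])
      moreover have "S - {i} \<subseteq> I" using less.prems by blast
      ultimately have "wick_poly M X (S - {i}) = explicit_wick_poly E (S - {i})" by (rule less.hyps)
      then show ?thesis by (simp only: deriv_explicit_wick_poly[OF S that])
    qed
    ultimately have ok: "?ok ?P" using mean_P by blast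
    have "Q = ?P" if Q: "?ok Q" for Q
    proof -
      have nonzero: "Poly_Mapping.lookup Q m = Poly_Mapping.lookup ?P m" if "m \<noteq> 0" for m
        using Q ok that by (intro mpoly_eq_if_derivs_eq[of _ S]) auto
      \<comment> \<open>Two solutions differ by a constant, and comparing means gives
        \<open>d = 0\<close>.\<close>
      define d where "d = Poly_Mapping.lookup Q 0 - Poly_Mapping.lookup ?P 0"
      have eval: "mpoly_eval Q y = mpoly_eval ?P y + d" for y
      proof -
        let ?K = "insert 0 (Poly_Mapping.keys Q \<union> Poly_Mapping.keys ?P)"
        let ?t = "\<lambda>R m. Poly_Mapping.lookup R m * (\<Prod>i\<in>Poly_Mapping.keys m. y i ^ Poly_Mapping.lookup m i)"
        have "mpoly_eval R y = Poly_Mapping.lookup R 0 + (\<Sum>m\<in>?K - {0}. ?t R m)" if "R \<in> {Q, ?P}" for R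
        proof -
          have "mpoly_eval R y = (\<Sum>m\<in>?K. ?t R m)"
            using that by (intro mpoly_eval_superset) auto
          then show ?thesis by (simp add: sum.insert_remove)
        qed
        moreover have "(\<Sum>m\<in>?K - {0}. ?t Q m) = (\<Sum>m\<in>?K - {0}. ?t ?P m)"
          using nonzero by (intro sum.cong refl) auto
        ultimately show ?thesis by (simp add: d_def)
      qed
      have "0 = (LINT \<omega>|M. mpoly_eval ?P (\<lambda>i. X i \<omega>) + d)" using Q by (simp add: eval)
      also have "\<dots> = d" using int_P mean_P by (simp add: prob_space)
      finally have "d = 0" by simp
      then have "Poly_Mapping.lookup Q m = Poly_Mapping.lookup ?P m" for m
        using nonzero[of m] by (cases "m = 0") (auto simp: d_def)
      then show ?thesis by (rule poly_mapping_eqI)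
    qed
    then have "(THE P. ?ok P) = ?P" using ok by (intro the_equality) blast+
    then show ?thesis using S False by (subst wick_poly.simps) simp
  qed
qed

section \<open>Traces over cycles\<close>

lemma matrix_pow_Suc: "(((**) A) ^^ Suc k) (mat 1) $ i $ j
    = (\<Sum>p\<in>UNIV. A $ i $ p * (((**) A) ^^ k) (mat 1) $ p $ j)"
  for A :: "complex^'n::finite^'n"
  by (simp add: matrix_matrix_mult_def)

text \<open>A matrix power as a sum over paths that start at \<open>q\<close>. The weight
  \<open>h\<close> of the endpoint is left arbitrary so that the induction can absorb the last step
  into it.\<close>

lemma sum_paths:
  fixes A :: "complex^'n::finite^'n"
  shows "(\<Sum>y\<in>PiE {..<Suc k} (\<lambda>_. UNIV). (if y 0 = q then 1 else 0) * (\<Prod>i<k. A $ y (Suc i) $ y i) * h (y k))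
    = (\<Sum>p\<in>UNIV. h p * (((**) A) ^^ k) (mat 1) $ p $ q)"
proof (induction k arbitrary: h)
  case 0
  have "{..<Suc 0} = insert 0 {}" by auto
  then show ?case
    by (simp add: sum_PiE_insert mat_def if_distrib[of "\<lambda>x. x * _"] if_distrib[of "(*) _"] cong: if_cong)
next
  case (Suc k)
  have "(\<Sum>y\<in>PiE {..<Suc (Suc k)} (\<lambda>_. UNIV). (if y 0 = q then 1 else 0) * (\<Prod>i<Suc k. A $ y (Suc i) $ y i) * h (y (Suc k)))
    = (\<Sum>p\<in>UNIV. \<Sum>y\<in>PiE {..<Suc k} (\<lambda>_. UNIV). (if y 0 = q then 1 else 0) * (\<Prod>i<k. A $ y (Suc i) $ y i) * (A $ p $ y k * h p))"
    unfolding lessThan_Suc[of "Suc k"] by (subst sum_PiE_insert) (simp_all add: mult.assoc)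
  also have "\<dots> = (\<Sum>y\<in>PiE {..<Suc k} (\<lambda>_. UNIV). (if y 0 = q then 1 else 0) * (\<Prod>i<k. A $ y (Suc i) $ y i) * (\<Sum>p\<in>UNIV. A $ p $ y k * h p))"
    by (subst sum.swap) (simp add: sum_distrib_left)
  also have "\<dots> = (\<Sum>r\<in>UNIV. (\<Sum>p\<in>UNIV. A $ p $ r * h p) * (((**) A) ^^ k) (mat 1) $ r $ q)"
    by (rule Suc.IH)
  also have "\<dots> = (\<Sum>p\<in>UNIV. h p * (((**) A) ^^ Suc k) (mat 1) $ p $ q)"
    unfolding matrix_pow_Suc sum_distrib_left sum_distrib_right
    by (subst sum.swap) (simp add: mult_ac)
  finally show ?case .
qed

text \<open>A closed path is a path of one step less from \<open>q\<close>, closed up by the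
  endpoint weight \<open>A $ q $ p\<close>.\<close>

lemma power_sum_eq_sum_cycles:
  fixes A :: "complex^'n::finite^'n"
  assumes "k > 0"
  shows "(\<Sum>y\<in>PiE {..<k} (\<lambda>_. UNIV). \<Prod>i<k. A $ y (Suc i mod k) $ y i) = power_sum k A"
proof -
  obtain n where k: "k = Suc n" using assms by (cases k) auto
  have "(\<Sum>y\<in>PiE {..<k} (\<lambda>_. UNIV). \<Prod>i<k. A $ y (Suc i mod k) $ y i)
    = (\<Sum>y\<in>PiE {..<k} (\<lambda>_. UNIV). \<Sum>q\<in>UNIV. (if y 0 = q then 1 else 0) * (\<Prod>i<n. A $ y (Suc i) $ y i) * A $ q $ y n)"
    by (simp add: k mult.assoc if_distrib[of "\<lambda>x. x * _"] cong: if_cong)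
  also have "\<dots> = (\<Sum>q\<in>UNIV. \<Sum>p\<in>UNIV. A $ q $ p * (((**) A) ^^ n) (mat 1) $ p $ q)"
    unfolding k by (subst sum.swap) (intro sum.cong refl sum_paths[where h = "\<lambda>p. A $ _ $ p"])
  also have "\<dots> = power_sum k A"
    unfolding power_sum_def trace_def k matrix_pow_Suc ..
  finally show ?thesis .
qed

lemma sum_assign_cycle:
  fixes A :: "complex^'n::finite^'n"
  assumes k: "k > 0" and c: "bij_betw c {..<k} C" and step: "\<And>i. i < k \<Longrightarrow> \<sigma> (c i) = c (Suc i mod k)"
  shows "(\<Sum>x\<in>assign C. \<Prod>s\<in>C. A $ x (\<sigma> s) $ x s) = power_sum k A"
proof -
  let ?d = "the_inv_into {..<k} c"
  have c_in: "c i \<in> C" if "i < k" for i using c that by (auto simp: bij_betw_def)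
  have inj: "inj_on c {..<k}" using c by (simp add: bij_betw_def)
  have d: "c (?d s) = s" "?d s < k" if "s \<in> C" for s
    using that c by (auto simp: bij_betw_def f_the_inv_into_f the_inv_into_into[of c "{..<k}" s "{..<k}", simplified])
  have dc: "?d (c i) = i" if "i < k" for i using that inj by (simp add: the_inv_into_f_f)
  have "(\<Sum>x\<in>assign C. \<Prod>s\<in>C. A $ x (\<sigma> s) $ x s) = (\<Sum>y\<in>PiE {..<k} (\<lambda>_. UNIV). \<Prod>i<k. A $ y (Suc i mod k) $ y i)"
  proof (rule sum.reindex_bij_witness[where i = "\<lambda>y. restrict (y \<circ> ?d) C" and j = "\<lambda>x. restrict (x \<circ> c) {..<k}"])
    fix x :: "slot \<Rightarrow> 'n" assume x: "x \<in> assign C"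
    show "restrict (restrict (x \<circ> c) {..<k} \<circ> ?d) C = x"
      using x by (intro PiE_ext[of _ C "\<lambda>_. UNIV"]) (auto simp: d)
    have "(\<Prod>s\<in>C. A $ x (\<sigma> s) $ x s) = (\<Prod>i<k. A $ x (\<sigma> (c i)) $ x (c i))"
      by (rule prod.reindex_bij_betw[OF c, symmetric])
    also have "\<dots> = (\<Prod>i<k. A $ restrict (x \<circ> c) {..<k} (Suc i mod k) $ restrict (x \<circ> c) {..<k} i)"
      using k by (intro prod.cong refl) (simp add: step)
    finally show "(\<Prod>i<k. A $ restrict (x \<circ> c) {..<k} (Suc i mod k) $ restrict (x \<circ> c) {..<k} i) = (\<Prod>s\<in>C. A $ x (\<sigma> s) $ x s)" ..
  next
    fix y :: "nat \<Rightarrow> 'n" assume y: "y \<in> PiE {..<k} (\<lambda>_. UNIV)"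
    show "restrict (restrict (y \<circ> ?d) C \<circ> c) {..<k} = y"
      using y by (intro PiE_ext[of _ "{..<k}" "\<lambda>_. UNIV"]) (auto simp: dc c_in)
  qed auto
  also have "\<dots> = power_sum k A" by (rule power_sum_eq_sum_cycles[OF k])
  finally show ?thesis .
qed

lemma matrix_pow_mult: "(((**) A) ^^ k) B = (((**) A) ^^ k) (mat 1) ** B"
  for A :: "complex^'n::finite^'n"
  by (induction k) (simp_all add: matrix_mul_assoc)

lemma matrix_pow_commute: "A ** (((**) A) ^^ k) (mat 1) = (((**) A) ^^ k) (mat 1) ** A"
  for A :: "complex^'n::finite^'n"
  by (metis funpow_swap1 matrix_mul_rid matrix_pow_mult)

lemma power_sum_transpose: "power_sum k (transpose A) = power_sum k A"
  for A :: "complex^'n::finite^'n"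
proof -
  have "(((**) (transpose A)) ^^ k) (mat 1) = transpose ((((**) A) ^^ k) (mat 1))"
  proof (induction k)
    case (Suc k)
    then show ?case by (simp add: matrix_transpose_mul[symmetric] matrix_pow_commute)
  qed (simp add: transpose_mat)
  then show ?thesis by (simp add: power_sum_def trace_def transpose_def)
qed

lemma power_sum_conj_transpose: "power_sum k (conj_transpose A) = cnj (power_sum k A)"
  for A :: "complex^'n::finite^'n"
proof -
  have "(((**) (conj_transpose A)) ^^ k) (mat 1) = conj_transpose ((((**) A) ^^ k) (mat 1))"
  proof (induction k)
    case (Suc k)
    then show ?case by (simp add: conj_transpose_mult[symmetric] matrix_pow_commute)
  qed (simp add: conj_transpose_def mat_def vec_eq_iff)
  then show ?thesis by (simp add: power_sum_def trace_def conj_transpose_def)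
qed

lemma orbit_cycle:
  assumes "permutation \<alpha>"
  obtains c where "bij_betw c {..<card (orbit \<alpha> s)} (orbit \<alpha> s)"
    "\<And>i. i < card (orbit \<alpha> s) \<Longrightarrow> \<alpha> (c i) = c (Suc i mod card (orbit \<alpha> s))" "card (orbit \<alpha> s) > 0"
proof -
  let ?k = "funpow_dist1 \<alpha> s s"
  have s: "s \<in> orbit \<alpha> s" using assms by (rule permutation_self_in_orbit)
  have "orbit \<alpha> s = (\<lambda>n. (\<alpha> ^^ n) s) ` {0..<?k}" by (rule orbit_conv_funpow_dist1[OF s])
  moreover have "inj_on (\<lambda>n. (\<alpha> ^^ n) s) {0..<?k}" by (rule inj_on_funpow_dist1[OF s])
  ultimately have bij: "bij_betw (\<lambda>n. (\<alpha> ^^ n) s) {..<?k} (orbit \<alpha> s)"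
    by (simp add: bij_betw_def lessThan_atLeast0)
  then have k: "card (orbit \<alpha> s) = ?k" using bij_betw_same_card by fastforce
  have "(\<alpha> ^^ ?k) s = s" using s by (rule funpow_dist1_prop)
  then have "\<alpha> ((\<alpha> ^^ i) s) = (\<alpha> ^^ (Suc i mod ?k)) s" if "i < ?k" for i
    using that by (cases "Suc i = ?k") auto
  then show ?thesis using that[of "\<lambda>n. (\<alpha> ^^ n) s"] bij unfolding k by simp
qed

section \<open>Permutations of a given cycle type\<close>

text \<open>\<open>\<gamma>\<close> rotates the \<open>k\<close> new points and fixes the others,
  while \<open>\<alpha>\<close> moves only the old points; each orbit of the composition is
  therefore one of \<open>\<alpha>\<close> or the block of new points.\<close>

lemma has_cycle_type_append_cycle:
  assumes \<alpha>: "has_cycle_type n \<alpha> l" and k: "k > 0"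
  shows "\<exists>\<alpha>'. has_cycle_type (k + n) \<alpha>' (k # l)"
proof -
  have \<alpha>_perm: "\<alpha> permutes {..<n}" and type: "image_mset card (mset_set (orbit \<alpha> ` {..<n})) = mset l"
    using \<alpha> by (auto simp: has_cycle_type_def)
  define \<gamma> where "\<gamma> i = (if n \<le> i \<and> i < k + n then (if Suc i = k + n then n else Suc i) else i)" for i
  have "\<gamma> ` {n..<k + n} \<subseteq> {n..<k + n}" "inj_on \<gamma> {n..<k + n}"
    by (auto simp: \<gamma>_def inj_on_def split: if_splits)
  then have "bij_betw \<gamma> {n..<k + n} {n..<k + n}"
    by (simp add: bij_betw_def endo_inj_surj)
  then have "\<gamma> permutes {n..<k + n}"
    by (rule bij_imp_permutes) (auto simp: \<gamma>_def)
  then have perm: "\<alpha> \<circ> \<gamma> permutes {..<k + n}"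
    by (intro permutes_compose) (auto intro: permutes_subset[OF \<alpha>_perm] permutes_subset)
  have low: "(\<alpha> \<circ> \<gamma>) i = \<alpha> i" if "i < n" for i using that by (simp add: \<gamma>_def)
  have high: "(\<alpha> \<circ> \<gamma>) i = \<gamma> i" if "n \<le> i" for i
  proof -
    have "\<gamma> i \<notin> {..<n}" using that by (auto simp: \<gamma>_def)
    then show ?thesis using permutes_not_in[OF \<alpha>_perm] by simp
  qed
  have orb_low: "orbit (\<alpha> \<circ> \<gamma>) i = orbit \<alpha> i" if "i < n" for i
  proof (rule orbit_cong0[where A = "{..<n}"])
    show "\<alpha> \<circ> \<gamma> \<in> {..<n} \<rightarrow> {..<n}"
      using low permutes_in_image[OF \<alpha>_perm] by auto
  qed (use that low in auto)
  have pow: "((\<alpha> \<circ> \<gamma>) ^^ j) n = n + j" if "j < k" for j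
    using that
  proof (induction j)
    case (Suc j)
    then show ?case using high[of "n + j"] by (simp add: \<gamma>_def)
  qed simp
  have "((\<alpha> \<circ> \<gamma>) ^^ k) n = n"
  proof -
    obtain j where j: "k = Suc j" using k by (cases k) auto
    then show ?thesis using pow[of j] high[of "n + j"] by (simp add: \<gamma>_def)
  qed
  from orbit_altdef_bounded[OF this k] have orb_n: "orbit (\<alpha> \<circ> \<gamma>) n = {n..<k + n}"
  proof -
    have "{((\<alpha> \<circ> \<gamma>) ^^ m) n | m. m < k} = (\<lambda>m. n + m) ` {..<k}" using pow by force
    also have "\<dots> = {n..<k + n}"
      using image_add_atLeastLessThan[of n 0 k] by (simp add: lessThan_atLeast0 add.commute)
    finally show ?thesis using \<open>orbit (\<alpha> \<circ> \<gamma>) n = {((\<alpha> \<circ> \<gamma>) ^^ m) n | m. m < k}\<close> by simp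
  qed
  have permutation: "permutation (\<alpha> \<circ> \<gamma>)" using perm by (auto simp: permutation_permutes)
  have orb_high: "orbit (\<alpha> \<circ> \<gamma>) i = {n..<k + n}" if "i \<in> {n..<k + n}" for i
  proof -
    have "cyclic_on (\<alpha> \<circ> \<gamma>) {n..<k + n}"
      using cyclic_on_orbit'[OF permutation, of n] orb_n by simp
    then show ?thesis using that by (simp add: cyclic_on_alldef)
  qed
  have "{..<k + n} = {n..<k + n} \<union> {..<n}" by auto
  then have img: "orbit (\<alpha> \<circ> \<gamma>) ` {..<k + n} = insert {n..<k + n} (orbit \<alpha> ` {..<n})"
    using orb_low orb_high k by (auto simp: image_Un image_iff)
  \<comment> \<open>The cycle type is read from the set of orbits, so the new orbit adds an entry
    only if it is not yet there.\<close>
  have "{n..<k + n} \<notin> orbit \<alpha> ` {..<n}"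
  proof
    assume "{n..<k + n} \<in> orbit \<alpha> ` {..<n}"
    then obtain i where "i < n" "orbit \<alpha> i = {n..<k + n}" by auto
    moreover have "orbit \<alpha> i \<subseteq> {..<n}" using \<open>i < n\<close> permutes_orbit_subset[OF \<alpha>_perm] by simp
    ultimately show False using k by auto
  qed
  then have "has_cycle_type (k + n) (\<alpha> \<circ> \<gamma>) (k # l)"
    unfolding has_cycle_type_def img using perm type by simp
  then show ?thesis by blast
qed

lemma ex_has_cycle_type:
  assumes "\<forall>k\<in>set l. 0 < k"
  shows "\<exists>\<alpha>. has_cycle_type (sum_list l) \<alpha> l"
  using assms
proof (induction l)
  case Nil
  have "has_cycle_type 0 id []" by (simp add: has_cycle_type_def permutes_id)
  then show ?case by auto
next
  case (Cons k l)
  then show ?case using has_cycle_type_append_cycle by fastforce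
qed

text \<open>Orders the orbits so that their lengths appear as in \<open>l\<close>, which puts each
  cycle at the index of its power sum.\<close>

lemma has_cycle_type_orbit_list:
  assumes "has_cycle_type n \<alpha> l"
  obtains os where "distinct os" "set os = orbit \<alpha> ` {..<n}" "map card os = l"
proof -
  obtain os where os: "mset os = mset_set (orbit \<alpha> ` {..<n})" using ex_mset by blast
  then have "mset l = mset (map card os)" using assms by (simp add: has_cycle_type_def)
  then obtain p where p: "p permutes {..<length (map card os)}" "permute_list p (map card os) = l"
    by (rule mset_eq_permutation)
  have "p permutes {..<length os}" using p(1) by simp
  moreover from this have "map card (permute_list p os) = l"
    using p(2) by (simp add: permute_list_map)
  moreover have "distinct os" "set os = orbit \<alpha> ` {..<n}"
    using os by (metis mset_eq_mset_set_imp_distinct finite_imageI finite_lessThan)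
       (metis os set_mset_mset finite_set_mset_mset_set finite_imageI finite_lessThan)
  ultimately show ?thesis using that[of "permute_list p os"] by simp
qed

section \<open>List tensors as forms\<close>

definition of_lists :: "'n list \<Rightarrow> 'n list \<Rightarrow> slot \<Rightarrow> 'n" where
  "of_lists is js s = (case s of Inl a \<Rightarrow> is ! a | Inr b \<Rightarrow> js ! b)"

definition tensor_of_form :: "nat \<Rightarrow> nat \<Rightarrow> 'n form \<Rightarrow> 'n tensor" where
  "tensor_of_form n m t = (\<lambda>(is, js). if length is = n \<and> length js = m then t (of_lists is js) else 0)"

definition lists_of :: "nat \<Rightarrow> nat \<Rightarrow> (slot \<Rightarrow> 'n) \<Rightarrow> 'n list \<times> 'n list" where
  "lists_of n m f = (map (\<lambda>a. f (Inl a)) [0..<n], map (\<lambda>b. f (Inr b)) [0..<m])"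

lemma clinear_tensor_of_form: "clinear (tensor_of_form n m)"
  by (rule clinearI) (auto simp: tensor_of_form_def fun_eq_iff)

lemma clinear_list_action: "clinear (perm_action \<alpha> \<beta> \<circ> unitary_action U)"
  by (rule clinearI)
    (auto simp: perm_action_def unitary_action_def fun_eq_iff algebra_simps sum.distrib sum_distrib_left)

lemma tensor_of_form_lists_of:
  assumes "t \<in> forms (list_slots n m)"
  shows "tensor_of_form n m t (lists_of n m f) = t f"
proof -
  have "t (of_lists (map (\<lambda>a. f (Inl a)) [0..<n]) (map (\<lambda>b. f (Inr b)) [0..<m])) = t f"
    by (rule formsD[OF assms]) (auto simp: of_lists_def list_slots_def)
  then show ?thesis by (simp add: tensor_of_form_def lists_of_def)
qed

lemma inj_on_tensor_of_form: "inj_on (tensor_of_form n m) (forms (list_slots n m))"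
  by (rule inj_onI) (metis ext tensor_of_form_lists_of)

lemma insert_nth_conv_update:
  assumes "length xs = n - 1" "a < n"
  shows "take a xs @ k # drop a xs = (take a xs @ z # drop a xs)[a := k]"
  using assms by (simp add: list_update_append)

text \<open>\<open>contraction\<close> takes lists that lack the contracted entry, whereas
  \<open>pair_trace\<close> ignores the values of an assignment there; each direction translates one
  convention into the other.\<close>

lemma contraction_tensor_of_form:
  fixes t :: "'n::finite form"
  assumes t: "t \<in> forms (list_slots n m)" and ab: "a < n" "b < m"
  shows "contraction a b (tensor_of_form n m t) = 0 \<longleftrightarrow> pair_trace a b t = 0"
proof
  assume contr: "contraction a b (tensor_of_form n m t) = 0"
  show "pair_trace a b t = 0"
  proof
    fix f :: "slot \<Rightarrow> 'n"
    let ?is = "map (\<lambda>a. f (Inl a)) [0..<n]" and ?js = "map (\<lambda>b. f (Inr b)) [0..<m]"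
    \<comment> \<open>Deleting an entry and inserting \<open>k\<close> at its place amounts to
      updating it.\<close>
    have "tensor_of_form n m t (take a (take a ?is @ drop (Suc a) ?is) @ k # drop a (take a ?is @ drop (Suc a) ?is),
        take b (take b ?js @ drop (Suc b) ?js) @ k # drop b (take b ?js @ drop (Suc b) ?js))
      = t (f(Inl a := k, Inr b := k))" for k
    proof -
      have "take a (take a ?is @ drop (Suc a) ?is) @ k # drop a (take a ?is @ drop (Suc a) ?is) = ?is[a := k]"
        using ab(1) by (simp add: upd_conv_take_nth_drop)
      moreover have "take b (take b ?js @ drop (Suc b) ?js) @ k # drop b (take b ?js @ drop (Suc b) ?js) = ?js[b := k]"
        using ab(2) by (simp add: upd_conv_take_nth_drop)
      moreover have "(?is[a := k], ?js[b := k]) = lists_of n m (f(Inl a := k, Inr b := k))"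
        by (auto simp: lists_of_def nth_list_update intro!: nth_equalityI)
      ultimately show ?thesis using tensor_of_form_lists_of[OF t] by metis
    qed
    then have "pair_trace a b t f = contraction a b (tensor_of_form n m t) (take a ?is @ drop (Suc a) ?is, take b ?js @ drop (Suc b) ?js)"
      by (simp add: pair_trace_def contraction_def)
    then show "pair_trace a b t f = 0 f" by (simp add: contr)
  qed
next
  assume tr: "pair_trace a b t = 0"
  show "contraction a b (tensor_of_form n m t) = 0"
  proof
    fix ij :: "'n list \<times> 'n list"
    obtain "is" js where ij: "ij = (is, js)" by (cases ij)
    show "contraction a b (tensor_of_form n m t) ij = 0 ij"
    proof (cases "length is = n - 1 \<and> length js = m - 1")
      case True
      \<comment> \<open>An arbitrary filler for the missing entries, overwritten by
        \<open>pair_trace\<close>.\<close>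
      fix z :: 'n
      let ?is = "\<lambda>k. take a is @ k # drop a is" and ?js = "\<lambda>k. take b js @ k # drop b js"
      have len: "length (?is k) = n" "length (?js k) = m" for k using True ab by auto
      have "of_lists (?is k) (?js k) s = ((of_lists (?is z) (?js z))(Inl a := k, Inr b := k)) s"
        if "s \<in> list_slots n m" for k s
      proof -
        have "?is k = (?is z)[a := k]" "?js k = (?js z)[b := k]"
          using True ab by (auto intro!: insert_nth_conv_update)
        then show ?thesis
          using that len[of z] by (cases s) (auto simp: of_lists_def list_slots_def nth_list_update)
      qed
      then have "t (of_lists (?is k) (?js k)) = t ((of_lists (?is z) (?js z))(Inl a := k, Inr b := k))" for k
        by (intro formsD[OF t])
      then have "contraction a b (tensor_of_form n m t) ij = pair_trace a b t (of_lists (?is z) (?js z))"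
        using len by (simp add: ij contraction_def tensor_of_form_def pair_trace_def)
      then show ?thesis using tr by simp
    next
      case False
      then have "\<not> (length (take a is @ k # drop a is) = n \<and> length (take b js @ k # drop b js) = m)" for k
        using ab by auto
      then show ?thesis by (simp only: ij contraction_def tensor_of_form_def case_prod_conv if_False) simp
    qed
  qed
qed

lemma tensor_of_form_harmonic:
  "tensor_of_form n m ` harmonic (list_slots n m) = (traceless_tensors n m :: 'n::finite tensor set)"
proof (intro set_eqI iffI)
  fix \<tau> :: "'n tensor" assume "\<tau> \<in> tensor_of_form n m ` harmonic (list_slots n m)"
  then obtain t where t: "t \<in> harmonic (list_slots n m)" "\<tau> = tensor_of_form n m t" by blast
  then show "\<tau> \<in> traceless_tensors n m"
    using contraction_tensor_of_form[OF harmonic_in_forms[OF t(1)]]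
    by (auto simp: traceless_tensors_def tensors_def harmonic_def list_slots_def tensor_of_form_def)
next
  fix \<tau> :: "'n tensor" assume \<tau>: "\<tau> \<in> traceless_tensors n m"
  define t where "t f = \<tau> (lists_of n m f)" for f
  have t: "t \<in> forms (list_slots n m)"
  proof (rule formsI)
    fix f g :: "slot \<Rightarrow> 'n" assume "\<And>s. s \<in> list_slots n m \<Longrightarrow> f s = g s"
    then have "lists_of n m f = lists_of n m g" by (auto simp: lists_of_def list_slots_def)
    then show "t f = t g" by (simp add: t_def)
  qed
  have "tensor_of_form n m t = \<tau>"
  proof
    fix ij :: "'n list \<times> 'n list"
    obtain "is" js where ij: "ij = (is, js)" by (cases ij)
    have "lists_of n m (of_lists is js) = (is, js)" if "length is = n" "length js = m"
      using that by (auto simp: lists_of_def of_lists_def intro!: nth_equalityI)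
    moreover have "\<tau> (is, js) = 0" if "\<not> (length is = n \<and> length js = m)"
      using \<tau> that by (auto simp: traceless_tensors_def tensors_def)
    ultimately show "tensor_of_form n m t ij = \<tau> ij"
      by (auto simp: ij tensor_of_form_def t_def)
  qed
  moreover have "t \<in> harmonic (list_slots n m)"
    using t \<tau> contraction_tensor_of_form[OF t] calculation
    by (auto simp: harmonic_def traceless_tensors_def list_slots_def)
  ultimately show "\<tau> \<in> tensor_of_form n m ` harmonic (list_slots n m)" by blast
qed

lemma list_action_tensor_of_form:
  fixes t :: "'n::finite form" and U :: "complex^'n^'n"
  assumes \<alpha>: "\<alpha> permutes {..<n}" and \<beta>: "\<beta> permutes {..<m}" and t: "t \<in> forms (list_slots n m)"
  shows "(perm_action \<alpha> \<beta> \<circ> unitary_action U) (tensor_of_form n m t)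
    = tensor_of_form n m ((permute \<alpha> \<beta> \<circ> act U (list_slots n m)) t)"
proof
  fix ij :: "'n list \<times> 'n list"
  obtain "is" js where ij: "ij = (is, js)" by (cases ij)
  let ?is = "permute_list \<alpha> is" and ?js = "permute_list \<beta> js"
  show "(perm_action \<alpha> \<beta> \<circ> unitary_action U) (tensor_of_form n m t) ij
    = tensor_of_form n m ((permute \<alpha> \<beta> \<circ> act U (list_slots n m)) t) ij"
  proof (cases "length is = n \<and> length js = m")
    case False
    have "tensor_of_form n m t (ks, ls) = 0" if "length ks = length is" "length ls = length js" for ks ls
      using that False by (auto simp: tensor_of_form_def)
    then show ?thesis using False
      by (auto simp: ij perm_action_def unitary_action_def tensor_of_form_def intro!: sum.neutral)
  next
    case True
    let ?f = "of_lists is js"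
    let ?A = "{ks :: 'n list. length ks = n}" and ?B = "{ls :: 'n list. length ls = m}"
    let ?w = "\<lambda>g. (\<Prod>s\<in>list_slots n m. slot_entry U s (?f (map_sum \<alpha> \<beta> s)) (g s)) * t g"
    have fin: "finite ?A" "finite ?B"
      using finite_lists_length_eq[of "UNIV :: 'n set"] by simp_all
    have perm1: "?is ! a = is ! \<alpha> a" if "a < n" for a using that \<alpha> True by (simp add: permute_list_nth)
    have perm2: "?js ! b = js ! \<beta> b" if "b < m" for b using that \<beta> True by (simp add: permute_list_nth)
    have summand: "(\<Prod>a<n. U $ (?is ! a) $ (ks ! a)) * (\<Prod>b<m. matrix_inv U $ (ls ! b) $ (?js ! b)) * tensor_of_form n m t (ks, ls)
      = ?w (of_lists ks ls)" if "length ks = n" "length ls = m" for ks ls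
    proof -
      have "(\<Prod>s\<in>list_slots n m. slot_entry U s (?f (map_sum \<alpha> \<beta> s)) (of_lists ks ls s))
        = (\<Prod>a<n. slot_entry U (Inl a) (is ! \<alpha> a) (ks ! a)) * (\<Prod>b<m. slot_entry U (Inr b) (js ! \<beta> b) (ls ! b))"
        unfolding list_slots_def by (subst prod.union_disjoint) (auto simp: prod.reindex of_lists_def)
      also have "\<dots> = (\<Prod>a<n. U $ (?is ! a) $ (ks ! a)) * (\<Prod>b<m. matrix_inv U $ (ls ! b) $ (?js ! b))"
        by (simp add: slot_entry_def perm1 perm2)
      finally show ?thesis using that by (simp add: tensor_of_form_def)
    qed
    have "(perm_action \<alpha> \<beta> \<circ> unitary_action U) (tensor_of_form n m t) ij
      = (\<Sum>ks\<in>?A. \<Sum>ls\<in>?B. ?w (of_lists ks ls))"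
      using True by (auto simp: ij perm_action_def unitary_action_def summand intro!: sum.cong)
    also have "\<dots> = (\<Sum>(ks, ls)\<in>?A \<times> ?B. ?w (of_lists ks ls))"
      by (rule sum.cartesian_product)
    also have "\<dots> = (\<Sum>g\<in>assign (list_slots n m). ?w g)"
    proof (rule sum.reindex_bij_witness[where i = "lists_of n m" and j = "\<lambda>(ks, ls). restrict (of_lists ks ls) (list_slots n m)"])
      fix p assume "p \<in> ?A \<times> ?B"
      then obtain ks ls where p: "p = (ks, ls)" "length ks = n" "length ls = m" by auto
      show "lists_of n m (case p of (ks, ls) \<Rightarrow> restrict (of_lists ks ls) (list_slots n m)) = p"
        using p by (auto simp: lists_of_def of_lists_def list_slots_def intro!: nth_equalityI)
      show "(case p of (ks, ls) \<Rightarrow> restrict (of_lists ks ls) (list_slots n m)) \<in> assign (list_slots n m)"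
        using p by auto
      have "t (restrict (of_lists ks ls) (list_slots n m)) = t (of_lists ks ls)" by (rule forms_restrict[OF t])
      then show "?w (case p of (ks, ls) \<Rightarrow> restrict (of_lists ks ls) (list_slots n m)) = (case p of (ks, ls) \<Rightarrow> ?w (of_lists ks ls))"
        using p by simp
    next
      fix g :: "slot \<Rightarrow> 'n" assume g: "g \<in> assign (list_slots n m)"
      show "(case lists_of n m g of (ks, ls) \<Rightarrow> restrict (of_lists ks ls) (list_slots n m)) = g"
        using g unfolding lists_of_def case_prod_conv
        by (intro assign_eqI[of _ "list_slots n m"]) (auto simp: of_lists_def list_slots_def)
      show "lists_of n m g \<in> ?A \<times> ?B" by (simp add: lists_of_def)
    qed
    also have "\<dots> = tensor_of_form n m ((permute \<alpha> \<beta> \<circ> act U (list_slots n m)) t) ij"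
      using True by (simp add: ij tensor_of_form_def permute_def act_def)
    finally show ?thesis .
  qed
qed

lemma newton_perm_eq_harmonic_trace:
  fixes U :: "complex^'n::finite^'n"
  assumes \<alpha>: "\<alpha> permutes {..<n}" and \<beta>: "\<beta> permutes {..<m}" and U: "invertible U"
  shows "newton_perm n m \<alpha> \<beta> U = harmonic_trace \<alpha> \<beta> U (list_slots n m)"
proof -
  let ?S = "list_slots n m"
  have finS: "finite ?S" by (simp add: list_slots_def)
  have inj: "inj \<alpha>" "inj \<beta>" using \<alpha> \<beta> by (auto intro: permutes_inj)
  have \<sigma>S: "map_sum \<alpha> \<beta> ` ?S = ?S"
  proof -
    have "map_sum \<alpha> \<beta> ` ?S = Inl ` \<alpha> ` {..<n} \<union> Inr ` \<beta> ` {..<m}"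
      by (simp add: list_slots_def image_Un image_image)
    then show ?thesis by (simp only: permutes_image[OF \<alpha>] permutes_image[OF \<beta>] list_slots_def)
  qed
  obtain B where B: "B \<subseteq> harmonic ?S" "cfun.independent B" "(harmonic ?S :: 'n form set) \<subseteq> cfun.span B"
    using cfun.maximal_independent_subset by blast
  have span: "cfun.span B = harmonic ?S"
    using B(3) cfun.span_minimal[OF B(1) subspace_harmonic] by blast
  have "finite (point ?S ` assign ?S :: 'n form set)" using finite_assign[OF finS, where 'n='n] by blast
  moreover have "B \<subseteq> forms ?S" using B(1) harmonic_in_forms by blast
  ultimately have finB: "finite B"
    using cfun.independent_span_bound[OF _ B(2)] span_point[OF finS, where 'n='n] by metis
  have "cfun.trace_on (tensor_of_form n m ` cfun.span B) (perm_action \<alpha> \<beta> \<circ> unitary_action U)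
    = cfun.trace_on (cfun.span B) (permute \<alpha> \<beta> \<circ> act U ?S)"
  proof (rule cfun_pair.trace_on_image[OF B(2) finB clinear_tensor_of_form _ clinear_permute_act _ clinear_list_action])
    show "inj_on (tensor_of_form n m) (cfun.span B)"
      unfolding span using inj_on_tensor_of_form by (rule inj_on_subset) (auto intro: harmonic_in_forms)
    show "(permute \<alpha> \<beta> \<circ> act U ?S) b \<in> cfun.span B" if "b \<in> B" for b
      using permute_harmonic[OF inj act_harmonic[OF finS U]] that B(1) unfolding span by (auto simp: \<sigma>S)
    show "(perm_action \<alpha> \<beta> \<circ> unitary_action U) (tensor_of_form n m b)
      = tensor_of_form n m ((permute \<alpha> \<beta> \<circ> act U ?S) b)" if "b \<in> B" for b
      by (rule list_action_tensor_of_form[OF \<alpha> \<beta>]) (use that \<open>B \<subseteq> forms ?S\<close> in blast)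
  qed
  then show ?thesis
    unfolding span tensor_of_form_harmonic newton_perm_def harmonic_trace_def .
qed

section \<open>Expansion of products of power sums\<close>

lemma sum_assign_union:
  fixes h h' :: "'n::finite form"
  assumes disj: "S \<inter> S' = {}" and h: "h \<in> forms S" "h' \<in> forms S'"
  shows "(\<Sum>x\<in>assign (S \<union> S'). h x * h' x) = (\<Sum>x\<in>assign S. h x) * (\<Sum>x\<in>assign S'. h' x)"
proof -
  have "(\<Sum>x\<in>assign S. h x) * (\<Sum>x\<in>assign S'. h' x) = (\<Sum>(y, z)\<in>assign S \<times> assign S'. h y * h' z)"
    by (simp add: sum_product sum.cartesian_product)
  also have "\<dots> = (\<Sum>x\<in>assign (S \<union> S'). h x * h' x)"
  proof (rule sum.reindex_bij_witness[where j = "\<lambda>(y, z) s. if s \<in> S then y s else z s"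
        and i = "\<lambda>x. (restrict x S, restrict x S')"])
    fix p :: "(slot \<Rightarrow> 'n) \<times> (slot \<Rightarrow> 'n)" assume "p \<in> assign S \<times> assign S'"
    then obtain y z where p: "p = (y, z)" "y \<in> assign S" "z \<in> assign S'" by auto
    show "(restrict (case p of (y, z) \<Rightarrow> \<lambda>s. if s \<in> S then y s else z s) S,
      restrict (case p of (y, z) \<Rightarrow> \<lambda>s. if s \<in> S then y s else z s) S') = p"
      using p disj by (auto simp: fun_eq_iff)
    show "(case p of (y, z) \<Rightarrow> \<lambda>s. if s \<in> S then y s else z s) \<in> assign (S \<union> S')"
      using p by (auto simp: PiE_def extensional_def)
    have "h (\<lambda>s. if s \<in> S then y s else z s) = h y" by (rule formsD[OF h(1)]) simp
    moreover have "h' (\<lambda>s. if s \<in> S then y s else z s) = h' z" by (rule formsD[OF h(2)]) (use disj in auto)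
    ultimately show "h (case p of (y, z) \<Rightarrow> \<lambda>s. if s \<in> S then y s else z s) *
        h' (case p of (y, z) \<Rightarrow> \<lambda>s. if s \<in> S then y s else z s) = (case p of (y, z) \<Rightarrow> h y * h' z)"
      by (simp add: p)
  next
    fix x :: "slot \<Rightarrow> 'n" assume x: "x \<in> assign (S \<union> S')"
    show "(case (restrict x S, restrict x S') of (y, z) \<Rightarrow> \<lambda>s. if s \<in> S then y s else z s) = x"
      using x by (auto simp: fun_eq_iff PiE_def extensional_def)
  qed auto
  finally show ?thesis by simp
qed

text \<open>For \<open>S\<close> invariant under \<open>\<sigma> = map_sum \<alpha> \<beta>\<close>
  this is the trace on all tensors in the slots of \<open>S\<close>, by
  \<open>trace_on_forms\<close>.\<close>

definition cycle_trace :: "(slot \<Rightarrow> slot) \<Rightarrow> complex^'n::finite^'n \<Rightarrow> slot set \<Rightarrow> complex" where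
  "cycle_trace \<sigma> U S = (\<Sum>x\<in>assign S. \<Prod>s\<in>S. slot_entry U s (x (\<sigma> s)) (x s))"

lemma cycle_trace_empty [simp]: "cycle_trace \<sigma> U {} = 1"
  by (simp add: cycle_trace_def)

lemma cycle_trace_union:
  assumes "S \<inter> S' = {}" "finite S" "finite S'" "\<sigma> ` S \<subseteq> S" "\<sigma> ` S' \<subseteq> S'"
  shows "cycle_trace \<sigma> U (S \<union> S') = cycle_trace \<sigma> U S * cycle_trace \<sigma> U S'"
proof -
  have forms: "(\<lambda>x. \<Prod>s\<in>R. slot_entry U s (x (\<sigma> s)) (x s)) \<in> forms R" if "\<sigma> ` R \<subseteq> R" for R
    using that by (intro formsI prod.cong refl arg_cong2[where f = "slot_entry U _"]) blast+
  show ?thesis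
    unfolding cycle_trace_def prod.union_disjoint[OF assms(2,3,1)]
    by (rule sum_assign_union[OF assms(1) forms[OF assms(4)] forms[OF assms(5)]])
qed

text \<open>The cycles carry the indices of the variables in the Wick product.
  \<open>C_minimal\<close> says that a closed set of slots meeting \<open>C i\<close> contains it,
  so that each \<open>C i\<close> is a single cycle.\<close>

locale cycle_family = index_numbering num n m for num :: "'n::finite \<Rightarrow> nat" and n m +
  fixes \<alpha> \<beta> :: "nat \<Rightarrow> nat" and C :: "nat \<Rightarrow> slot set" and L :: nat
  assumes \<alpha>: "\<alpha> permutes {..<n}" and \<beta>: "\<beta> permutes {..<m}"
    and C_nonempty: "i < L \<Longrightarrow> C i \<noteq> {}"
    and C_disjoint: "i < L \<Longrightarrow> j < L \<Longrightarrow> i \<noteq> j \<Longrightarrow> C i \<inter> C j = {}"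
    and C_union: "(\<Union>i<L. C i) = slots"
    and C_invariant: "i < L \<Longrightarrow> map_sum \<alpha> \<beta> ` C i = C i"
    and C_minimal: "i < L \<Longrightarrow> s \<in> C i \<Longrightarrow> s \<in> X \<Longrightarrow> map_sum \<alpha> \<beta> ` X \<subseteq> X \<Longrightarrow> C i \<subseteq> X"
begin

abbreviation "\<sigma> \<equiv> map_sum \<alpha> \<beta>"

definition cycles :: "nat set \<Rightarrow> slot set" where
  "cycles A = (\<Union>i\<in>A. C i)"

text \<open>\<open>card (pairings T)\<close> is the coefficient \<open>m_T\<close>.\<close>

definition pairings :: "nat set \<Rightarrow> (nat \<times> nat) set set" where
  "pairings T = {\<pi>. matching \<pi> \<and> cov \<pi> = cycles T \<and> map_prod \<alpha> \<beta> ` \<pi> = \<pi>}"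

lemma inj_\<alpha>: "inj \<alpha>" and inj_\<beta>: "inj \<beta>"
  using \<alpha> \<beta> by (auto intro: permutes_inj)

lemma cycles_subset_slots: "A \<subseteq> {..<L} \<Longrightarrow> cycles A \<subseteq> slots"
  using C_union by (auto simp: cycles_def)

lemma finite_cycles: "A \<subseteq> {..<L} \<Longrightarrow> finite (cycles A)"
  using cycles_subset_slots finite_slots finite_subset by blast

lemma cycles_invariant: "A \<subseteq> {..<L} \<Longrightarrow> \<sigma> ` cycles A = cycles A"
  unfolding cycles_def image_UN using C_invariant by (intro SUP_cong refl) auto

lemma C_in_cycles_iff:
  assumes "A \<subseteq> {..<L}" "i < L" "s \<in> C i"
  shows "s \<in> cycles A \<longleftrightarrow> i \<in> A"
proof
  assume "s \<in> cycles A"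
  then obtain j where "j \<in> A" "s \<in> C j" by (auto simp: cycles_def)
  then show "i \<in> A" using C_disjoint[of i j] assms by blast
qed (use assms in \<open>auto simp: cycles_def\<close>)

lemma cycles_inj: "A \<subseteq> {..<L} \<Longrightarrow> B \<subseteq> {..<L} \<Longrightarrow> cycles A = cycles B \<Longrightarrow> A = B"
proof -
  have "A \<subseteq> B" if AB: "A \<subseteq> {..<L}" "B \<subseteq> {..<L}" "cycles A = cycles B" for A B
  proof
    fix i assume i: "i \<in> A"
    then have "i < L" using AB(1) by blast
    then obtain s where "s \<in> C i" using C_nonempty by blast
    then show "i \<in> B"
      using C_in_cycles_iff[OF AB(1) \<open>i < L\<close>] C_in_cycles_iff[OF AB(2) \<open>i < L\<close>] i AB(3) by blast
  qed
  then show "A \<subseteq> {..<L} \<Longrightarrow> B \<subseteq> {..<L} \<Longrightarrow> cycles A = cycles B \<Longrightarrow> A = B"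
    by (metis subset_antisym)
qed

lemma cycles_diff: "A \<subseteq> {..<L} \<Longrightarrow> T \<subseteq> A \<Longrightarrow> cycles A - cycles T = cycles (A - T)"
proof (intro set_eqI iffI)
  fix s assume A: "A \<subseteq> {..<L}" "T \<subseteq> A"
  {
    assume "s \<in> cycles A - cycles T"
    then obtain i where "i \<in> A" "s \<in> C i" "i \<notin> T" by (auto simp: cycles_def)
    then show "s \<in> cycles (A - T)" by (auto simp: cycles_def)
  next
    assume "s \<in> cycles (A - T)"
    then obtain i where i: "i \<in> A - T" "s \<in> C i" by (auto simp: cycles_def)
    moreover have "s \<notin> cycles T" using C_in_cycles_iff[of T i s] i A by auto
    ultimately show "s \<in> cycles A - cycles T" by (auto simp: cycles_def)
  }
qed

lemma invariant_eq_cycles: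
  assumes A: "A \<subseteq> {..<L}" and X: "X \<subseteq> cycles A" "\<sigma> ` X = X"
  shows "\<exists>T\<subseteq>A. X = cycles T"
proof (intro exI conjI)
  let ?T = "{i \<in> A. C i \<inter> X \<noteq> {}}"
  show "?T \<subseteq> A" by auto
  show "X = cycles ?T"
  proof
    show "X \<subseteq> cycles ?T"
    proof
      fix s assume "s \<in> X"
      then obtain i where "i \<in> A" "s \<in> C i" using X(1) by (auto simp: cycles_def)
      then show "s \<in> cycles ?T" unfolding cycles_def using \<open>s \<in> X\<close> by blast
    qed
    show "cycles ?T \<subseteq> X"
    proof
      fix s assume "s \<in> cycles ?T"
      then obtain i r where "i \<in> A" "s \<in> C i" "r \<in> C i" "r \<in> X" by (auto simp: cycles_def)
      then show "s \<in> X" using C_minimal[of i r X] X(2) A by auto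
    qed
  qed
qed

lemma fixed_matchings_eq:
  assumes A: "A \<subseteq> {..<L}"
  shows "{\<pi> \<in> matchings (cycles A). map_prod \<alpha> \<beta> ` \<pi> = \<pi>} = (\<Union>T\<in>Pow A. pairings T)"
proof (intro set_eqI iffI)
  fix \<pi> assume \<pi>: "\<pi> \<in> {\<pi> \<in> matchings (cycles A). map_prod \<alpha> \<beta> ` \<pi> = \<pi>}"
  then have fixed: "map_prod \<alpha> \<beta> ` \<pi> = \<pi>" and m: "matching \<pi>" "cov \<pi> \<subseteq> cycles A"
    unfolding matchings_def by blast+
  have "\<sigma> ` cov \<pi> = cov \<pi>" using cov_map_prod[of \<alpha> \<beta> \<pi>] unfolding fixed by (rule sym)
  from invariant_eq_cycles[OF A m(2) this] obtain T where T: "T \<subseteq> A" "cov \<pi> = cycles T" by blast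
  have "\<pi> \<in> pairings T" unfolding pairings_def mem_Collect_eq using fixed m(1) T(2) by (intro conjI)
  then show "\<pi> \<in> (\<Union>T\<in>Pow A. pairings T)" using T(1) by blast
next
  fix \<pi> assume "\<pi> \<in> (\<Union>T\<in>Pow A. pairings T)"
  then obtain T where "T \<subseteq> A" "\<pi> \<in> pairings T" by blast
  moreover from this have "cycles T \<subseteq> cycles A" by (force simp: cycles_def)
  ultimately show "\<pi> \<in> {\<pi> \<in> matchings (cycles A). map_prod \<alpha> \<beta> ` \<pi> = \<pi>}"
    by (simp add: pairings_def matchings_def)
qed

lemma cycle_trace_eq_sum_harmonic:
  fixes U :: "complex^'n^'n"
  assumes A: "A \<subseteq> {..<L}" and U: "invertible U"
  shows "cycle_trace \<sigma> U (cycles A)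
    = (\<Sum>T\<in>Pow A. of_nat (card (pairings T)) * harmonic_trace \<alpha> \<beta> U (cycles (A - T)))"
proof -
  have finA: "finite A" using A finite_subset by blast
  have fin: "finite (pairings T)" if "T \<subseteq> A" for T
  proof (rule finite_subset)
    have "cycles T \<subseteq> cycles A" using that by (force simp: cycles_def)
    then show "pairings T \<subseteq> matchings (cycles A)" by (auto simp: pairings_def matchings_def)
    show "finite (matchings (cycles A))" by (rule finite_matchings[OF finite_cycles[OF A]])
  qed
  have "cycle_trace \<sigma> U (cycles A) = cfun.trace_on (forms (cycles A)) (permute \<alpha> \<beta> \<circ> act U (cycles A))"
    unfolding cycle_trace_def by (rule trace_on_forms[symmetric, OF finite_cycles[OF A] cycles_invariant[OF A]])
  also have "\<dots> = (\<Sum>\<pi> | \<pi> \<in> matchings (cycles A) \<and> map_prod \<alpha> \<beta> ` \<pi> = \<pi>. harmonic_trace \<alpha> \<beta> U (cycles A - cov \<pi>))"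
    by (rule trace_on_forms_eq_sum_harmonic[OF cycles_subset_slots[OF A] cycles_invariant[OF A] U inj_\<alpha> inj_\<beta>])
  also have "\<dots> = (\<Sum>T\<in>Pow A. \<Sum>\<pi>\<in>pairings T. harmonic_trace \<alpha> \<beta> U (cycles A - cov \<pi>))"
    unfolding fixed_matchings_eq[OF A]
  proof (rule sum.UNION_disjoint)
    show "\<forall>T\<in>Pow A. \<forall>T'\<in>Pow A. T \<noteq> T' \<longrightarrow> pairings T \<inter> pairings T' = {}"
    proof (intro ballI impI)
      fix T T' assume "T \<in> Pow A" "T' \<in> Pow A" "T \<noteq> T'"
      then have "cycles T \<noteq> cycles T'" using cycles_inj[of T T'] A by blast
      then show "pairings T \<inter> pairings T' = {}" by (auto simp: pairings_def)
    qed
  qed (use finA fin in auto)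
  also have "\<dots> = (\<Sum>T\<in>Pow A. \<Sum>\<pi>\<in>pairings T. harmonic_trace \<alpha> \<beta> U (cycles (A - T)))"
  proof (intro sum.cong refl)
    fix T \<pi> assume "T \<in> Pow A" "\<pi> \<in> pairings T"
    then show "harmonic_trace \<alpha> \<beta> U (cycles A - cov \<pi>) = harmonic_trace \<alpha> \<beta> U (cycles (A - T))"
      using cycles_diff[OF A, of T] by (simp add: pairings_def)
  qed
  finally show ?thesis by simp
qed

lemma cycle_trace_cycles:
  assumes "A \<subseteq> {..<L}"
  shows "cycle_trace \<sigma> U (cycles A) = (\<Prod>i\<in>A. cycle_trace \<sigma> U (C i))"
proof -
  have "finite A" using assms finite_subset by blast
  then show ?thesis using assms
  proof (induction A rule: finite_induct)
    case empty
    then show ?case by (simp add: cycles_def)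
  next
    case (insert i A)
    have ins: "cycles (insert i A) = C i \<union> cycles A" by (simp add: cycles_def)
    have "C i \<inter> cycles A = {}"
      using C_in_cycles_iff[of A i] insert.prems insert.hyps(2) by auto
    moreover have "finite (C i)" using finite_cycles[of "{i}"] insert.prems by (simp add: cycles_def)
    ultimately have "cycle_trace \<sigma> U (cycles (insert i A)) = cycle_trace \<sigma> U (C i) * cycle_trace \<sigma> U (cycles A)"
      unfolding ins using insert.prems finite_cycles[of A] C_invariant[of i] cycles_invariant[of A]
      by (intro cycle_trace_union) auto
    then show ?case using insert by simp
  qed
qed

lemma pairings_empty: "pairings {} = {{}}"
  by (auto simp: pairings_def cycles_def cov_def matching_def)

text \<open>Forms without slots are the constants. This normalization turns the term
  \<open>T = A\<close> of the expansion into the bare count of matchings.\<close>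

lemma harmonic_trace_empty: "harmonic_trace \<alpha> \<beta> U {} = 1"
  for U :: "complex^'n^'n"
proof -
  have "harmonic {} = (forms {} :: 'n form set)" by (auto simp: harmonic_def)
  then show ?thesis
    unfolding harmonic_trace_def using trace_on_forms[of "{}" \<alpha> \<beta> U] by simp
qed

text \<open>Integrating the expansion kills the harmonic trace of every nonempty set of cycles, so
  only the term \<open>T = A\<close> remains. The bound by N limits the number of slots
  involved.\<close>

lemma haar_mean_cycle_trace:
  fixes M :: "(complex^'n^'n) measure"
  assumes M: "haar_measure_unitary M" and nm: "n + m \<le> CARD('n)" and A: "A \<subseteq> {..<L}"
  shows "integrable M (\<lambda>U. cycle_trace \<sigma> U (cycles A))"
    and "(LINT U|M. cycle_trace \<sigma> U (cycles A)) = of_nat (card (pairings A))"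
proof -
  interpret prob_space M using M by (simp add: haar_measure_unitary_def)
  have finA: "finite A" using A finite_subset by blast
  have int: "integrable M (\<lambda>U. harmonic_trace \<alpha> \<beta> U (cycles B))"
    and mean: "(LINT U|M. harmonic_trace \<alpha> \<beta> U (cycles B)) = (if B = {} then 1 else 0)" if B: "B \<subseteq> A" for B
  proof -
    have BL: "B \<subseteq> {..<L}" using B A by blast
    have "integrable M (\<lambda>U. harmonic_trace \<alpha> \<beta> U (cycles B))
      \<and> (LINT U|M. harmonic_trace \<alpha> \<beta> U (cycles B)) = (if B = {} then 1 else 0)"
    proof (cases "B = {}")
      case True
      then show ?thesis by (simp add: cycles_def harmonic_trace_empty prob_space)
    next
      case False
      then have "cycles B \<noteq> {}" using C_nonempty BL by (auto simp: cycles_def)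
      moreover have "card (cycles B) \<le> CARD('n)"
      proof -
        have "card (cycles B) \<le> card slots"
          by (rule card_mono[OF finite_slots cycles_subset_slots[OF BL]])
        also have "\<dots> \<le> n + m"
          unfolding list_slots_def by (rule order_trans[OF card_Un_le]) (simp add: card_image)
        finally show ?thesis using nm by simp
      qed
      ultimately show ?thesis
        using haar_mean_harmonic_trace[OF M finite_cycles[OF BL] _ _ inj_\<alpha> inj_\<beta> cycles_invariant[OF BL]] False
        by simp
    qed
    then show "integrable M (\<lambda>U. harmonic_trace \<alpha> \<beta> U (cycles B))"
      "(LINT U|M. harmonic_trace \<alpha> \<beta> U (cycles B)) = (if B = {} then 1 else 0)" by auto
  qed
  let ?h = "\<lambda>U. \<Sum>T\<in>Pow A. of_nat (card (pairings T)) * harmonic_trace \<alpha> \<beta> U (cycles (A - T))"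
  have eq: "cycle_trace \<sigma> U (cycles A) = ?h U" if "U \<in> space M" for U
    using that space_haar[OF M] by (intro cycle_trace_eq_sum_harmonic[OF A] unitary_invertible) simp
  have "integrable M ?h"
    by (intro Bochner_Integration.integrable_sum integrable_mult_right int) auto
  moreover have "integrable M (\<lambda>U. cycle_trace \<sigma> U (cycles A)) \<longleftrightarrow> integrable M ?h"
    by (rule Bochner_Integration.integrable_cong[OF refl]) (rule eq)
  ultimately show "integrable M (\<lambda>U. cycle_trace \<sigma> U (cycles A))" by simp
  have "(LINT U|M. cycle_trace \<sigma> U (cycles A)) = (LINT U|M. ?h U)"
    by (rule Bochner_Integration.integral_cong[OF refl eq])
  also have "\<dots> = (\<Sum>T\<in>Pow A. LINT U|M. of_nat (card (pairings T)) * harmonic_trace \<alpha> \<beta> U (cycles (A - T)))"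
    by (intro Bochner_Integration.integral_sum integrable_mult_right int) auto
  also have "\<dots> = (\<Sum>T\<in>Pow A. if T = A then of_nat (card (pairings T)) else 0)"
    by (intro sum.cong refl) (auto simp: mean)
  also have "\<dots> = of_nat (card (pairings A))" using finA by simp
  finally show "(LINT U|M. cycle_trace \<sigma> U (cycles A)) = of_nat (card (pairings A))" .
qed

text \<open>By \<open>cycle_trace_eq_sum_harmonic\<close> the products of power sums are the
  convolution of their moments with the harmonic traces. Inverting it gives the harmonic trace the
  coefficients of the explicit Wick polynomial.\<close>

theorem harmonic_trace_eq_wick_product:
  fixes M :: "(complex^'n^'n) measure"
  assumes M: "haar_measure_unitary M" and nm: "n + m \<le> CARD('n)" and U: "U \<in> unitary_group"
    and Xs: "length Xs = L" "\<And>i V. i < L \<Longrightarrow> V \<in> unitary_group \<Longrightarrow> (Xs ! i) V = cycle_trace \<sigma> V (C i)"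
  shows "harmonic_trace \<alpha> \<beta> U slots = wick_product M Xs U"
proof -
  let ?I = "{..<L}" and ?E = "\<lambda>T. of_nat (card (pairings T)) :: complex"
  have prob: "prob_space M" using M by (simp add: haar_measure_unitary_def)
  have prod: "(\<Prod>i\<in>A. (Xs ! i) V) = cycle_trace \<sigma> V (cycles A)" if "A \<subseteq> ?I" "V \<in> unitary_group" for A V
    unfolding cycle_trace_cycles[OF that(1)] using that by (intro prod.cong refl Xs(2)) auto
  have prod': "(\<Prod>i\<in>A. (Xs ! i) V) = cycle_trace \<sigma> V (cycles A)" if "A \<subseteq> ?I" "V \<in> space M" for A V
    using prod that space_haar[OF M] by blast
  have "wick_poly M (\<lambda>i. Xs ! i) ?I = explicit_wick_poly ?E ?I"
  proof (rule wick_poly_eq_explicit[OF prob finite_lessThan])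
    fix A assume A: "A \<subseteq> ?I"
    have "integrable M (\<lambda>V. \<Prod>i\<in>A. (Xs ! i) V) \<longleftrightarrow> integrable M (\<lambda>V. cycle_trace \<sigma> V (cycles A))"
      by (rule Bochner_Integration.integrable_cong[OF refl]) (rule prod'[OF A])
    then show "integrable M (\<lambda>V. \<Prod>i\<in>A. (Xs ! i) V)"
      using haar_mean_cycle_trace(1)[OF M nm A] by simp
    have "(LINT V|M. (\<Prod>i\<in>A. (Xs ! i) V)) = (LINT V|M. cycle_trace \<sigma> V (cycles A))"
      by (rule Bochner_Integration.integral_cong[OF refl]) (rule prod'[OF A])
    then show "?E A = (LINT V|M. (\<Prod>i\<in>A. (Xs ! i) V))"
      using haar_mean_cycle_trace(2)[OF M nm A] by simp
  qed simp
  then have "wick_product M Xs U = (\<Sum>A\<in>Pow ?I. wick_coeff ?E (?I - A) * (\<Prod>i\<in>A. (Xs ! i) U))"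
    by (simp add: wick_product_def Xs(1) eval_explicit_wick_poly)
  also have "\<dots> = (\<Sum>A\<in>Pow ?I. wick_coeff ?E (?I - A) * cycle_trace \<sigma> U (cycles A))"
    using prod U by (intro sum.cong refl) auto
  also have "\<dots> = harmonic_trace \<alpha> \<beta> U (cycles ?I)"
  proof (rule wick_inversion[symmetric, of ?I ?E "\<lambda>A. cycle_trace \<sigma> U (cycles A)"])
    show "?E {} = 1" by (simp add: pairings_empty)
    show "cycle_trace \<sigma> U (cycles s) = (\<Sum>T\<in>Pow s. ?E T * harmonic_trace \<alpha> \<beta> U (cycles (s - T)))" if "s \<subseteq> ?I" for s
      by (rule cycle_trace_eq_sum_harmonic[OF that unitary_invertible[OF U]])
  qed auto
  also have "cycles ?I = slots" using C_union by (simp add: cycles_def)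
  finally show ?thesis by simp
qed

end

section \<open>Cycles of permutations as slot sets\<close>

lemma cycle_trace_Inl_orbit:
  assumes "permutation \<alpha>"
  shows "cycle_trace (map_sum \<alpha> \<beta>) U (Inl ` orbit \<alpha> s) = power_sum (card (orbit \<alpha> s)) U"
proof -
  let ?O = "orbit \<alpha> s"
  obtain c where c: "bij_betw c {..<card ?O} ?O" "\<And>i. i < card ?O \<Longrightarrow> \<alpha> (c i) = c (Suc i mod card ?O)" "card ?O > 0"
    using orbit_cycle[OF assms] by metis
  have "bij_betw (Inl \<circ> c) {..<card ?O} (Inl ` ?O :: slot set)"
    by (rule bij_betw_trans[OF c(1)]) (simp add: bij_betw_def)
  from sum_assign_cycle[OF c(3) this, of "map_sum \<alpha> \<beta>" U] c(2)
  have "(\<Sum>x\<in>assign (Inl ` ?O). \<Prod>s\<in>Inl ` ?O. U $ x (map_sum \<alpha> \<beta> s) $ x s) = power_sum (card ?O) U"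
    by simp
  moreover have "slot_entry U s i j = U $ i $ j" if "s \<in> Inl ` ?O" for s i j
    using that by (auto simp: slot_entry_def)
  ultimately show ?thesis unfolding cycle_trace_def by (simp cong: prod.cong)
qed

text \<open>Dual slots carry the transposed inverse, and power sums do not see the
  transposition.\<close>

lemma cycle_trace_Inr_orbit:
  assumes "permutation \<beta>"
  shows "cycle_trace (map_sum \<alpha> \<beta>) U (Inr ` orbit \<beta> s) = power_sum (card (orbit \<beta> s)) (matrix_inv U)"
proof -
  let ?O = "orbit \<beta> s" and ?A = "transpose (matrix_inv U)"
  obtain c where c: "bij_betw c {..<card ?O} ?O" "\<And>i. i < card ?O \<Longrightarrow> \<beta> (c i) = c (Suc i mod card ?O)" "card ?O > 0"
    using orbit_cycle[OF assms] by metis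
  have "bij_betw (Inr \<circ> c) {..<card ?O} (Inr ` ?O :: slot set)"
    by (rule bij_betw_trans[OF c(1)]) (simp add: bij_betw_def)
  from sum_assign_cycle[OF c(3) this, of "map_sum \<alpha> \<beta>" ?A] c(2)
  have "(\<Sum>x\<in>assign (Inr ` ?O). \<Prod>s\<in>Inr ` ?O. ?A $ x (map_sum \<alpha> \<beta> s) $ x s) = power_sum (card ?O) ?A"
    by simp
  moreover have "slot_entry U s i j = ?A $ i $ j" if "s \<in> Inr ` ?O" for s i j
    using that by (auto simp: slot_entry_def transpose_def)
  ultimately show ?thesis unfolding cycle_trace_def by (simp add: power_sum_transpose cong: prod.cong)
qed

lemma orbit_minimal:
  assumes "t \<in> orbit \<alpha> s" "permutation \<alpha>" "t \<in> X" "\<alpha> ` X \<subseteq> X"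
  shows "orbit \<alpha> s \<subseteq> X"
proof
  fix r assume "r \<in> orbit \<alpha> s"
  have "s \<in> orbit \<alpha> t"
    by (rule orbit_swap[OF permutation_self_in_orbit[OF assms(2)] assms(1)])
  then have "r \<in> orbit \<alpha> t" using \<open>r \<in> orbit \<alpha> s\<close> orbit_trans by metis
  then show "r \<in> X" by induction (use assms in auto)
qed

lemma orbit_image:
  assumes "permutation \<alpha>"
  shows "\<alpha> ` orbit \<alpha> s = orbit \<alpha> s"
proof
  show "\<alpha> ` orbit \<alpha> s \<subseteq> orbit \<alpha> s" by (auto intro: orbit.step)
  show "orbit \<alpha> s \<subseteq> \<alpha> ` orbit \<alpha> s"
  proof
    fix t assume "t \<in> orbit \<alpha> s"
    then show "t \<in> \<alpha> ` orbit \<alpha> s"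
      by cases (use permutation_self_in_orbit[OF assms] in auto)
  qed
qed

lemma orbit_disjoint: "permutation \<alpha> \<Longrightarrow> orbit \<alpha> s \<noteq> orbit \<alpha> t \<Longrightarrow> orbit \<alpha> s \<inter> orbit \<alpha> t = {}"
  by (metis disjoint_iff orbit_minimal orbit_image order_refl subset_antisym)

text \<open>For slots of one kind there is nothing to contract and all forms are harmonic. This
  accounts for the conventions when a partition is empty.\<close>

lemma harmonic_trace_no_pairs:
  fixes U :: "complex^'n::finite^'n"
  assumes "finite S" "map_sum \<alpha> \<beta> ` S = S" "\<And>a b. \<not> (Inl a \<in> S \<and> Inr b \<in> S)"
  shows "harmonic_trace \<alpha> \<beta> U S = cycle_trace (map_sum \<alpha> \<beta>) U S"
proof -
  have "harmonic S = (forms S :: 'n form set)" using assms(3) by (auto simp: harmonic_def)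
  then show ?thesis
    unfolding harmonic_trace_def cycle_trace_def using trace_on_forms[OF assms(1,2)] by simp
qed

lemma harmonic_trace_cycle_types:
  fixes haar :: "(complex^'n::finite^'n) measure"
  assumes haar: "haar_measure_unitary haar" and U: "U \<in> unitary_group"
    and \<alpha>: "has_cycle_type n \<alpha> l" and \<beta>: "has_cycle_type m \<beta> k" and nm: "n + m \<le> CARD('n)"
  shows "harmonic_trace \<alpha> \<beta> U (list_slots n m) = wick_product haar (power_sum_family l k) U"
    and "cycle_trace (map_sum \<alpha> \<beta>) U (list_slots n m) = power_sums l U * power_sums k (matrix_inv U)"
proof -
  have perm: "\<alpha> permutes {..<n}" "\<beta> permutes {..<m}"
    using \<alpha> \<beta> by (auto simp: has_cycle_type_def)
  then have p: "permutation \<alpha>" "permutation \<beta>" by (auto simp: permutation_permutes)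
  obtain os where os: "distinct os" "set os = orbit \<alpha> ` {..<n}" "map card os = l"
    using has_cycle_type_orbit_list[OF \<alpha>] .
  obtain qs where qs: "distinct qs" "set qs = orbit \<beta> ` {..<m}" "map card qs = k"
    using has_cycle_type_orbit_list[OF \<beta>] .
  have len: "length os = length l" "length qs = length k" using os(3) qs(3) by auto
  \<comment> \<open>The order of \<open>power_sum_family\<close>: first the \<open>V\<close> cycles,
    then the dual ones.\<close>
  define Cs where "Cs = map ((`) Inl) os @ map ((`) Inr) qs"
  define L where "L = length l + length k"
  have Cs_len: "length Cs = L" by (simp add: Cs_def L_def len)
  have set_Cs: "set Cs = (\<lambda>s. Inl ` orbit \<alpha> s) ` {..<n} \<union> (\<lambda>s. Inr ` orbit \<beta> s) ` {..<m}"
    by (simp add: Cs_def os(2) qs(2) image_image)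
  have "inj ((`) (Inl :: nat \<Rightarrow> slot))" "inj ((`) (Inr :: nat \<Rightarrow> slot))"
    by (auto simp: inj_image_eq_iff intro!: injI)
  \<comment> \<open>An image under \<open>Inl\<close> equals one under \<open>Inr\<close> only if
    both are empty, and no orbit is.\<close>
  moreover have "{} \<notin> set os" using os(2) orbit_nonempty by (metis imageE)
  moreover have "X = {}" if eq: "Inl ` X = (Inr ` Y :: slot set)" for X Y
  proof -
    have False if "x \<in> X" for x
    proof -
      have "Inl x \<in> (Inr ` Y :: slot set)" unfolding eq[symmetric] using that by (rule imageI)
      then show False by auto
    qed
    then show ?thesis by blast
  qed
  ultimately have "distinct Cs"
    using os(1) qs(1) unfolding Cs_def distinct_append distinct_map
    by (auto intro: inj_on_subset)
  have Cs_cases: "(\<exists>s<n. Cs ! i = Inl ` orbit \<alpha> s) \<or> (\<exists>s<m. Cs ! i = Inr ` orbit \<beta> s)" if "i < L" for i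
    using that nth_mem[of i Cs] Cs_len unfolding set_Cs by auto
  \<comment> \<open>The indices are numbered from 0 to N - 1, which reaches all values below
    \<open>n + m\<close>.\<close>
  obtain num :: "'n \<Rightarrow> nat" where num: "bij_betw num UNIV {..<CARD('n)}"
    using ex_bij_betw_finite_nat[of "UNIV :: 'n set"] by (auto simp: lessThan_atLeast0)
  interpret index_numbering num n m
  proof
    show "inj num" using num by (simp add: bij_betw_def)
    fix j assume "j < n + m"
    then have "j \<in> num ` UNIV" using num nm by (auto simp: bij_betw_def)
    then show "\<exists>k. num k = j" by auto
  qed
  interpret cycle_family num n m \<alpha> \<beta> "\<lambda>i. Cs ! i" L
  proof
    show "\<alpha> permutes {..<n}" "\<beta> permutes {..<m}" by fact+
    fix i assume i: "i < L"
    show "Cs ! i \<noteq> {}" using Cs_cases[OF i] by (auto simp: orbit_nonempty)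
    show "map_sum \<alpha> \<beta> ` (Cs ! i) = Cs ! i"
    proof -
      have "map_sum \<alpha> \<beta> ` Inl ` X = Inl ` \<alpha> ` X" "map_sum \<alpha> \<beta> ` Inr ` X = Inr ` \<beta> ` X" for X
        by (simp_all add: image_image)
      then show ?thesis
        using Cs_cases[OF i] orbit_image[OF p(1)] orbit_image[OF p(2)] by metis
    qed
    show "Cs ! i \<inter> Cs ! j = {}" if "j < L" "i \<noteq> j" for j
    proof -
      have "Cs ! i \<noteq> Cs ! j" using \<open>distinct Cs\<close> i that Cs_len by (simp add: nth_eq_iff_index_eq)
      have same: "Inl ` X \<inter> Inl ` Y = ({} :: slot set)" "Inr ` X \<inter> Inr ` Y = ({} :: slot set)" if "X \<inter> Y = {}" for X Y
        using that by auto
      have mixed: "Inl ` X \<inter> Inr ` Y = ({} :: slot set)" "Inr ` X \<inter> Inl ` Y = ({} :: slot set)" for X Y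
        by auto
      show ?thesis
        using Cs_cases[OF i] Cs_cases[OF that(1)] \<open>Cs ! i \<noteq> Cs ! j\<close>
      proof (elim disjE exE conjE)
        fix r s assume "Cs ! i = Inl ` orbit \<alpha> r" "Cs ! j = Inl ` orbit \<alpha> s" "Cs ! i \<noteq> Cs ! j"
        then show ?thesis using same(1)[OF orbit_disjoint[OF p(1), of r s]] by metis
      next
        fix r s assume "Cs ! i = Inr ` orbit \<beta> r" "Cs ! j = Inr ` orbit \<beta> s" "Cs ! i \<noteq> Cs ! j"
        then show ?thesis using same(2)[OF orbit_disjoint[OF p(2), of r s]] by metis
      qed (simp_all only: mixed)
    qed
    show "Cs ! i \<subseteq> X" if "s \<in> Cs ! i" "s \<in> X" "map_sum \<alpha> \<beta> ` X \<subseteq> X" for s X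
      using Cs_cases[OF i]
    proof (elim disjE exE conjE)
      fix r assume r: "Cs ! i = Inl ` orbit \<alpha> r"
      then obtain a where a: "s = Inl a" "a \<in> orbit \<alpha> r" using \<open>s \<in> Cs ! i\<close> by auto
      have "\<alpha> ` (Inl -` X) \<subseteq> Inl -` X" using that(3) by force
      from orbit_minimal[OF a(2) p(1) _ this] show "Cs ! i \<subseteq> X" using r a(1) that(2) by auto
    next
      fix r assume r: "Cs ! i = Inr ` orbit \<beta> r"
      then obtain a where a: "s = Inr a" "a \<in> orbit \<beta> r" using \<open>s \<in> Cs ! i\<close> by auto
      have "\<beta> ` (Inr -` X) \<subseteq> Inr -` X" using that(3) by force
      from orbit_minimal[OF a(2) p(2) _ this] show "Cs ! i \<subseteq> X" using r a(1) that(2) by auto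
    qed
  next
    have "(\<Union>i<L. Cs ! i) = \<Union> (set Cs)"
      using Cs_len by (auto simp: set_conv_nth)
    also have "\<dots> = slots"
    proof -
      have "(\<Union>s<n. orbit \<alpha> s) = {..<n}" "(\<Union>s<m. orbit \<beta> s) = {..<m}"
        using permutes_orbit_subset[OF perm(1)] permutes_orbit_subset[OF perm(2)]
          permutation_self_in_orbit[OF p(1)] permutation_self_in_orbit[OF p(2)] by blast+
      then have "Inl ` (\<Union>s<n. orbit \<alpha> s) \<union> Inr ` (\<Union>s<m. orbit \<beta> s) = slots"
        by (simp add: list_slots_def)
      then show ?thesis by (simp add: set_Cs image_UN)
    qed
    finally show "(\<Union>i<L. Cs ! i) = slots" .
  qed
  let ?Xs = "power_sum_family l k :: (complex^'n^'n \<Rightarrow> complex) list"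
  have Xs_len: "length ?Xs = L" by (simp add: power_sum_family_def L_def)
  have Xs: "(?Xs ! i) V = cycle_trace (map_sum \<alpha> \<beta>) V (Cs ! i)" if "i < L" for i V
  proof (cases "i < length l")
    case True
    then obtain s where s: "os ! i = orbit \<alpha> s" using nth_mem[of i os] os(2) len by auto
    have "l ! i = card (os ! i)" using True os(3) len by (metis nth_map)
    then show ?thesis
      using True cycle_trace_Inl_orbit[OF p(1), of \<beta> V s] len
      by (simp add: power_sum_family_def Cs_def nth_append s)
  next
    case False
    let ?j = "i - length l"
    have j: "?j < length k" using False that by (simp add: L_def)
    then obtain s where s: "qs ! ?j = orbit \<beta> s" using nth_mem[of ?j qs] qs(2) len by auto
    have "k ! ?j = card (qs ! ?j)" using j qs(3) len by (metis nth_map)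
    then show ?thesis
      using False j cycle_trace_Inr_orbit[OF p(2), of \<alpha> V s] len
      by (simp add: power_sum_family_def Cs_def nth_append s)
  qed
  show "harmonic_trace \<alpha> \<beta> U (list_slots n m) = wick_product haar ?Xs U"
    using harmonic_trace_eq_wick_product[OF haar nm U Xs_len Xs] .
  have "cycle_trace (map_sum \<alpha> \<beta>) U slots = (\<Prod>i<L. (?Xs ! i) U)"
    using cycle_trace_cycles[of "{..<L}" U] C_union Xs by (simp add: cycles_def)
  also have "\<dots> = prod_list (map (\<lambda>X. X U) ?Xs)"
    using Xs_len by (simp add: prod.list_conv_set_nth lessThan_atLeast0)
  also have "\<dots> = power_sums l U * power_sums k (matrix_inv U)"
    by (simp add: power_sum_family_def power_sums_def o_def)
  finally show "cycle_trace (map_sum \<alpha> \<beta>) U (list_slots n m) = power_sums l U * power_sums k (matrix_inv U)"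
    .
qed

theorem propositionD1:
  fixes haar :: "(complex^'n^'n) measure"
    and U :: "complex^'n^'n"
    and lam mu :: "nat list"
  assumes "haar_measure_unitary haar"
    and "int_partition lam" and "int_partition mu"
    and "sum_list lam + sum_list mu \<le> CARD('n)"
    and "U \<in> unitary_group"
  shows "newton_poly lam mu U = wick_product haar (power_sum_family lam mu) U"
proof -
  \<comment> \<open>These are the permutations chosen by \<open>newton_poly\<close>; the result for
    arbitrary permutations of the given cycle types is applied to them.\<close>
  define \<alpha> where "\<alpha> = (SOME \<alpha>. has_cycle_type (sum_list lam) \<alpha> lam)"
  define \<beta> where "\<beta> = (SOME \<beta>. has_cycle_type (sum_list mu) \<beta> mu)"
  have \<alpha>: "has_cycle_type (sum_list lam) \<alpha> lam"
    unfolding \<alpha>_def by (rule someI_ex[OF ex_has_cycle_type]) (use assms(2) in \<open>simp add: int_partition_def\<close>)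
  have \<beta>: "has_cycle_type (sum_list mu) \<beta> mu"
    unfolding \<beta>_def by (rule someI_ex[OF ex_has_cycle_type]) (use assms(3) in \<open>simp add: int_partition_def\<close>)
  let ?S = "list_slots (sum_list lam) (sum_list mu)"
  have perm: "\<alpha> permutes {..<sum_list lam}" "\<beta> permutes {..<sum_list mu}"
    using \<alpha> \<beta> by (auto simp: has_cycle_type_def)
  have "map_sum \<alpha> \<beta> ` ?S = Inl ` \<alpha> ` {..<sum_list lam} \<union> Inr ` \<beta> ` {..<sum_list mu}"
    by (simp add: list_slots_def image_Un image_image)
  then have invariant: "map_sum \<alpha> \<beta> ` ?S = ?S"
    by (simp only: permutes_image[OF perm(1)] permutes_image[OF perm(2)] list_slots_def)
  note trace = harmonic_trace_cycle_types[OF assms(1,5) \<alpha> \<beta> assms(4)]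
  have one_sided: "harmonic_trace \<alpha> \<beta> U ?S = power_sums lam U * power_sums mu (matrix_inv U)"
    if "lam = [] \<or> mu = []"
    using that invariant unfolding trace(2)[symmetric]
    by (intro harmonic_trace_no_pairs) (auto simp: list_slots_def)
  \<comment> \<open>For an empty first partition the convention uses the conjugate, the Wick family
    the inverse; they agree on unitary matrices.\<close>
  have "power_sums mu (matrix_inv U) = cnj (power_sums mu U)"
    unfolding power_sums_def unitary_inv[OF assms(5)] power_sum_conj_transpose
    by (induction mu) auto
  then have "newton_poly lam mu U = harmonic_trace \<alpha> \<beta> U ?S"
    using one_sided newton_perm_eq_harmonic_trace[OF perm unitary_invertible[OF assms(5)]]
    by (auto simp: newton_poly_def power_sums_def simp flip: \<alpha>_def \<beta>_def)
  then show ?thesis by (simp only: trace(1))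
qed

end
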